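(* Let $p$ be a prime, $K/\mathbb{Q}_p$ a finite totally ramified extension with $K\neq\mathbb{Q}_p$, $G=SL_3(K)$, $\Delta$ its Bruhat-Tits building with hyperspecial chamber $C$ and hyperspecial vertex $v_0\in C$, $I$ the pro-$p$ Iwahori subgroup, $k$ a field of characteristic $p$ and $\mathbb{X}=k[G/I]$. Let $\Delta_0$ be the set of vertices of $C$. Then $\Delta_0$ is a $\mathrm{Star}(v_0)$-collapsible region of $\Delta$.
   Context: Let $\mathcal{O}$ be the valuation ring of $K$, $\pi$ a uniformiser. $\Delta$ is the 2-dimensional simplicial complex whose vertices are homothety classes $[L]$ of full rank $\mathcal{O}$-lattices in $K^3$, two distinct vertices being joined by an edge iff they have representatives with $L_1\supseteq L_2\supseteq\pi L_1$, and whose facets are the cliques of this graph; chambers are the 2-simplices. $v_0=[\mathcal{O}e_1+\mathcal{O}e_2+\mathcal{O}e_3]$, $v_1=[\mathcal{O}e_1+\mathcal{O}e_2+\mathcal{O}\pi e_3]$, $v_2=[\mathcal{O}e_1+\mathcal{O}\pi e_2+\mathcal{O}\pi e_3]$, $C=\{v_0,v_1,v_2\}$. $\mathrm{Star}(v_0)$ is the collection of all chambers containing $v_0$, regarded also as the set of their vertices. For a facet $F$, $J_F$ is the subgroup of $G$ fixing every vertex of $F$. There is a connected $\mathcal{O}$-group scheme $\mathcal{G}_F$ (Bruhat-Tits) with generic fibre $SL_3$, $\mathcal{G}_F(\mathcal{O})=J_F$ and connected reduction mod $\pi$; $I_F$ is the subgroup of $g\in J_F$ whose reduction mod $\pi$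 lies in the unipotent radical of the special fibre. $I=I_C$ is the group of matrices in $SL_3(\mathcal{O})$ that are upper triangular unipotent mod $\pi$. Chains. An orientation of an $i$-facet ($i\ge1$) is an ordering of its vertices up to even permutation; $\sigma$ swaps the two orientations; vertices have one orientation. If $c=[y_0,\dots,y_i]$ is an orientation of $F$ and $F'=F\cup\{x\}$ is an $(i+1)$-facet, $c\uparrow^{F'}=[x,y_0,\dots,y_i]$ (for $i=0$: the oriented edge with target $y_0$). $C_i(\Delta,\mathbb{X})$ is the space of finitely supported functions $\alpha$ from oriented $i$-facets to $\mathbb{X}$ with $\alpha(F,c)\in\mathbb{X}^{I_F}$ and (for $i\geq1$) $\alpha(\sigma(F,c))=-\alpha(F,c)$. $\varepsilon_i:C_{i+1}(\Delta,\mathbb{X})\to C_i(\Delta,\mathbb{X})$ is $\varepsilon_i(\alpha)(F,c)=\sum_{F'}\alpha(F',c\uparrow^{F'})$, summing over $(i+1)$-facets $F'$ having $F$ as a face. $G$ acts by $(g\cdot\alpha)(F,c)=g\,\alpha(g^{-1}F,g^{-1}c)$. For a set of vertices $\mathcal{X}$, a facet lies in $\mathcal{X}$ if all its vertices do, and $C_i(\mathcal{X},\mathbb{X})$ consists of the chains in $C_i(\Delta,\mathbb{X})$ vanishing on all $i$-facets not lying in $\mathcal{X}$. Collapsibility. For an $I$-invariant set of vertices $\mathcal{X}$ put $M_{\mathcal{X}}=C_1(\mathcal{X},\mathbb{X})+\varepsilon_1(C_2(\Delta,\mathbb{X}))$. A chain $\beta\in C_1(\Delta,\mathbb{X})$ with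 $\varepsilon_0(\beta)\in C_0(\mathcal{X},\mathbb{X})$ is $(I,\mathcal{X})$-shift invariant if $g\cdot\beta-\beta\in M_{\mathcal{X}}$ for all $g\in I$. For an $I$-invariant region $\mathcal{L}\supseteq\mathcal{X}$, $\mathcal{X}$ is $\mathcal{L}$-collapsible if every $\beta\in C_1(\mathcal{L},\mathbb{X})$ which is $(I,\mathcal{X})$-shift invariant and satisfies $\varepsilon_0(\beta)\in C_0(\mathcal{X},\mathbb{X})$ lies in $M_{\mathcal{X}}$. *)

theory Defs
  imports
    "HOL-Analysis.Analysis"
    "HOL-Algebra.Left_Coset"
    "HOL-Algebra.Product_Groups"
    "HOL-Algebra.Algebraic_Closure_Type"
    "HOL-Combinatorics.Permutations"
    "HOL-Computational_Algebra.Fraction_Field"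
    "HOL-Library.Poly_Mapping"
    "Berlekamp_Zassenhaus.Finite_Field"
begin

unbundle no Formal_Power_Series.fps_syntax


section \<open>The field of p-adic numbers\<close>

text \<open>The prime \<open>p\<close> is the cardinality of a type of class \<^class>\<open>prime_card\<close>. A \<open>p\<close>-adic
  integer is a compatible sequence of residues modulo \<open>p ^ n\<close>, each represented in
  \<open>{0..<p ^ n}\<close>.\<close>

typedef ('p :: prime_card) padic_int =
  "{x :: nat \<Rightarrow> int. \<forall>n. x (Suc n) mod int CARD('p) ^ n = x n}"
  by (rule exI[of _ "\<lambda>_. 0"]) auto

setup_lifting type_definition_padic_int

lemma mod_power_Suc_mod:
  fixes a q :: int
  shows "a mod q ^ Suc n mod q ^ n = a mod q ^ n"
  by (rule mod_mod_cancel) simp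

lemma coherent_op:
  fixes x y x' y' q :: int
  assumes "x' mod q ^ n = x"
  shows "y' mod q ^ n = y \<Longrightarrow> (x' + y') mod q ^ Suc n mod q ^ n = (x + y) mod q ^ n"
    and "y' mod q ^ n = y \<Longrightarrow> (x' - y') mod q ^ Suc n mod q ^ n = (x - y) mod q ^ n"
    and "(- x') mod q ^ Suc n mod q ^ n = (- x) mod q ^ n"
    and "y' mod q ^ n = y \<Longrightarrow> (x' * y') mod q ^ Suc n mod q ^ n = (x * y) mod q ^ n"
  unfolding mod_power_Suc_mod using assms by (auto simp: mod_simps)

instantiation padic_int :: (prime_card) comm_ring_1
begin

lift_definition zero_padic_int :: "'a padic_int" is "\<lambda>_. 0" by simp

lift_definition one_padic_int :: "'a padic_int" is "\<lambda>n. 1 mod int CARD('a) ^ n"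
  by (simp only: mod_power_Suc_mod)

lift_definition plus_padic_int :: "'a padic_int \<Rightarrow> 'a padic_int \<Rightarrow> 'a padic_int"
  is "\<lambda>x y n. (x n + y n) mod int CARD('a) ^ n"
  by (rule coherent_op(1))

lift_definition minus_padic_int :: "'a padic_int \<Rightarrow> 'a padic_int \<Rightarrow> 'a padic_int"
  is "\<lambda>x y n. (x n - y n) mod int CARD('a) ^ n"
  by (rule coherent_op(2))

lift_definition uminus_padic_int :: "'a padic_int \<Rightarrow> 'a padic_int"
  is "\<lambda>x n. (- x n) mod int CARD('a) ^ n"
  by (rule coherent_op(3))

lift_definition times_padic_int :: "'a padic_int \<Rightarrow> 'a padic_int \<Rightarrow> 'a padic_int"
  is "\<lambda>x y n. (x n * y n) mod int CARD('a) ^ n"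
  by (rule coherent_op(4))

instance
proof
  have red: "f n mod int CARD('a) ^ n = f n"
    if "\<forall>n. f (Suc n) mod int CARD('a) ^ n = f n" for f n
    using that mod_mod_trivial[of "f (Suc n)" "int CARD('a) ^ n"] by simp
  fix a b c :: "'a padic_int"
  show "a + b + c = a + (b + c)"
    by transfer (auto simp: fun_eq_iff mod_simps add.assoc)
  show "a + b = b + a" by transfer (simp add: add.commute)
  show "0 + a = a" by transfer (auto simp: fun_eq_iff red)
  show "- a + a = 0" by transfer (auto simp: fun_eq_iff mod_simps)
  show "a - b = a + - b" by transfer (auto simp: fun_eq_iff mod_simps)
  show "a * b * c = a * (b * c)"
    by transfer (auto simp: fun_eq_iff mod_simps mult.assoc)
  show "a * b = b * a" by transfer (simp add: mult.commute)
  show "1 * a = a" by transfer (auto simp: fun_eq_iff mod_simps red)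
  show "(a + b) * c = a * c + b * c"
    by transfer (auto simp: fun_eq_iff mod_simps distrib_right)
  show "(0 :: 'a padic_int) \<noteq> 1"
  proof transfer
    have "1 < int CARD('a)" using prime_card[where 'a = 'a] prime_gt_1_nat by fastforce
    then have "(1 :: int) mod int CARD('a) ^ 1 = 1" by simp
    then show "(\<lambda>_. 0 :: int) \<noteq> (\<lambda>n. 1 mod int CARD('a) ^ n)"
      by (auto dest!: fun_cong[of _ _ 1])
  qed
qed

end

lemma padic_int_coherent:
  fixes x :: "nat \<Rightarrow> int"
  assumes "\<forall>n. x (Suc n) mod q ^ n = x n"
  shows "x (n + k) mod q ^ n = x n"
proof (induction k)
  case 0
  show ?case using assms mod_mod_trivial[of "x (Suc n)" "q ^ n"] by simp
next
  case (Suc k)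
  have "x (Suc (n + k)) mod q ^ (n + k) = x (n + k)" using assms by blast
  moreover have "q ^ n dvd q ^ (n + k)" by (simp add: le_imp_power_dvd)
  ultimately have "x (n + k) mod q ^ n = x (Suc (n + k)) mod q ^ n"
    using mod_mod_cancel[of "q ^ n" "q ^ (n + k)" "x (Suc (n + k))"] by simp
  with Suc show ?case by simp
qed

instance padic_int :: (prime_card) idom
proof
  fix a b :: "'a padic_int"
  assume "a \<noteq> 0" "b \<noteq> 0"
  then show "a * b \<noteq> 0"
  proof transfer
    let ?q = "int CARD('a)"
    fix x y :: "nat \<Rightarrow> int"
    assume x: "\<forall>n. x (Suc n) mod ?q ^ n = x n" "x \<noteq> (\<lambda>_. 0)"
    assume y: "\<forall>n. y (Suc n) mod ?q ^ n = y n" "y \<noteq> (\<lambda>_. 0)"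
    from x(2) obtain m where m: "x m \<noteq> 0" by auto
    from y(2) obtain n where n: "y n \<noteq> 0" by auto
    have "m \<noteq> 0" using x(1)[rule_format, of 0] m by (cases m) auto
    then obtain m' where m': "m = Suc m'" using not0_implies_Suc by blast
    have xm: "\<not> ?q ^ m dvd x (m + n)"
      using padic_int_coherent[OF x(1), of m n] m by auto
    have yn: "\<not> ?q ^ n dvd y (m + n)"
      using padic_int_coherent[OF y(1), of n m] n by (auto simp: add.commute)
    have "prime_elem ?q" using prime_card[where 'a = 'a] by simp
    then have "\<not> ?q ^ (m' + n) dvd x (m + n) * y (m + n)"
      using prime_elem_power_dvd_cases[of ?q "m' + n" "x (m + n)" "y (m + n)" m n] xm yn m'
      by auto
    then have "\<not> ?q ^ (m + n) dvd x (m + n) * y (m + n)"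
      using le_imp_power_dvd[of "m' + n" "m + n" ?q] m' by (auto dest: dvd_trans)
    then have "(x (m + n) * y (m + n)) mod ?q ^ (m + n) \<noteq> 0"
      by (simp add: dvd_eq_mod_eq_0)
    then show "(\<lambda>n. (x n * y n) mod ?q ^ n) \<noteq> (\<lambda>_. 0)" by (auto dest: fun_cong)
  qed
qed

type_synonym 'p padic = "'p padic_int fract"

definition padic_residue :: "'p :: prime_card padic_int \<Rightarrow> 'p mod_ring" where
  "padic_residue a = of_int (Rep_padic_int a 1)"

section \<open>Matrix groups and the unipotent radical\<close>

definition SL3 :: "('a :: field ^ 3 ^ 3) monoid" where
  "SL3 = \<lparr>carrier = {g. det g = 1}, monoid.mult = (**), one = mat 1\<rparr>"

text \<open>Polynomial functions and the Zariski topology on families of matrices. Linear algebraic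
  groups over an algebraically closed field are identified with their groups of points.\<close>

inductive_set polynomial_functions :: "(('i \<Rightarrow> 'a :: field ^ 3 ^ 3) \<Rightarrow> 'a) set" where
  const: "(\<lambda>h. c) \<in> polynomial_functions"
| coord: "(\<lambda>h. h x $ i $ j) \<in> polynomial_functions"
| add: "f \<in> polynomial_functions \<Longrightarrow> f' \<in> polynomial_functions \<Longrightarrow>
    (\<lambda>h. f h + f' h) \<in> polynomial_functions"
| mult: "f \<in> polynomial_functions \<Longrightarrow> f' \<in> polynomial_functions \<Longrightarrow>
    (\<lambda>h. f h * f' h) \<in> polynomial_functions"

definition zariski :: "('i \<Rightarrow> 'a :: field ^ 3 ^ 3) topology" where
  "zariski = topology_generated_by {{h. f h \<noteq> 0} | f. f \<in> polynomial_functions}"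

definition unipotent_matrix :: "'a :: field ^ 3 ^ 3 \<Rightarrow> bool" where
  "unipotent_matrix A \<longleftrightarrow> (\<exists>n. (((**) (A - mat 1)) ^^ n) (mat 1) = 0)"

text \<open>\<open>H\<close> is a closed subgroup of the product of copies of \<open>SL\<^sub>3\<close> indexed by \<open>F\<close>. The unipotent
  radical is the largest connected closed normal unipotent subgroup; as a largest one exists,
  it is the union of all of them.\<close>

definition unipotent_radical ::
    "'i set \<Rightarrow> ('i \<Rightarrow> 'a :: field ^ 3 ^ 3) monoid \<Rightarrow> ('i \<Rightarrow> 'a ^ 3 ^ 3) set" where
  "unipotent_radical F H = \<Union>{U. U \<lhd> H
     \<and> closedin (subtopology zariski (carrier H)) U
     \<and> connectedin zariski U
     \<and> (\<forall>h\<in>U. \<forall>x\<in>F. unipotent_matrix (h x))}"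

section \<open>Orientations\<close>

definition orientation :: "'a list \<Rightarrow> 'a list set" where
  "orientation ys = {permute_list s ys | s. s permutes {..<length ys} \<and> evenperm s}"

definition opposite :: "'a list set \<Rightarrow> 'a list set" where
  "opposite c = {permute_list s ys | s ys. ys \<in> c \<and> s permutes {..<length ys} \<and> \<not> evenperm s}"

text \<open>An orientation determines the facet that it orients.\<close>

definition underlying :: "'a list set \<Rightarrow> 'a set" where
  "underlying c = (\<Union>ys\<in>c. set ys)"

text \<open>For \<open>F' = underlying c \<union> {x}\<close> this is the orientation \<open>[x, y\<^sub>0, \<dots>, y\<^sub>i]\<close>
  where \<open>c = [y\<^sub>0, \<dots>, y\<^sub>i]\<close>.\<close>

definition extend_orientation :: "'a list set \<Rightarrow> 'a set \<Rightarrow> 'a list set" where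
  "extend_orientation c F' = (\<Union>x\<in>F' - underlying c. \<Union>ys\<in>c. orientation (x # ys))"

section \<open>Totally ramified extensions of the p-adic numbers\<close>

text \<open>\<open>\<iota>\<close> makes \<open>K\<close> a finite extension of the field of \<open>p\<close>-adic numbers, \<open>v\<close> is the normalised
  valuation of \<open>K\<close> (its value at \<open>0\<close> is irrelevant) and \<open>\<pi>\<close> is a uniformiser. That \<open>v\<close>
  extends the \<open>p\<close>-adic valuation up to scaling is expressed by comparing valuation rings.\<close>

locale padic_extension = field_hom \<iota>
  for \<iota> :: "'p :: prime_card padic \<Rightarrow> 'K :: field" +
  fixes v :: "'K \<Rightarrow> int" and \<pi> :: 'K
  assumes finite_extension: "\<exists>B. finite_dimensional_vector_space (\<lambda>c x. \<iota> c * x) B"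
    and v_mult: "x \<noteq> 0 \<Longrightarrow> y \<noteq> 0 \<Longrightarrow> v (x * y) = v x + v y"
    and v_add: "x \<noteq> 0 \<Longrightarrow> y \<noteq> 0 \<Longrightarrow> x + y \<noteq> 0 \<Longrightarrow> min (v x) (v y) \<le> v (x + y)"
    and v_extends: "z \<noteq> 0 \<Longrightarrow> 0 \<le> v (\<iota> z) \<longleftrightarrow> (\<exists>a. z = Fract a 1)"
    and uniformiser: "\<pi> \<noteq> 0" "v \<pi> = 1"
begin

definition valuation_ring :: "'K set" where
  "valuation_ring = {x. x = 0 \<or> 0 \<le> v x}"

definition maximal_ideal :: "'K set" where
  "maximal_ideal = {x. x = 0 \<or> 1 \<le> v x}"

end

text \<open>Totally ramified: the residue field extension is trivial.\<close>

locale totally_ramified_extension = padic_extension \<iota> v \<pi>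
  for \<iota> :: "'p :: prime_card padic \<Rightarrow> 'K :: field" and v :: "'K \<Rightarrow> int" and \<pi> :: 'K +
  assumes totally_ramified: "x \<in> valuation_ring \<Longrightarrow> \<exists>a. x - \<iota> (Fract a 1) \<in> maximal_ideal"
begin

text \<open>By total ramification the residue field is the field with \<open>p\<close> elements. The map
  below is the reduction modulo \<open>\<pi>\<close> on the valuation ring, and is only meaningful there.\<close>

definition residue_map :: "'K \<Rightarrow> 'p mod_ring" where
  "residue_map x = (THE r. \<exists>a. x - \<iota> (Fract a 1) \<in> maximal_ideal \<and> r = padic_residue a)"

definition integral_matrix :: "'K ^ 3 ^ 3 \<Rightarrow> bool" where
  "integral_matrix A \<longleftrightarrow> (\<forall>i j. A $ i $ j \<in> valuation_ring)"

definition reduce_matrix :: "'K ^ 3 ^ 3 \<Rightarrow> 'p mod_ring alg_closure ^ 3 ^ 3" where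
  "reduce_matrix A = (\<chi> i j. to_ac (residue_map (A $ i $ j)))"

subsection \<open>The building\<close>

definition lattice_of :: "'K ^ 3 ^ 3 \<Rightarrow> ('K ^ 3) set" where
  "lattice_of A = {A *v a | a. \<forall>i. a $ i \<in> valuation_ring}"

text \<open>The columns of an invertible matrix form a basis of \<open>K\<^sup>3\<close>.\<close>

definition lattices :: "('K ^ 3) set set" where
  "lattices = {lattice_of A | A. invertible A}"

definition homothety_class :: "('K ^ 3) set \<Rightarrow> ('K ^ 3) set set" where
  "homothety_class L = {(\<lambda>u. c *s u) ` L | c. c \<noteq> 0}"

definition vertices :: "('K ^ 3) set set set" where
  "vertices = homothety_class ` lattices"

definition adjacent :: "('K ^ 3) set set \<Rightarrow> ('K ^ 3) set set \<Rightarrow> bool" where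
  "adjacent x y \<longleftrightarrow> x \<noteq> y \<and> (\<exists>L\<^sub>1\<in>x. \<exists>L\<^sub>2\<in>y. L\<^sub>2 \<subseteq> L\<^sub>1 \<and> (\<lambda>u. \<pi> *s u) ` L\<^sub>1 \<subseteq> L\<^sub>2)"

definition facets :: "nat \<Rightarrow> ('K ^ 3) set set set set" where
  "facets i = {F. F \<subseteq> vertices \<and> finite F \<and> card F = Suc i
     \<and> (\<forall>x\<in>F. \<forall>y\<in>F. x \<noteq> y \<longrightarrow> adjacent x y)}"

definition v\<^sub>0 :: "('K ^ 3) set set" where
  "v\<^sub>0 = homothety_class {vector [a, b, c] | a b c.
     a \<in> valuation_ring \<and> b \<in> valuation_ring \<and> c \<in> valuation_ring}"

definition v\<^sub>1 :: "('K ^ 3) set set" where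
  "v\<^sub>1 = homothety_class {vector [a, b, \<pi> * c] | a b c.
     a \<in> valuation_ring \<and> b \<in> valuation_ring \<and> c \<in> valuation_ring}"

definition v\<^sub>2 :: "('K ^ 3) set set" where
  "v\<^sub>2 = homothety_class {vector [a, \<pi> * b, \<pi> * c] | a b c.
     a \<in> valuation_ring \<and> b \<in> valuation_ring \<and> c \<in> valuation_ring}"

definition C :: "('K ^ 3) set set set" where
  "C = {v\<^sub>0, v\<^sub>1, v\<^sub>2}"

definition Star :: "('K ^ 3) set set \<Rightarrow> ('K ^ 3) set set set" where
  "Star x = \<Union>{F \<in> facets 2. x \<in> F}"

definition act :: "'K ^ 3 ^ 3 \<Rightarrow> ('K ^ 3) set set \<Rightarrow> ('K ^ 3) set set" where
  "act g x = (\<lambda>L. (\<lambda>u. g *v u) ` L) ` x"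

subsection \<open>The subgroups attached to a facet\<close>

definition J :: "('K ^ 3) set set set \<Rightarrow> ('K ^ 3 ^ 3) set" where
  "J F = {g \<in> carrier SL3. \<forall>x\<in>F. act g x = x}"

text \<open>A basis of some lattice representing the vertex.\<close>

definition frame :: "('K ^ 3) set set \<Rightarrow> 'K ^ 3 ^ 3" where
  "frame x = (SOME A. invertible A \<and> x = homothety_class (lattice_of A))"

text \<open>For \<open>SL\<^sub>3\<close> the Bruhat-Tits scheme of a facet \<open>F\<close> is the scheme of automorphisms, of
  determinant one, of the periodic chain of all lattices representing the vertices of \<open>F\<close>. An
  automorphism is given by its components on one lattice \<open>L\<^sub>x\<close> for each vertex \<open>x\<close>, here the one
  with basis \<open>frame x\<close>, subject to commuting with all maps \<open>L\<^sub>y \<rightarrow> L\<^sub>x\<close> given by multiplication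
  with a scalar \<open>c\<close>. In terms of the bases, such a map has the matrix
  \<open>matrix_inv (frame x) ** mat c ** frame y\<close>. The following is the group of points
  of the special fibre over the algebraic closure of the residue field.\<close>

definition special_fibre ::
    "('K ^ 3) set set set \<Rightarrow> (('K ^ 3) set set \<Rightarrow> 'p mod_ring alg_closure ^ 3 ^ 3) monoid" where
  "special_fibre F = (product_group F (\<lambda>_. SL3))
     \<lparr>carrier := {h \<in> carrier (product_group F (\<lambda>_. SL3)). \<forall>x\<in>F. \<forall>y\<in>F. \<forall>c.
        let T = matrix_inv (frame x) ** mat c ** frame y in
          integral_matrix T \<longrightarrow> h x ** reduce_matrix T = reduce_matrix T ** h y}\<rparr>"

definition reduction ::
    "('K ^ 3) set set set \<Rightarrow> 'K ^ 3 ^ 3 \<Rightarrow> ('K ^ 3) set set \<Rightarrow> 'p mod_ring alg_closure ^ 3 ^ 3" where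
  "reduction F g = (\<lambda>x\<in>F. reduce_matrix (matrix_inv (frame x) ** g ** frame x))"

definition I\<^sub>F :: "('K ^ 3) set set set \<Rightarrow> ('K ^ 3 ^ 3) set" where
  "I\<^sub>F F = {g \<in> J F. reduction F g \<in> unipotent_radical F (special_fibre F)}"

text \<open>The pro-\<open>p\<close> Iwahori subgroup.\<close>

definition I :: "('K ^ 3 ^ 3) set" where
  "I = {g \<in> carrier SL3. integral_matrix g
     \<and> (\<forall>i. g $ i $ i - 1 \<in> maximal_ideal)
     \<and> g $ 2 $ 1 \<in> maximal_ideal \<and> g $ 3 $ 1 \<in> maximal_ideal \<and> g $ 3 $ 2 \<in> maximal_ideal}"

subsection \<open>Chains\<close>

text \<open>The permutation module \<open>k[G/I]\<close>, as finitely supported functions on the set of left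
  cosets, with the action \<open>(g f)(S) = f(g\<^sup>-\<^sup>1 S)\<close>.\<close>

definition perm_module :: "(('K ^ 3 ^ 3) set \<Rightarrow>\<^sub>0 'k :: field) set" where
  "perm_module = {f. Poly_Mapping.keys f \<subseteq> lcosets\<^bsub>SL3\<^esub> I}"

definition translate ::
    "'K ^ 3 ^ 3 \<Rightarrow> (('K ^ 3 ^ 3) set \<Rightarrow>\<^sub>0 'k :: field) \<Rightarrow> (('K ^ 3 ^ 3) set \<Rightarrow>\<^sub>0 'k)" where
  "translate g f = Poly_Mapping.map_key (l_coset SL3 (inv\<^bsub>SL3\<^esub> g)) f"

definition oriented_facets :: "nat \<Rightarrow> ('K ^ 3) set set list set set" where
  "oriented_facets i = {orientation ys | ys. distinct ys \<and> set ys \<in> facets i}"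

text \<open>In the following, \<open>V\<close> is the module of coefficients; chains are extended by zero to all
  arguments that are not oriented \<open>i\<close>-facets.\<close>

definition chains ::
    "(('K ^ 3 ^ 3) set \<Rightarrow>\<^sub>0 'k :: field) set \<Rightarrow> nat
      \<Rightarrow> (('K ^ 3) set set list set \<Rightarrow> (('K ^ 3 ^ 3) set \<Rightarrow>\<^sub>0 'k)) set" where
  "chains V i = {\<alpha>. finite {c. \<alpha> c \<noteq> 0}
     \<and> (\<forall>c. c \<notin> oriented_facets i \<longrightarrow> \<alpha> c = 0)
     \<and> (\<forall>c\<in>oriented_facets i. \<alpha> c \<in> V \<and> (\<forall>g\<in>I\<^sub>F (underlying c). translate g (\<alpha> c) = \<alpha> c))
     \<and> (1 \<le> i \<longrightarrow> (\<forall>c\<in>oriented_facets i. \<alpha> (opposite c) = - \<alpha> c))}"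

definition boundary ::
    "nat \<Rightarrow> (('K ^ 3) set set list set \<Rightarrow> (('K ^ 3 ^ 3) set \<Rightarrow>\<^sub>0 'k :: field))
      \<Rightarrow> ('K ^ 3) set set list set \<Rightarrow> (('K ^ 3 ^ 3) set \<Rightarrow>\<^sub>0 'k)" where
  "boundary i \<alpha> = (\<lambda>c. if c \<in> oriented_facets i
     then \<Sum>F' | F' \<in> facets (Suc i) \<and> underlying c \<subseteq> F'. \<alpha> (extend_orientation c F')
     else 0)"

definition act_chain ::
    "'K ^ 3 ^ 3 \<Rightarrow> (('K ^ 3) set set list set \<Rightarrow> (('K ^ 3 ^ 3) set \<Rightarrow>\<^sub>0 'k :: field))
      \<Rightarrow> ('K ^ 3) set set list set \<Rightarrow> (('K ^ 3 ^ 3) set \<Rightarrow>\<^sub>0 'k)" where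
  "act_chain g \<alpha> = (\<lambda>c. translate g (\<alpha> (map (act (inv\<^bsub>SL3\<^esub> g)) ` c)))"

definition chains_in ::
    "('K ^ 3) set set set \<Rightarrow> (('K ^ 3 ^ 3) set \<Rightarrow>\<^sub>0 'k :: field) set \<Rightarrow> nat
      \<Rightarrow> (('K ^ 3) set set list set \<Rightarrow> (('K ^ 3 ^ 3) set \<Rightarrow>\<^sub>0 'k)) set" where
  "chains_in R V i = {\<alpha> \<in> chains V i.
     \<forall>c\<in>oriented_facets i. \<not> underlying c \<subseteq> R \<longrightarrow> \<alpha> c = 0}"

subsection \<open>Collapsibility\<close>

definition invariant_region :: "('K ^ 3) set set set \<Rightarrow> bool" where
  "invariant_region R \<longleftrightarrow> R \<subseteq> vertices \<and> (\<forall>g\<in>I. act g ` R = R)"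

definition M ::
    "('K ^ 3) set set set \<Rightarrow> (('K ^ 3 ^ 3) set \<Rightarrow>\<^sub>0 'k :: field) set
      \<Rightarrow> (('K ^ 3) set set list set \<Rightarrow> (('K ^ 3 ^ 3) set \<Rightarrow>\<^sub>0 'k)) set" where
  "M R V = {\<lambda>c. \<alpha> c + boundary 1 \<gamma> c | \<alpha> \<gamma>. \<alpha> \<in> chains_in R V 1 \<and> \<gamma> \<in> chains V 2}"

definition shift_invariant ::
    "('K ^ 3) set set set \<Rightarrow> (('K ^ 3 ^ 3) set \<Rightarrow>\<^sub>0 'k :: field) set
      \<Rightarrow> (('K ^ 3) set set list set \<Rightarrow> (('K ^ 3 ^ 3) set \<Rightarrow>\<^sub>0 'k)) \<Rightarrow> bool" where
  "shift_invariant R V \<beta> \<longleftrightarrow> \<beta> \<in> chains V 1 \<and> boundary 0 \<beta> \<in> chains_in R V 0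
     \<and> (\<forall>g\<in>I. (\<lambda>c. act_chain g \<beta> c - \<beta> c) \<in> M R V)"

text \<open>\<open>collapsible L R V\<close>: the region \<open>R\<close> is \<open>L\<close>-collapsible, for chains with coefficients
  in \<open>V\<close>.\<close>

definition collapsible ::
    "('K ^ 3) set set set \<Rightarrow> ('K ^ 3) set set set
      \<Rightarrow> (('K ^ 3 ^ 3) set \<Rightarrow>\<^sub>0 'k :: field) set \<Rightarrow> bool" where
  "collapsible L R V \<longleftrightarrow> invariant_region R \<and> invariant_region L \<and> R \<subseteq> L
     \<and> (\<forall>\<beta>\<in>chains_in L V 1.
          shift_invariant R V \<beta> \<and> boundary 0 \<beta> \<in> chains_in R V 0 \<longrightarrow> \<beta> \<in> M R V)"

end

end

theory Submission
  imports Defs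
begin

text \<open>
  Let \<open>\<beta>\<close> be a 1-chain in the star of \<open>v\<^sub>0\<close> whose boundary is supported on \<open>C\<close>. The link of \<open>v\<^sub>0\<close>
  consists of the points and lines of the projective plane over the field with \<open>p\<close> elements, and
  the chambers at \<open>v\<^sub>0\<close> are its flags. The point and the line of a flag are written \<open>point_of A\<close> and
  \<open>line_of A\<close> with a matrix \<open>A\<close> in \<open>GL\<^sub>3(\<O>)\<close>. An element of \<open>k[G/I]\<close> is viewed as a function on \<open>G\<close> that is
  invariant under \<open>I\<close> from the right. Let \<open>\<Gamma>\<close> be the kernel of the reduction map on \<open>SL\<^sub>3(\<O>)\<close>.

  To fill chambers, consider an edge \<open>e = {P, l}\<close> of the link. The group \<open>I\<^sub>e\<close> does not contain \<open>\<Gamma>\<close>, but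
  \<open>\<Gamma> I\<^sub>e\<close> contains the subgroup attached to the chamber \<open>{v\<^sub>0, P, l}\<close> (\<open>I_conj_factor\<close>,
  \<open>chamber_imp_I\<close>). So if \<open>\<beta>\<close> takes a \<open>\<Gamma>\<close>-invariant value on \<open>e\<close>, this value may be placed on the
  chamber. If this is the case for all edges of the link other than \<open>{v\<^sub>1, v\<^sub>2}\<close>, the resulting 2-chain
  \<open>\<gamma>\<close> makes \<open>\<beta> - \<epsilon>\<^sub>1(\<gamma>)\<close> vanish on all those edges; as \<open>\<beta>\<close> has no boundary outside of \<open>C\<close>, the
  difference also vanishes on the edges from \<open>v\<^sub>0\<close> to vertices outside of \<open>C\<close>. Hence it lies in
  \<open>C\<^sub>1(C, k[G/I])\<close>, and \<open>\<beta>\<close> lies in \<open>M\<^sub>C\<close>.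

  For the invariance under \<open>\<Gamma>\<close>, fix \<open>h\<close> in \<open>G\<close>, and call a flag moved if the value of \<open>\<beta>\<close> on it is not
  constant on \<open>\<Gamma> h\<close>. This value does not change under \<open>I\<^sub>e\<close> from the left, nor under \<open>h I h\<^sup>-\<^sup>1\<close>
  next to \<open>h\<close>. Pivoting provides a basis \<open>\<kappa>\<close> in \<open>GL\<^sub>3(\<O>)\<close> such that \<open>h I h\<^sup>-\<^sup>1\<close> contains the upper
  triangular elementary matrices congruent to \<open>1\<close> modulo \<open>\<pi>\<close> in this basis
  (\<open>stabiliser_contains_unipotents\<close>). Unless \<open>P = point_of \<kappa>\<close> or \<open>l = line_of \<kappa>\<close>, one of them
  supplies the direction in which \<open>\<Gamma>\<close> is not already covered by \<open>I\<^sub>e\<close>, and the flag is not moved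
  (\<open>moved_edge_position\<close>). So the moved flags lie in a double star, which is a tree. On edges at \<open>v\<^sub>0\<close>
  all values are \<open>\<Gamma>\<close>-invariant; since the values of \<open>\<beta>\<close> at a vertex outside of \<open>C\<close> add up to zero,
  such a vertex does not lie on exactly one moved flag. Thus the moved flags form a forest
  with all leaves in \<open>{v\<^sub>1, v\<^sub>2}\<close>, that is, at most a path from \<open>v\<^sub>2\<close> to \<open>v\<^sub>1\<close>. In a double star it has
  length one or three, and length three is impossible (\<open>no_path_of_length_three\<close>). So \<open>{v\<^sub>1, v\<^sub>2}\<close> is the
  only flag that can be moved.

  The groups \<open>I\<^sub>F\<close> are defined by the unipotent radical of a special fibre. For an edge the special
  fibre consists of pairs of matrices that intertwine two maps \<open>P\<close> and \<open>Q\<close> with \<open>P Q = Q P = 0\<close>; its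
  unipotent radical (\<open>unipotent_radical_edge\<close>) leads to congruences for the entries of the elements of
  \<open>I\<^sub>F\<close> in an adapted basis (\<open>edge_lemma\<close>).
\<close>

section \<open>Matrices of size three\<close>

lemma matrix_diff_ldistrib: "A ** (B - B') = A ** B - A ** (B' :: 'a::ring_1 ^ 'n ^ 'm)"
  by (vector matrix_matrix_mult_def sum_subtractf[symmetric] algebra_simps)

lemma matrix_diff_rdistrib: "(A - A') ** B = A ** B - A' ** (B :: 'a::ring_1 ^ 'n ^ 'm)"
  by (vector matrix_matrix_mult_def sum_subtractf[symmetric] algebra_simps)

lemma matrix_add_rdistrib': "(A + A') ** B = A ** B + A' ** (B :: 'a::semiring_1 ^ 'n ^ 'm)"
  by (vector matrix_matrix_mult_def sum.distrib[symmetric] algebra_simps)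

lemma matrix_mul_zero [simp]:
  "A ** (0 :: 'a::semiring_1 ^ 'n ^ 'm) = 0" "(0 :: 'a::semiring_1 ^ 'm ^ 'k) ** B = 0"
  by (vector matrix_matrix_mult_def)+

lemmas mat3_simps = matrix_matrix_mult_def vec_eq_iff forall_3 sum_3 mat_def

definition adj3 :: "'a::comm_ring_1 ^ 3 ^ 3 \<Rightarrow> 'a ^ 3 ^ 3" where
  "adj3 A = vector [
     vector [A$2$2 * A$3$3 - A$2$3 * A$3$2, A$1$3 * A$3$2 - A$1$2 * A$3$3, A$1$2 * A$2$3 - A$1$3 * A$2$2],
     vector [A$2$3 * A$3$1 - A$2$1 * A$3$3, A$1$1 * A$3$3 - A$1$3 * A$3$1, A$1$3 * A$2$1 - A$1$1 * A$2$3],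
     vector [A$2$1 * A$3$2 - A$2$2 * A$3$1, A$1$2 * A$3$1 - A$1$1 * A$3$2, A$1$1 * A$2$2 - A$1$2 * A$2$1]]"

lemma adj3_mult: "A ** adj3 A = mat (det A)" "adj3 A ** A = mat (det A)"
  by (simp_all add: adj3_def mat3_simps det_3 algebra_simps)

lemma
  fixes A :: "'a::field ^ 3 ^ 3"
  assumes "det A \<noteq> 0"
  shows matrix_inv_right': "A ** matrix_inv A = mat 1"
    and matrix_inv_left': "matrix_inv A ** A = mat 1"
proof -
  have "invertible A" using assms by (simp add: invertible_det_nz)
  then have "\<exists>B. A ** B = mat 1 \<and> B ** A = mat 1" by (simp add: invertible_def)
  from someI_ex[OF this] show "A ** matrix_inv A = mat 1" "matrix_inv A ** A = mat 1"
    by (simp_all add: matrix_inv_def)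
qed

lemma matrix_inv_unique:
  fixes A :: "'a::field ^ 3 ^ 3"
  assumes "A ** B = mat 1"
  shows "matrix_inv A = B"
proof -
  have "det A * det B = 1" using assms by (metis det_I det_mul)
  then have "det A \<noteq> 0" by auto
  then show ?thesis
    by (metis assms matrix_inv_left' matrix_mul_assoc matrix_mul_lid matrix_mul_rid)
qed

lemma matrix_inv_adj3:
  fixes A :: "'a::field ^ 3 ^ 3"
  assumes "det A \<noteq> 0"
  shows "matrix_inv A = (\<chi> i j. adj3 A $ i $ j / det A)"
proof (rule matrix_inv_unique)
  have "A ** (\<chi> i j. adj3 A $ i $ j / det A) = (\<chi> i j. (A ** adj3 A) $ i $ j / det A)"
    by (simp add: mat3_simps add_divide_distrib)
  also have "\<dots> = mat 1" using assms by (simp add: adj3_mult) (simp add: mat3_simps)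
  finally show "A ** (\<chi> i j. adj3 A $ i $ j / det A) = mat 1" .
qed

text \<open>Over the polynomial ring, \<open>1 - T Z\<close> is invertible by the geometric series. Its determinant is
  therefore a unit, hence a constant; its value at \<open>0\<close> is \<open>1\<close> and its derivative there is
  \<open>- trace Z\<close>.\<close>

lemma
  fixes Z :: "'a::field ^ 3 ^ 3"
  assumes "(((**) Z) ^^ n) (mat 1) = 0"
  shows nilpotent_trace: "trace Z = 0"
    and nilpotent_det: "det (mat 1 - (\<chi> i j. t * Z $ i $ j)) = 1"
proof -
  \<comment> \<open>The matrix \<open>T Z\<close> over the polynomial ring in \<open>T\<close>.\<close>
  define Zp :: "'a poly ^ 3 ^ 3" where "Zp = (\<chi> i j. Polynomial.monom (Z $ i $ j) 1)"
  define pw where "pw k = (((**) Zp) ^^ k) (mat 1)" for k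
  have pw: "pw k = (\<chi> i j. Polynomial.monom ((((**) Z) ^^ k) (mat 1) $ i $ j) k)" for k
  proof (induction k)
    case 0
    show ?case by (simp add: pw_def mat3_simps)
  next
    case (Suc k)
    have e: "Polynomial.monom a (Suc 0) * Polynomial.monom b k = Polynomial.monom (a * b) (Suc k)" for a b :: 'a
      by (simp add: mult_monom)
    have "pw (Suc k) = Zp ** pw k" by (simp add: pw_def)
    also have "\<dots> = (\<chi> i j. Polynomial.monom ((((**) Z) ^^ Suc k) (mat 1) $ i $ j) (Suc k))"
      unfolding Suc by (simp add: Zp_def mat3_simps e flip: add_monom)
    finally show ?case .
  qed
  have geo: "(mat 1 - Zp) ** (\<Sum>k<m. pw k) = mat 1 - pw m" for m
  proof (induction m)
    case 0 show ?case by (simp add: pw_def)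
  next
    case (Suc m)
    have "Zp ** pw m = pw (Suc m)" by (simp add: pw_def)
    then show ?case using Suc by (simp add: matrix_add_ldistrib matrix_diff_rdistrib)
  qed
  have "pw n = 0" using pw[of n] assms by (simp add: vec_eq_iff)
  then have "(mat 1 - Zp) ** (\<Sum>k<n. pw k) = mat 1" using geo[of n] by simp
  then have u: "det (mat 1 - Zp) * det (\<Sum>k<n. pw k) = 1" by (metis det_I det_mul)
  then have "Polynomial.degree (det (mat 1 - Zp)) + Polynomial.degree (det (\<Sum>k<n. pw k)) = 0"
    by (metis Polynomial.degree_1 Polynomial.degree_mult_eq mult_zero_left mult_zero_right zero_neq_one)
  then obtain c where c: "det (mat 1 - Zp) = [:c:]" by (metis add_is_0 degree_eq_zeroE)
  have ev: "poly (det (mat 1 - Zp)) t = det (mat 1 - (\<chi> i j. t * Z $ i $ j))" for t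
    by (simp add: det_3 Zp_def mat_def poly_monom algebra_simps)
  have "det (mat 1 - (\<chi> i j. 0 * Z $ i $ j)) = 1" by (simp add: det_3 mat_def)
  then have "c = 1" using ev[of 0] c by simp
  then show "det (mat 1 - (\<chi> i j. t * Z $ i $ j)) = 1" using ev[of t] c by simp
  have "poly (pderiv (det (mat 1 - Zp))) 0 = - trace Z"
    by (simp add: det_3 Zp_def mat_def pderiv_mult pderiv_diff pderiv_add pderiv_monom poly_monom trace_def sum_3)
  then show "trace Z = 0" using c by simp
qed

lemma square_zero_det:
  fixes Z :: "'a::field ^ 3 ^ 3"
  assumes "Z ** Z = 0"
  shows "det (mat 1 + Z) = 1"
proof -
  have "(((**) Z) ^^ 2) (mat 1) = 0" using assms by (simp add: numeral_2_eq_2)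
  from nilpotent_det[OF this, of "- 1"]
  show ?thesis by (simp add: det_3 mat_def)
qed

lemma unipotent_trace:
  fixes A :: "'a::field ^ 3 ^ 3"
  assumes "unipotent_matrix A"
  shows "trace A = 3"
proof -
  obtain n where "(((**) (A - mat 1)) ^^ n) (mat 1) = 0"
    using assms by (auto simp: unipotent_matrix_def)
  from nilpotent_trace[OF this] show ?thesis by (simp add: trace_def sum_3 mat_def add.assoc)
qed

lemma unipotent_eigenvalue:
  fixes A :: "'a::field ^ 3 ^ 3"
  assumes "unipotent_matrix A" "A *v u = c *s u" "u \<noteq> 0"
  shows "c = 1"
proof -
  obtain n where n: "(((**) (A - mat 1)) ^^ n) (mat 1) = 0"
    using assms by (auto simp: unipotent_matrix_def)
  have "(((**) (A - mat 1)) ^^ k) (mat 1) *v u = (c - 1) ^ k *s u" for k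
  proof (induction k)
    case (Suc k)
    have "(A - mat 1) *v u = (c - 1) *s u"
      using assms(2) by (simp add: matrix_vector_mult_diff_rdistrib)
    then have "(A - mat 1) *v ((c - 1) ^ k *s u) = (c - 1) ^ k *s ((c - 1) *s u)"
      by (simp add: vector_scalar_commute)
    then show ?case using Suc
      by (simp add: matrix_vector_mul_assoc[symmetric] algebra_simps)
  qed simp
  from this[of n] n assms(3) show ?thesis by auto
qed

lemma SL3_simps [simp]:
  "g \<in> carrier SL3 \<longleftrightarrow> det g = 1" "x \<otimes>\<^bsub>SL3\<^esub> y = x ** y" "\<one>\<^bsub>SL3\<^esub> = mat 1"
  by (simp_all add: SL3_def)

lemma group_SL3 [simp]: "group (SL3 :: ('a::field ^ 3 ^ 3) monoid)"
proof (rule groupI)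
  fix x :: "'a ^ 3 ^ 3"
  assume "x \<in> carrier SL3"
  then show "\<exists>y\<in>carrier SL3. y \<otimes>\<^bsub>SL3\<^esub> x = \<one>\<^bsub>SL3\<^esub>"
    by (intro bexI[of _ "adj3 x"]) (use adj3_mult[of x] det_mul[of x "adj3 x"] in simp_all)
qed (auto simp: det_mul matrix_mul_assoc)

lemma SL3_cancel:
  fixes A B g :: "'a::field ^ 3 ^ 3"
  assumes "A ** g = B ** g" "det g = 1"
  shows "A = B"
proof -
  have "A ** (g ** adj3 g) = B ** (g ** adj3 g)" by (simp add: matrix_mul_assoc assms)
  then show ?thesis by (simp add: adj3_mult assms)
qed

lemma inv_SL3: "det g = 1 \<Longrightarrow> inv\<^bsub>SL3\<^esub> g = matrix_inv (g :: 'a::field ^ 3 ^ 3)"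
  by (metis SL3_simps(1) SL3_simps(2) SL3_simps(3) group.r_inv group_SL3 matrix_inv_unique)

lemma inv_SL3_mult:
  assumes "det (g :: 'a::field ^ 3 ^ 3) = 1"
  shows "inv\<^bsub>SL3\<^esub> g ** g = mat 1" "g ** inv\<^bsub>SL3\<^esub> g = mat 1" "det (inv\<^bsub>SL3\<^esub> g) = 1"
  using group.l_inv[OF group_SL3, of g] group.r_inv[OF group_SL3, of g]
    group.inv_closed[OF group_SL3, of g] assms by auto

section \<open>The unipotent radical for an edge\<close>

text \<open>The special fibre attached to an edge with vertices \<open>x\<close> and \<open>y\<close>: in the application, \<open>P\<close> and \<open>Q\<close>
  are the reductions of the two inclusions between lattices \<open>L\<^sub>x \<supset> L\<^sub>y \<supset> \<pi> L\<^sub>x\<close>.\<close>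

definition edge_fibre ::
    "'i \<Rightarrow> 'i \<Rightarrow> 'a::field ^ 3 ^ 3 \<Rightarrow> 'a ^ 3 ^ 3 \<Rightarrow> ('i \<Rightarrow> 'a ^ 3 ^ 3) monoid" where
  "edge_fibre x y P Q = (product_group {x, y} (\<lambda>_. SL3))
     \<lparr>carrier := {h \<in> carrier (product_group {x, y} (\<lambda>_. SL3)).
        h x ** P = P ** h y \<and> h y ** Q = Q ** h x}\<rparr>"

text \<open>The pairs that act trivially on the images of \<open>P\<close> and \<open>Q\<close>. By the intertwining relations they
  satisfy \<open>P ** h y = P\<close> and \<open>Q ** h x = Q\<close> as well, so they also act trivially on the quotients by
  the kernels.\<close>

definition edge_radical ::
    "'i \<Rightarrow> 'i \<Rightarrow> 'a::field ^ 3 ^ 3 \<Rightarrow> 'a ^ 3 ^ 3 \<Rightarrow> ('i \<Rightarrow> 'a ^ 3 ^ 3) set" where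
  "edge_radical x y P Q = {h \<in> carrier (edge_fibre x y P Q). h x ** P = P \<and> h y ** Q = Q}"

lemma carrier_edge_fibre:
  "h \<in> carrier (edge_fibre x y P Q) \<longleftrightarrow> h \<in> extensional {x, y} \<and> det (h x) = 1 \<and> det (h y) = 1 \<and>
     h x ** P = P ** h y \<and> h y ** Q = Q ** h x"
  by (auto simp: edge_fibre_def PiE_iff)

lemma edge_fibre_simps:
  "h \<otimes>\<^bsub>edge_fibre x y P Q\<^esub> h' = (\<lambda>z\<in>{x, y}. h z ** h' z)"
  "\<one>\<^bsub>edge_fibre x y P Q\<^esub> = (\<lambda>z\<in>{x, y}. mat 1)"
  by (simp_all add: edge_fibre_def)

lemma edge_fibre_commute:
  "edge_fibre x y P Q = edge_fibre y x Q P" "edge_radical x y P Q = edge_radical y x Q P"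
  by (auto simp: edge_fibre_def edge_radical_def insert_commute conj_commute)

lemma intertwine_inv:
  fixes P :: "'a::field ^ 3 ^ 3"
  assumes "a ** P = P ** b" "a' ** a = mat 1" "b ** b' = mat 1"
  shows "a' ** P = P ** b'"
  by (metis assms matrix_mul_assoc matrix_mul_lid matrix_mul_rid)

lemma extensional_pair_eqI:
  "f \<in> extensional {x, y} \<Longrightarrow> g \<in> extensional {x, y} \<Longrightarrow> f x = g x \<Longrightarrow> f y = g y \<Longrightarrow> f = g"
  by (rule extensionalityI[of f "{x, y}" g]) auto

lemma group_edge_fibre [simp]: "group (edge_fibre x y P Q)"
proof (rule groupI)
  let ?G = "edge_fibre x y P Q"
  show "g \<otimes>\<^bsub>?G\<^esub> h \<in> carrier ?G" if "g \<in> carrier ?G" "h \<in> carrier ?G" for g h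
    using that by (simp add: carrier_edge_fibre edge_fibre_simps det_mul) (metis matrix_mul_assoc)
  show "\<one>\<^bsub>?G\<^esub> \<in> carrier ?G" by (simp add: carrier_edge_fibre edge_fibre_simps)
  show "f \<otimes>\<^bsub>?G\<^esub> g \<otimes>\<^bsub>?G\<^esub> h = f \<otimes>\<^bsub>?G\<^esub> (g \<otimes>\<^bsub>?G\<^esub> h)" for f g h
    by (rule extensional_pair_eqI) (auto simp: edge_fibre_simps matrix_mul_assoc)
  show "\<one>\<^bsub>?G\<^esub> \<otimes>\<^bsub>?G\<^esub> h = h" if "h \<in> carrier ?G" for h
    by (rule extensional_pair_eqI) (use that in \<open>auto simp: edge_fibre_simps carrier_edge_fibre\<close>)
  show "\<exists>h'\<in>carrier ?G. h' \<otimes>\<^bsub>?G\<^esub> h = \<one>\<^bsub>?G\<^esub>" if h: "h \<in> carrier ?G" for h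
  proof
    let ?h = "\<lambda>z\<in>{x, y}. inv\<^bsub>SL3\<^esub> (h z)"
    have d: "det (h x) = 1" "det (h y) = 1" using h by (auto simp: carrier_edge_fibre)
    show "?h \<in> carrier ?G"
      using h intertwine_inv[of "h x" P "h y" "inv\<^bsub>SL3\<^esub> (h x)" "inv\<^bsub>SL3\<^esub> (h y)"]
        intertwine_inv[of "h y" Q "h x" "inv\<^bsub>SL3\<^esub> (h y)" "inv\<^bsub>SL3\<^esub> (h x)"]
      by (simp add: carrier_edge_fibre inv_SL3_mult d)
    show "?h \<otimes>\<^bsub>?G\<^esub> h = \<one>\<^bsub>?G\<^esub>"
      by (rule extensional_pair_eqI) (auto simp: edge_fibre_simps inv_SL3_mult d)
  qed
qed

lemma polynomial_on_line:
  fixes u :: "'a::field \<Rightarrow> 'i \<Rightarrow> 'a ^ 3 ^ 3"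
  assumes "f \<in> polynomial_functions"
    and u: "\<And>z i j. \<exists>a b. \<forall>t. u t z $ i $ j = a + t * b"
  shows "\<exists>q. \<forall>t. f (u t) = poly q t"
  using assms(1)
proof induction
  case (const c)
  show ?case by (rule exI[of _ "Polynomial.monom c 0"]) (simp add: poly_monom)
next
  case (coord z i j)
  obtain a b where "\<forall>t. u t z $ i $ j = a + t * b" using u by blast
  then show ?case
    by (intro exI[of _ "Polynomial.monom a 0 + Polynomial.monom b 1"]) (simp add: poly_monom)
next
  case (add f f')
  then obtain q q' where "\<forall>t. f (u t) = poly q t" "\<forall>t. f' (u t) = poly q' t" by blast
  then show ?case by (intro exI[of _ "q + q'"]) simp
next
  case (mult f f')
  then obtain q q' where "\<forall>t. f (u t) = poly q t" "\<forall>t. f' (u t) = poly q' t" by blast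
  then show ?case by (intro exI[of _ "q * q'"]) simp
qed

text \<open>On an affine line a polynomial function becomes a polynomial in one variable, which vanishes
  at finitely many points or everywhere. This is what is used of the irreducibility of affine
  spaces.\<close>

lemma zariski_open_on_line:
  fixes u :: "'a::field \<Rightarrow> 'i \<Rightarrow> 'a ^ 3 ^ 3"
  assumes "openin zariski E"
    and u: "\<And>z i j. \<exists>a b. \<forall>t. u t z $ i $ j = a + t * b"
    and "u t\<^sub>0 \<in> E"
  shows "finite {t. u t \<notin> E}"
proof -
  have "generate_topology_on {{h :: 'i \<Rightarrow> 'a ^ 3 ^ 3. f h \<noteq> 0} | f. f \<in> polynomial_functions} E"
    using assms(1) by (simp add: zariski_def openin_topology_generated_by_iff)
  then show ?thesis using assms(3)
  proof (induction arbitrary: t\<^sub>0)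
    case Empty
    then show ?case by simp
  next
    case (Int a b)
    then have "finite ({t. u t \<notin> a} \<union> {t. u t \<notin> b})" by blast
    then show ?case by (rule rev_finite_subset) auto
  next
    case (UN K)
    then obtain k where k: "k \<in> K" "u t\<^sub>0 \<in> k" by blast
    then have "finite {t. u t \<notin> k}" using UN by blast
    then show ?case by (rule rev_finite_subset) (use k in auto)
  next
    case (Basis s)
    then obtain f where f: "f \<in> polynomial_functions" "s = {h. f h \<noteq> 0}" by blast
    obtain q where q: "\<forall>t. f (u t) = poly q t" using polynomial_on_line[of f u, OF f(1) u] by blast
    have "q \<noteq> 0" using q f(2) Basis by auto
    then show ?case using poly_roots_finite[of q] f(2) q by simp
  qed
qed

lemma topspace_zariski [simp]: "topspace (zariski :: ('i \<Rightarrow> 'a::field ^ 3 ^ 3) topology) = UNIV"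
proof -
  have "(\<lambda>h. 1) \<in> (polynomial_functions :: (('i \<Rightarrow> 'a ^ 3 ^ 3) \<Rightarrow> 'a) set)"
    by (rule polynomial_functions.const)
  then have "(UNIV :: ('i \<Rightarrow> 'a ^ 3 ^ 3) set) \<in> {{h. f h \<noteq> 0} | f. f \<in> polynomial_functions}"
    by (intro CollectI exI[of _ "\<lambda>h. 1"]) auto
  then have "openin (zariski :: ('i \<Rightarrow> 'a ^ 3 ^ 3) topology) UNIV"
    unfolding zariski_def by (rule topology_generated_by_Basis)
  then show ?thesis using openin_subset by blast
qed

lemma zariski_closed_zeros:
  assumes "f \<in> polynomial_functions"
  shows "closedin zariski {h. f h = 0}"
proof -
  have "openin zariski {h. f h \<noteq> 0}"
    unfolding zariski_def by (rule topology_generated_by_Basis) (use assms in blast)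
  moreover have "{h. f h \<noteq> 0} = UNIV - {h. f h = 0}" by auto
  ultimately show ?thesis by (simp add: closedin_def)
qed

lemma zariski_closed_equation:
  fixes P R :: "'a::field ^ 3 ^ 3"
  shows "closedin zariski {h. h z ** P = R}"
proof -
  let ?f = "\<lambda>i j h. h z $ i $ 1 * P $ 1 $ j + h z $ i $ 2 * P $ 2 $ j + h z $ i $ 3 * P $ 3 $ j + (- R $ i $ j)"
  have "?f i j \<in> polynomial_functions" for i j
    by (intro polynomial_functions.intros)
  then have "closedin zariski {h. ?f i j h = 0}" for i j by (rule zariski_closed_zeros)
  then have "closedin zariski (\<Inter>((\<lambda>(i, j). {h. ?f i j h = 0}) ` UNIV))"
    by (intro closedin_Inter) auto
  also have "\<Inter>((\<lambda>(i, j). {h. ?f i j h = 0}) ` UNIV) = {h. h z ** P = R}"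
    by (auto simp: matrix_matrix_mult_def vec_eq_iff sum_3 algebra_simps)
  finally show ?thesis .
qed

text \<open>The splittings of the identity make the periodic sequence given by \<open>P\<close> and \<open>Q\<close> exact: the image
  of each of the two maps is the kernel of the other.\<close>

locale edge_maps =
  fixes x y :: 'i and P Q A\<^sub>1 A\<^sub>2 B\<^sub>1 B\<^sub>2 :: "'a::field ^ 3 ^ 3"
  assumes distinct: "x \<noteq> y"
    and PQ: "P ** Q = 0" and QP: "Q ** P = 0"
    and split_x: "P ** A\<^sub>1 + A\<^sub>2 ** Q = mat 1"
    and split_y: "Q ** B\<^sub>1 + B\<^sub>2 ** P = mat 1"
begin

abbreviation "H \<equiv> edge_fibre x y P Q"
abbreviation "U \<equiv> edge_radical x y P Q"

lemma swap: "edge_maps y x Q P B\<^sub>1 B\<^sub>2 A\<^sub>1 A\<^sub>2"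
  using distinct PQ QP split_x split_y by unfold_locales auto

lemma square_zero:
  assumes "Z ** P = 0" "Q ** Z = 0"
  shows "Z ** Z = 0"
proof -
  have "Z = Z ** (P ** A\<^sub>1 + A\<^sub>2 ** Q)" by (simp add: split_x)
  also have "\<dots> = Z ** A\<^sub>2 ** Q" by (simp add: matrix_add_ldistrib matrix_mul_assoc assms)
  finally have "Z ** Z = Z ** A\<^sub>2 ** (Q ** Z)" by (metis matrix_mul_assoc)
  then show ?thesis by (simp add: assms)
qed

text \<open>In terms of \<open>h x - 1\<close> and \<open>h y - 1\<close> the radical is a linear space: these matrices have square zero,
  so that the determinants are automatically \<open>1\<close>.\<close>

lemma radical_iff:
  "h \<in> U \<longleftrightarrow> h \<in> extensional {x, y} \<and> (h x - mat 1) ** P = 0 \<and> Q ** (h x - mat 1) = 0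
     \<and> (h y - mat 1) ** Q = 0 \<and> P ** (h y - mat 1) = 0"
  (is "_ \<longleftrightarrow> ?r h")
proof
  assume "h \<in> U"
  then show "?r h"
    by (auto simp: edge_radical_def carrier_edge_fibre matrix_diff_ldistrib matrix_diff_rdistrib)
next
  interpret s: edge_maps y x Q P B\<^sub>1 B\<^sub>2 A\<^sub>1 A\<^sub>2 by (rule swap)
  assume r: "?r h"
  have "det (mat 1 + (h x - mat 1)) = 1" "det (mat 1 + (h y - mat 1)) = 1"
    using r by (intro square_zero_det square_zero s.square_zero; blast)+
  then show "h \<in> U"
    using r by (auto simp: edge_radical_def carrier_edge_fibre matrix_diff_ldistrib matrix_diff_rdistrib)
qed

lemma radical_unipotent:
  assumes "h \<in> U" "z \<in> {x, y}"
  shows "unipotent_matrix (h z)"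
proof -
  interpret s: edge_maps y x Q P B\<^sub>1 B\<^sub>2 A\<^sub>1 A\<^sub>2 by (rule swap)
  have "(h z - mat 1) ** (h z - mat 1) = 0"
    using assms radical_iff square_zero s.square_zero by blast
  then have "(((**) (h z - mat 1)) ^^ 2) (mat 1) = 0" by (simp add: numeral_2_eq_2)
  then show ?thesis unfolding unipotent_matrix_def by blast
qed

lemma radical_normal: "U \<lhd> H"
proof -
  interpret H: group H by simp
  have conj: "g \<otimes>\<^bsub>H\<^esub> h \<otimes>\<^bsub>H\<^esub> inv\<^bsub>H\<^esub> g \<in> U" if g: "g \<in> carrier H" and h: "h \<in> U" for g h
  proof -
    define z where "z = g \<otimes>\<^bsub>H\<^esub> h \<otimes>\<^bsub>H\<^esub> inv\<^bsub>H\<^esub> g"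
    have hc: "h \<in> carrier H" using h by (simp add: edge_radical_def)
    have z: "z \<in> carrier H" using g hc by (simp add: z_def)
    have "z \<otimes>\<^bsub>H\<^esub> g = g \<otimes>\<^bsub>H\<^esub> h"
      using g hc by (simp add: z_def H.m_assoc)
    then have e: "z x ** g x = g x ** h x" "z y ** g y = g y ** h y"
      by (auto simp: edge_fibre_simps fun_eq_iff split: if_splits)
    have g': "g x ** P = P ** g y" "g y ** Q = Q ** g x" "det (g x) = 1" "det (g y) = 1"
      using g by (auto simp: carrier_edge_fibre)
    have h': "h x ** P = P" "h y ** Q = Q" using h by (auto simp: edge_radical_def)
    have "z x ** P ** g y = P ** g y" by (metis e(1) g'(1) h'(1) matrix_mul_assoc)
    then have "z x ** P = P"
      using g'(4) by (rule SL3_cancel)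
    moreover have "z y ** Q ** g x = Q ** g x" by (metis e(2) g'(2) h'(2) matrix_mul_assoc)
    then have "z y ** Q = Q"
      using g'(3) by (rule SL3_cancel)
    ultimately show ?thesis using z by (simp add: edge_radical_def z_def)
  qed
  have "subgroup U H"
  proof (rule H.subgroupI)
    show "U \<subseteq> carrier H" by (auto simp: edge_radical_def)
    have "\<one>\<^bsub>H\<^esub> \<in> U"
      using H.one_closed by (simp add: edge_radical_def edge_fibre_simps)
    then show "U \<noteq> {}" by blast
    fix a b assume a: "a \<in> U" and b: "b \<in> U"
    then have "a \<otimes>\<^bsub>H\<^esub> b \<in> carrier H" by (auto simp: edge_radical_def)
    then show "a \<otimes>\<^bsub>H\<^esub> b \<in> U"
      using a b by (simp add: edge_radical_def edge_fibre_simps flip: matrix_mul_assoc)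
  next
    fix a assume a: "a \<in> U"
    have ac: "a \<in> carrier H" using a by (simp add: edge_radical_def)
    then have "inv\<^bsub>H\<^esub> a \<otimes>\<^bsub>H\<^esub> a = \<one>\<^bsub>H\<^esub>" by simp
    then have "(inv\<^bsub>H\<^esub> a) x ** a x = mat 1" "(inv\<^bsub>H\<^esub> a) y ** a y = mat 1"
      by (auto simp: edge_fibre_simps fun_eq_iff split: if_splits)
    moreover have "a x ** P = P" "a y ** Q = Q" using a by (auto simp: edge_radical_def)
    ultimately have "(inv\<^bsub>H\<^esub> a) x ** P = P" "(inv\<^bsub>H\<^esub> a) y ** Q = Q"
      by (metis matrix_mul_assoc matrix_mul_lid)+
    then show "inv\<^bsub>H\<^esub> a \<in> U" using H.inv_closed[OF ac] by (simp add: edge_radical_def)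
  qed
  then show ?thesis using conj by (rule H.normal_invI)
qed

lemma radical_closed: "closedin (subtopology zariski (carrier H)) U"
proof -
  have "closedin zariski ({h. h x ** P = P} \<inter> {h. h y ** Q = Q})"
    by (intro closedin_Int zariski_closed_equation)
  moreover have "U = {h. h x ** P = P} \<inter> {h. h y ** Q = Q} \<inter> carrier H"
    by (auto simp: edge_radical_def)
  ultimately show ?thesis unfolding closedin_subtopology by blast
qed

text \<open>With any two points the radical contains the line through them. Two open sets that meet the
  radical in these points each contain all but finitely many points of the line, hence they have a
  point in common on it.\<close>

lemma radical_connected:
  assumes inf: "infinite (UNIV :: 'a set)"
  shows "connectedin zariski U"
  unfolding connectedin
proof (intro conjI notI)
  show "U \<subseteq> topspace zariski" by simp
next
  assume "\<exists>E\<^sub>1 E\<^sub>2. openin zariski E\<^sub>1 \<and> openin zariski E\<^sub>2 \<and> U \<subseteq> E\<^sub>1 \<union> E\<^sub>2 \<and> E\<^sub>1 \<inter> E\<^sub>2 \<inter> U = {}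
      \<and> E\<^sub>1 \<inter> U \<noteq> {} \<and> E\<^sub>2 \<inter> U \<noteq> {}"
  then obtain E\<^sub>1 E\<^sub>2 a b where E: "openin zariski E\<^sub>1" "openin zariski E\<^sub>2" "E\<^sub>1 \<inter> E\<^sub>2 \<inter> U = {}"
    and a: "a \<in> E\<^sub>1" "a \<in> U" and b: "b \<in> E\<^sub>2" "b \<in> U" by blast
  define u where "u t = (\<lambda>z\<in>{x, y}. a z + mat t ** (b z - a z))" for t :: 'a
  have mt: "mat t ** A = (\<chi> i j. t * A $ i $ j)" for t and A :: "'a ^ 3 ^ 3"
    by (simp add: mat3_simps)
  have lin: "\<exists>c d. \<forall>t. u t z $ i $ j = c + t * d" for z i j
  proof (cases "z \<in> {x, y}")
    case True
    then show ?thesis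
      by (intro exI[of _ "a z $ i $ j"] exI[of _ "(b z - a z) $ i $ j"]) (simp add: u_def mt)
  next
    case False
    then show ?thesis
      by (intro exI[of _ "(undefined :: 'a ^ 3 ^ 3) $ i $ j"] exI[of _ 0]) (simp add: u_def)
  qed
  have "u 0 = a" "u 1 = b"
    using a b by (auto simp: u_def radical_iff intro!: extensional_pair_eqI)
  then have "finite {t. u t \<notin> E\<^sub>1}" "finite {t. u t \<notin> E\<^sub>2}"
    using zariski_open_on_line[of E\<^sub>1 u 0] zariski_open_on_line[of E\<^sub>2 u 1] E a b lin by auto
  then have "finite ({t. u t \<notin> E\<^sub>1} \<union> {t. u t \<notin> E\<^sub>2})" by blast
  then obtain t where t: "u t \<in> E\<^sub>1" "u t \<in> E\<^sub>2"
    using inf by (metis (mono_tags, lifting) UnCI ex_new_if_finite mem_Collect_eq)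
  have comb: "a z + mat t ** (b z - a z) - mat 1 = (a z - mat 1) + mat t ** ((b z - mat 1) - (a z - mat 1))"
    for z by simp
  have mtc: "R ** (mat t ** S) = mat t ** (R ** S)" for R S :: "'a ^ 3 ^ 3"
    by (simp add: mat3_simps algebra_simps)
  have "u t \<in> U"
    using a(2) b(2) unfolding radical_iff u_def
    by (simp add: comb matrix_add_ldistrib matrix_add_rdistrib' mtc flip: matrix_mul_assoc)
       (simp add: mtc matrix_diff_ldistrib matrix_diff_rdistrib)
  then show False using t E by blast
qed

text \<open>Let \<open>\<psi>\<close> be a linear form with \<open>\<psi>(P w) = 0\<close>. Then \<open>g = 1 + P w \<psi>\<close> is the first component of an
  element of the group, with inverse \<open>1 - P w \<psi>\<close>, and since \<open>U'\<close> is normal, both \<open>h (g h g\<^sup>-\<^sup>1)\<close> and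
  \<open>h h\<close> are unipotent and have trace \<open>3\<close>. Expanding the difference of the traces leaves
  \<open>\<psi>(h P w)\<^sup>2 = 0\<close>. So every form that vanishes on \<open>P w\<close> vanishes on \<open>h P w\<close>, which makes \<open>P w\<close> an
  eigenvector of the unipotent matrix \<open>h\<close>.\<close>

lemma radical_fixes_image:
  assumes U': "U' \<lhd> H" and unip: "\<And>h. h \<in> U' \<Longrightarrow> unipotent_matrix (h x)" and h: "h \<in> U'"
  shows "h x ** P = P"
proof -
  interpret H: group H by simp
  interpret U': normal U' H by (rule U')
  have key: "(\<Sum>i\<in>UNIV. \<psi> $ i * (h x *v (P *v w)) $ i) = 0"
    if orth: "(\<Sum>i\<in>UNIV. \<psi> $ i * (P *v w) $ i) = 0" for w \<psi> :: "'a ^ 3"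
  proof -
    \<comment> \<open>The rank one matrix \<open>w \<psi>\<close>, for which \<open>P w \<psi>\<close> is \<open>P ** W\<close>.\<close>
    define W where "W = (\<chi> i j. w $ i * \<psi> $ j)"
    have PW: "P ** W = (\<chi> i j. (P *v w) $ i * \<psi> $ j)"
      by (simp add: W_def mat3_simps matrix_vector_mult_def algebra_simps)
    have WPW: "W ** P ** W = 0"
    proof -
      have "W ** (P ** W) = (\<chi> i j. w $ i * (\<Sum>i\<in>UNIV. \<psi> $ i * (P *v w) $ i) * \<psi> $ j)"
        unfolding PW by (simp add: W_def matrix_matrix_mult_def vec_eq_iff sum_3 algebra_simps)
      then show ?thesis using orth by (simp add: matrix_mul_assoc vec_eq_iff)
    qed
    define g where "g = (\<lambda>z\<in>{x, y}. mat 1 + (if z = x then P ** W else W ** P))"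
    define g' where "g' = (\<lambda>z\<in>{x, y}. mat 1 - (if z = x then P ** W else W ** P))"
    have sq: "(P ** W) ** (P ** W) = 0" "(W ** P) ** (W ** P) = 0"
      by (metis WPW matrix_mul_assoc matrix_mul_zero)+
    have gx: "g x = mat 1 + P ** W" "g y = mat 1 + W ** P" "g' x = mat 1 - P ** W"
      using distinct by (auto simp: g_def g'_def)
    have g: "g \<in> carrier H"
      unfolding carrier_edge_fibre gx using square_zero_det[OF sq(1)] square_zero_det[OF sq(2)]
      by (auto simp: g_def matrix_add_ldistrib matrix_add_rdistrib' matrix_mul_assoc QP)
         (metis QP PQ matrix_mul_assoc matrix_mul_zero)+
    have inv: "(inv\<^bsub>H\<^esub> g) x = mat 1 - P ** W"
    proof -
      have "inv\<^bsub>H\<^esub> g \<otimes>\<^bsub>H\<^esub> g = \<one>\<^bsub>H\<^esub>" using g by simp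
      then have "(inv\<^bsub>H\<^esub> g) x ** g x = mat 1" by (auto simp: edge_fibre_simps fun_eq_iff split: if_splits)
      moreover have "g x ** (mat 1 - P ** W) = mat 1"
        by (simp add: gx matrix_add_rdistrib' matrix_diff_ldistrib sq)
      ultimately show ?thesis
        using matrix_mul_assoc[of "(inv\<^bsub>H\<^esub> g) x" "g x" "mat 1 - P ** W"] by simp
    qed
    have "h \<otimes>\<^bsub>H\<^esub> (g \<otimes>\<^bsub>H\<^esub> h \<otimes>\<^bsub>H\<^esub> inv\<^bsub>H\<^esub> g) \<in> U'" "h \<otimes>\<^bsub>H\<^esub> h \<in> U'"
      using h U'.inv_op_closed2[OF g h] by auto
    from unip[OF this(1)] unip[OF this(2)]
    have "trace (h x ** (g x ** h x ** (inv\<^bsub>H\<^esub> g) x)) = trace (h x ** h x)"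
      by (simp add: edge_fibre_simps unipotent_trace)
    moreover have "trace (h x ** ((mat 1 + R) ** h x ** (mat 1 - R)))
       = trace (h x ** h x) + (trace (h x ** (R ** h x)) - trace (h x ** (h x ** R)))
         - trace (h x ** (R ** (h x ** R)))" for R
      by (simp add: matrix_add_rdistrib' matrix_diff_ldistrib matrix_diff_rdistrib matrix_add_ldistrib
        trace_add trace_sub matrix_mul_assoc algebra_simps)
    moreover have "trace (h x ** (R ** h x)) = trace (h x ** (h x ** R))" for R
      by (metis matrix_mul_assoc trace_mul_sym)
    ultimately have "trace (h x ** (P ** W ** (h x ** (P ** W)))) = 0"
      by (simp add: gx inv)
    then have tr0: "trace ((h x ** (P ** W)) ** (h x ** (P ** W))) = 0"
      by (simp add: matrix_mul_assoc)
    have hPW: "h x ** (P ** W) = (\<chi> i j. (h x *v (P *v w)) $ i * \<psi> $ j)"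
      unfolding PW by (simp add: mat3_simps matrix_vector_mult_def algebra_simps)
    have tr: "trace ((\<chi> i j. b $ i * \<psi> $ j) ** (\<chi> i j. b $ i * \<psi> $ j)) = (\<Sum>i\<in>UNIV. \<psi> $ i * b $ i)\<^sup>2"
      for b :: "'a ^ 3"
      by (simp add: trace_def matrix_matrix_mult_def sum_3 power2_eq_square algebra_simps)
    show ?thesis using tr0 unfolding hPW tr by simp
  qed
  have fixes_Pw: "h x *v (P *v w) = P *v w" for w
  proof (cases "P *v w = 0")
    case False
    define u where "u = P *v w"
    define w' where "w' = h x *v u"
    \<comment> \<open>The forms with coefficient \<open>u\<^sub>j\<close> at \<open>i\<close> and \<open>- u\<^sub>i\<close> at \<open>j\<close> vanish on \<open>u\<close> and suffice to show that \<open>w'\<close> is a multiple of \<open>u\<close>.\<close>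
    have par: "u $ j * w' $ i = u $ i * w' $ j" for i j
    proof (cases "i = j")
      case False
      have "(\<Sum>k\<in>UNIV. ((\<chi> k. if k = i then u $ j else if k = j then - u $ i else 0) :: 'a ^ 3) $ k * z $ k)
          = u $ j * z $ i - u $ i * z $ j" for z :: "'a ^ 3"
        using False exhaust_3[of i] exhaust_3[of j] by (auto simp: sum_3)
      from key[of "\<chi> k. if k = i then u $ j else if k = j then - u $ i else 0" w,
          folded u_def, unfolded this]
      show ?thesis by (simp add: w'_def)
    qed simp
    obtain j where j: "u $ j \<noteq> 0" using False by (auto simp: u_def vec_eq_iff)
    have c: "h x *v u = (w' $ j / u $ j) *s u"
      using par j by (simp add: vec_eq_iff field_simps flip: w'_def)
    have "u \<noteq> 0" using False by (simp add: u_def)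
    with unip[OF h] c have "w' $ j / u $ j = 1" by (rule unipotent_eigenvalue)
    then show ?thesis using c by (simp add: u_def)
  qed simp
  show ?thesis
    by (simp add: matrix_eq fixes_Pw flip: matrix_vector_mul_assoc)
qed

lemma unipotent_radical_edge:
  assumes "infinite (UNIV :: 'a set)"
  shows "unipotent_radical {x, y} H = U"
proof
  interpret s: edge_maps y x Q P B\<^sub>1 B\<^sub>2 A\<^sub>1 A\<^sub>2 by (rule swap)
  show "unipotent_radical {x, y} H \<subseteq> U"
  proof
    fix h assume "h \<in> unipotent_radical {x, y} H"
    then obtain U' where U': "U' \<lhd> H" "\<forall>h\<in>U'. \<forall>z\<in>{x, y}. unipotent_matrix (h z)" "h \<in> U'"
      by (auto simp: unipotent_radical_def)
    have "h \<in> carrier H"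
      using U'(1,3) by (meson normal_imp_subgroup subgroup.mem_carrier)
    then show "h \<in> U"
      using radical_fixes_image[OF U'(1) _ U'(3)] s.radical_fixes_image[of U' h] U'
      by (auto simp: edge_radical_def edge_fibre_commute)
  qed
  show "U \<subseteq> unipotent_radical {x, y} H"
    unfolding unipotent_radical_def
    using radical_normal radical_closed radical_connected[OF assms] radical_unipotent by blast
qed

end

section \<open>The valuation ring and its residue map\<close>

lemma infinite_alg_closed_field: "infinite (UNIV :: 'a::alg_closed_field set)"
proof
  assume fin: "finite (UNIV :: 'a set)"
  define q where "q = (\<Prod>a\<in>(UNIV :: 'a set). [:- a, 1:])"
  have "Polynomial.degree q = card (UNIV :: 'a set)"
    unfolding q_def by (subst degree_prod_eq_sum_degree) auto
  moreover have "card (UNIV :: 'a set) > 0" using fin by (simp add: card_gt_0_iff)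
  ultimately have "Polynomial.degree (q + 1) > 0" by (simp add: degree_add_eq_left)
  then obtain a where "poly (q + 1) a = 0" using alg_closed_imp_poly_has_root by blast
  moreover have "poly q a = 0"
    unfolding q_def poly_prod by (rule prod_zero[OF fin]) auto
  ultimately show False by simp
qed

lemma of_int_mod_card: "(of_int (k mod int CARD('p)) :: 'p::prime_card mod_ring) = of_int k"
proof -
  have "(of_int k :: 'p mod_ring) = of_int (int CARD('p) * (k div int CARD('p)) + k mod int CARD('p))"
    by simp
  also have "\<dots> = of_int (k mod int CARD('p))"
    by (simp only: of_int_add of_int_mult of_int_of_nat_eq of_nat_card_eq_0) simp
  finally show ?thesis by simp
qed

lemma padic_residue_add: "padic_residue (a + b) = padic_residue a + padic_residue b"
  unfolding padic_residue_def plus_padic_int.rep_eq power_one_right of_int_mod_card by simp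

lemma padic_residue_mult: "padic_residue (a * b) = padic_residue a * padic_residue b"
  unfolding padic_residue_def times_padic_int.rep_eq power_one_right of_int_mod_card by simp

lemma padic_residue_diff: "padic_residue (a - b) = padic_residue a - padic_residue b"
  unfolding padic_residue_def minus_padic_int.rep_eq power_one_right of_int_mod_card by simp

lemma padic_residue_1: "padic_residue 1 = 1"
  unfolding padic_residue_def one_padic_int.rep_eq power_one_right of_int_mod_card by simp

lemma padic_residue_0: "padic_residue 0 = 0"
  unfolding padic_residue_def zero_padic_int.rep_eq by simp

lemma padic_residue_of_nat: "padic_residue (of_nat n) = of_nat n"
  by (induction n) (simp_all add: padic_residue_0 padic_residue_1 padic_residue_add)

context padic_extension
begin

abbreviation ring_of_integers ("\<O>") where "\<O> \<equiv> valuation_ring"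
abbreviation prime_ideal ("\<mm>") where "\<mm> \<equiv> maximal_ideal"

lemma v_1 [simp]: "v 1 = 0"
  using v_mult[of 1 1] by simp

lemma v_minus_1: "v (- 1) = 0"
  using v_mult[of "- 1" "- 1"] by simp

lemma v_inverse: "x \<noteq> 0 \<Longrightarrow> v (inverse x) = - v x"
  using v_mult[of x "inverse x"] by simp

lemma v_divide: "x \<noteq> 0 \<Longrightarrow> y \<noteq> 0 \<Longrightarrow> v (x / y) = v x - v y"
  by (simp add: divide_inverse v_mult v_inverse)

lemma in_O_iff: "x \<in> \<O> \<longleftrightarrow> x = 0 \<or> 0 \<le> v x"
  by (simp add: valuation_ring_def)

lemma in_m_iff: "x \<in> \<mm> \<longleftrightarrow> x = 0 \<or> 1 \<le> v x"
  by (simp add: maximal_ideal_def)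

lemma O_0 [simp]: "0 \<in> \<O>" and O_1 [simp]: "1 \<in> \<O>" and m_0 [simp]: "0 \<in> \<mm>" and m_1 [simp]: "1 \<notin> \<mm>"
  by (auto simp: in_O_iff in_m_iff)

lemma pi_m [simp]: "\<pi> \<in> \<mm>" and pi_O [simp]: "\<pi> \<in> \<O>" and pi_nz [simp]: "\<pi> \<noteq> 0"
  using uniformiser by (auto simp: in_O_iff in_m_iff)

lemma m_imp_O: "x \<in> \<mm> \<Longrightarrow> x \<in> \<O>"
  by (auto simp: in_O_iff in_m_iff)

lemma O_mult [simp]: "x \<in> \<O> \<Longrightarrow> y \<in> \<O> \<Longrightarrow> x * y \<in> \<O>"
  by (cases "x = 0"; cases "y = 0") (auto simp: in_O_iff v_mult)

lemma m_mult_left: "x \<in> \<O> \<Longrightarrow> y \<in> \<mm> \<Longrightarrow> x * y \<in> \<mm>"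
  by (cases "x = 0"; cases "y = 0") (auto simp: in_O_iff in_m_iff v_mult)

lemma m_mult_right: "x \<in> \<mm> \<Longrightarrow> y \<in> \<O> \<Longrightarrow> x * y \<in> \<mm>"
  using m_mult_left[of y x] by (simp add: mult.commute)

lemma O_add [simp]: "x \<in> \<O> \<Longrightarrow> y \<in> \<O> \<Longrightarrow> x + y \<in> \<O>"
  using v_add[of x y] by (cases "x = 0"; cases "y = 0"; cases "x + y = 0") (auto simp: in_O_iff)

lemma m_add [simp]: "x \<in> \<mm> \<Longrightarrow> y \<in> \<mm> \<Longrightarrow> x + y \<in> \<mm>"
  using v_add[of x y] by (cases "x = 0"; cases "y = 0"; cases "x + y = 0") (auto simp: in_m_iff)

lemma O_minus [simp]: "- x \<in> \<O> \<longleftrightarrow> x \<in> \<O>"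
  by (cases "x = 0") (use v_mult[of "- 1" x] v_minus_1 in \<open>auto simp: in_O_iff\<close>)

lemma m_minus [simp]: "- x \<in> \<mm> \<longleftrightarrow> x \<in> \<mm>"
  by (cases "x = 0") (use v_mult[of "- 1" x] v_minus_1 in \<open>auto simp: in_m_iff\<close>)

lemma O_diff [simp]: "x \<in> \<O> \<Longrightarrow> y \<in> \<O> \<Longrightarrow> x - y \<in> \<O>"
  using O_add[of x "- y"] by simp

lemma m_diff [simp]: "x \<in> \<mm> \<Longrightarrow> y \<in> \<mm> \<Longrightarrow> x - y \<in> \<mm>"
  using m_add[of x "- y"] by simp

lemma m_add_cancel: "y \<in> \<mm> \<Longrightarrow> x + y \<in> \<mm> \<longleftrightarrow> x \<in> \<mm>"
  using m_diff[of "x + y" y] m_add[of x y] by auto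

lemma unit_inverse: "x \<in> \<O> \<Longrightarrow> x \<notin> \<mm> \<Longrightarrow> x \<noteq> 0 \<and> inverse x \<in> \<O> \<and> v x = 0"
  by (auto simp: in_O_iff in_m_iff v_inverse)

lemma unit_iff: "x \<in> \<O> \<and> x \<notin> \<mm> \<longleftrightarrow> x \<noteq> 0 \<and> v x = 0"
  by (auto simp: in_O_iff in_m_iff)

lemma m_prime: "x \<in> \<O> \<Longrightarrow> y \<in> \<O> \<Longrightarrow> x * y \<in> \<mm> \<Longrightarrow> x \<in> \<mm> \<or> y \<in> \<mm>"
  by (cases "x = 0"; cases "y = 0") (auto simp: in_O_iff in_m_iff v_mult)

lemma m_iff_pi: "x \<in> \<mm> \<longleftrightarrow> x / \<pi> \<in> \<O>"
  using uniformiser v_divide[of x \<pi>] by (cases "x = 0") (auto simp: in_O_iff in_m_iff)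

lemma pi_mult_m_iff [simp]: "\<pi> * x \<in> \<mm> \<longleftrightarrow> x \<in> \<O>" "x * \<pi> \<in> \<mm> \<longleftrightarrow> x \<in> \<O>"
  by (simp_all add: m_iff_pi)

abbreviation embed :: "'p padic_int \<Rightarrow> 'K" where "embed a \<equiv> \<iota> (Fract a 1)"

lemma embed_add: "embed (a + b) = embed a + embed b"
  by (simp flip: hom_add)

lemma embed_mult: "embed (a * b) = embed a * embed b"
  by (simp flip: hom_mult)

lemma embed_diff: "embed (a - b) = embed a - embed b"
  by (simp flip: hom_minus)

lemma embed_1: "embed 1 = 1"
  by (simp flip: One_fract_def)

lemma embed_0: "embed 0 = 0"
  by (simp flip: Zero_fract_def)

lemma embed_of_nat: "embed (of_nat n) = of_nat n"
  by (induction n) (simp_all add: embed_0 embed_1 embed_add)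

lemma embed_O: "embed a \<in> \<O>"
proof (cases "a = 0")
  case False
  then have "Fract a 1 \<noteq> 0" by (simp add: eq_fract Zero_fract_def)
  then show ?thesis using v_extends[of "Fract a 1"] by (auto simp: in_O_iff)
qed (simp add: embed_0)

text \<open>An element of the image that is not in the maximal ideal is a unit, and its inverse is again the
  image of a \<open>p\<close>-adic integer because the valuation of \<open>K\<close> extends the \<open>p\<close>-adic one.\<close>

lemma embed_m: "padic_residue a = 0 \<Longrightarrow> embed a \<in> \<mm>"
proof (rule ccontr)
  assume res: "padic_residue a = 0" and "embed a \<notin> \<mm>"
  then have u: "embed a \<noteq> 0" "v (embed a) = 0" using unit_inverse[OF embed_O] by auto
  then have "a \<noteq> 0" using embed_0 by auto
  then have nz: "Fract 1 a \<noteq> 0" by (simp add: eq_fract Zero_fract_def)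
  have "\<iota> (Fract 1 a) = inverse (embed a)" by (simp flip: hom_inverse)
  then have "0 \<le> v (\<iota> (Fract 1 a))" using u by (simp add: v_inverse)
  then obtain b where "Fract 1 a = Fract b 1" using v_extends[OF nz] by blast
  then have "b * a = 1" using \<open>a \<noteq> 0\<close> by (simp add: eq_fract)
  then show False using padic_residue_mult[of b a] res by (simp add: padic_residue_1)
qed

lemma embed_m_iff: "embed a \<in> \<mm> \<longleftrightarrow> padic_residue a = 0"
proof
  assume m: "embed a \<in> \<mm>"
  show "padic_residue a = 0"
  proof (rule ccontr)
    assume nz: "padic_residue a \<noteq> 0"
    obtain n where n: "inverse (padic_residue a) = of_nat n" using surj_of_nat_mod_ring by blast
    have "padic_residue (a * of_nat n - 1) = 0"
      using nz by (simp add: padic_residue_diff padic_residue_mult padic_residue_of_nat padic_residue_1 flip: n)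
    then have "embed (a * of_nat n - 1) \<in> \<mm>" by (rule embed_m)
    then have "embed a * embed (of_nat n) - 1 \<in> \<mm>" by (simp add: embed_diff embed_mult embed_1)
    from m_diff[OF m_mult_right[OF m embed_O[of "of_nat n"]] this] show False by simp
  qed
qed (rule embed_m)

end

context totally_ramified_extension
begin

lemma residue_map_eqI:
  assumes "x - embed a \<in> \<mm>"
  shows "residue_map x = padic_residue a"
  unfolding residue_map_def
proof (rule the_equality)
  show "\<exists>a'. x - embed a' \<in> \<mm> \<and> padic_residue a = padic_residue a'" using assms by blast
  fix r assume "\<exists>a'. x - embed a' \<in> \<mm> \<and> r = padic_residue a'"
  then obtain a' where a': "x - embed a' \<in> \<mm>" "r = padic_residue a'" by blast
  have "(x - embed a') - (x - embed a) \<in> \<mm>" using m_diff[OF a'(1) assms] .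
  then have "embed (a - a') \<in> \<mm>" by (simp add: embed_diff)
  then show "r = padic_residue a" using a' by (simp add: embed_m_iff padic_residue_diff)
qed

lemma residue_mapE:
  assumes "x \<in> \<O>"
  obtains a where "x - embed a \<in> \<mm>" "residue_map x = padic_residue a"
  using totally_ramified[OF assms] residue_map_eqI by blast

text \<open>The entries of \<open>reduce_matrix\<close>: the residue, regarded in the algebraic closure.\<close>

definition \<rho> :: "'K \<Rightarrow> 'p mod_ring alg_closure" where
  "\<rho> x = to_ac (residue_map x)"

lemma residue_map_add: "x \<in> \<O> \<Longrightarrow> y \<in> \<O> \<Longrightarrow> residue_map (x + y) = residue_map x + residue_map y"
proof -
  assume "x \<in> \<O>" "y \<in> \<O>"
  then obtain a b where "x - embed a \<in> \<mm>" "y - embed b \<in> \<mm>"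
    and r: "residue_map x = padic_residue a" "residue_map y = padic_residue b"
    by (metis residue_mapE)
  then have "(x - embed a) + (y - embed b) \<in> \<mm>" by simp
  then have "x + y - embed (a + b) \<in> \<mm>" by (simp add: embed_add algebra_simps)
  then show ?thesis using r by (simp add: residue_map_eqI padic_residue_add)
qed

lemma residue_map_mult: "x \<in> \<O> \<Longrightarrow> y \<in> \<O> \<Longrightarrow> residue_map (x * y) = residue_map x * residue_map y"
proof -
  assume x: "x \<in> \<O>" and "y \<in> \<O>"
  then obtain a b where "x - embed a \<in> \<mm>" "y - embed b \<in> \<mm>"
    and r: "residue_map x = padic_residue a" "residue_map y = padic_residue b"
    by (metis residue_mapE)
  then have "(x - embed a) * embed b + x * (y - embed b) \<in> \<mm>"
    by (intro m_add m_mult_left m_mult_right embed_O x)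
  then have "x * y - embed (a * b) \<in> \<mm>" by (simp add: embed_mult algebra_simps)
  then show ?thesis using r by (simp add: residue_map_eqI padic_residue_mult)
qed

lemma residue_map_of_nat: "residue_map (of_nat n) = of_nat n"
  using residue_map_eqI[of "of_nat n" "of_nat n"] by (simp add: embed_of_nat padic_residue_of_nat)

lemma residue_map_0: "residue_map 0 = 0" and residue_map_1: "residue_map 1 = 1"
  using residue_map_of_nat[of 0] residue_map_of_nat[of 1] by simp_all

lemma residue_map_eq_0_iff: "x \<in> \<O> \<Longrightarrow> residue_map x = 0 \<longleftrightarrow> x \<in> \<mm>"
proof -
  assume "x \<in> \<O>"
  then obtain a where a: "x - embed a \<in> \<mm>" "residue_map x = padic_residue a"
    by (rule residue_mapE)
  have "x \<in> \<mm> \<longleftrightarrow> embed a \<in> \<mm>" using m_add_cancel[OF a(1), of "embed a"] by (simp add: algebra_simps)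
  then show ?thesis using a by (simp add: embed_m_iff)
qed

lemma residue_map_minus: "x \<in> \<O> \<Longrightarrow> residue_map (- x) = - residue_map x"
  using residue_map_add[of x "- x"] by (simp add: residue_map_0 add_eq_0_iff)

lemma residue_map_diff: "x \<in> \<O> \<Longrightarrow> y \<in> \<O> \<Longrightarrow> residue_map (x - y) = residue_map x - residue_map y"
  using residue_map_add[of x "- y"] by (simp add: residue_map_minus)

lemma \<rho>_simps:
  "\<rho> 0 = 0" "\<rho> 1 = 1"
  "x \<in> \<O> \<Longrightarrow> y \<in> \<O> \<Longrightarrow> \<rho> (x + y) = \<rho> x + \<rho> y"
  "x \<in> \<O> \<Longrightarrow> y \<in> \<O> \<Longrightarrow> \<rho> (x * y) = \<rho> x * \<rho> y"
  "x \<in> \<O> \<Longrightarrow> y \<in> \<O> \<Longrightarrow> \<rho> (x - y) = \<rho> x - \<rho> y"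
  "x \<in> \<O> \<Longrightarrow> \<rho> x = 0 \<longleftrightarrow> x \<in> \<mm>"
  by (simp_all add: \<rho>_def residue_map_add residue_map_mult residue_map_diff residue_map_0
    residue_map_1 residue_map_eq_0_iff)

abbreviation red where "red \<equiv> reduce_matrix"

definition small_matrix :: "'K ^ 3 ^ 3 \<Rightarrow> bool" where
  "small_matrix A \<longleftrightarrow> (\<forall>i j. A $ i $ j \<in> \<mm>)"

lemma red_nth [simp]: "red A $ i $ j = \<rho> (A $ i $ j)"
  by (simp add: reduce_matrix_def \<rho>_def)

lemma integral_nth: "integral_matrix A \<Longrightarrow> A $ i $ j \<in> \<O>"
  by (simp add: integral_matrix_def)

lemma integral_mat_1 [simp]: "integral_matrix (mat 1)"
  by (simp add: integral_matrix_def mat_def)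

lemma integral_mult [simp]: "integral_matrix A \<Longrightarrow> integral_matrix B \<Longrightarrow> integral_matrix (A ** B)"
  by (simp add: integral_matrix_def matrix_matrix_mult_def sum_3)

lemma integral_diff [simp]: "integral_matrix A \<Longrightarrow> integral_matrix B \<Longrightarrow> integral_matrix (A - B)"
  by (simp add: integral_matrix_def)

lemma small_mult_left: "integral_matrix A \<Longrightarrow> small_matrix B \<Longrightarrow> small_matrix (A ** B)"
  by (simp add: integral_matrix_def small_matrix_def matrix_matrix_mult_def sum_3 m_mult_left)

lemma small_mult_right: "small_matrix A \<Longrightarrow> integral_matrix B \<Longrightarrow> small_matrix (A ** B)"
  by (simp add: integral_matrix_def small_matrix_def matrix_matrix_mult_def sum_3 m_mult_right)

lemma red_mult: "integral_matrix A \<Longrightarrow> integral_matrix B \<Longrightarrow> red (A ** B) = red A ** red B"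
  by (simp add: integral_matrix_def vec_eq_iff matrix_matrix_mult_def sum_3 \<rho>_simps)

lemma red_diff: "integral_matrix A \<Longrightarrow> integral_matrix B \<Longrightarrow> red (A - B) = red A - red B"
  by (simp add: integral_matrix_def vec_eq_iff \<rho>_simps)

lemma red_mat_1 [simp]: "red (mat 1) = mat 1"
  by (simp add: vec_eq_iff mat_def \<rho>_simps)

lemma red_eq_0_iff: "integral_matrix A \<Longrightarrow> red A = 0 \<longleftrightarrow> small_matrix A"
  by (simp add: vec_eq_iff small_matrix_def integral_matrix_def \<rho>_simps)

lemma integral_det: "integral_matrix A \<Longrightarrow> det A \<in> \<O>"
  by (simp add: integral_matrix_def det_3)

lemma det_red: "integral_matrix A \<Longrightarrow> det (red A) = \<rho> (det A)"
  by (simp add: integral_matrix_def det_3 \<rho>_simps)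

text \<open>The group \<open>GL\<^sub>3(\<O>)\<close>.\<close>

definition GLO :: "('K ^ 3 ^ 3) set" where
  "GLO = {k. integral_matrix k \<and> det k \<in> \<O> - \<mm>}"

lemma GLO_det_nz: "k \<in> GLO \<Longrightarrow> det k \<noteq> 0"
  by (auto simp: GLO_def)

lemma GLO_inv: "k \<in> GLO \<Longrightarrow> matrix_inv k \<in> GLO"
proof -
  assume k: "k \<in> GLO"
  then have u: "det k \<noteq> 0" "inverse (det k) \<in> \<O>" "v (det k) = 0" using unit_inverse[of "det k"] by (auto simp: GLO_def)
  have ki: "k $ i $ j \<in> \<O>" for i j using k by (simp add: GLO_def integral_nth)
  have "adj3 k $ i $ j \<in> \<O>" for i j
    using exhaust_3[of i] exhaust_3[of j] by (auto simp: adj3_def ki)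
  then have "integral_matrix (matrix_inv k)"
    using u by (simp add: integral_matrix_def matrix_inv_adj3 divide_inverse)
  moreover have "det k * det (matrix_inv k) = 1"
    using matrix_inv_right'[OF u(1)] by (metis det_I det_mul)
  then have "det (matrix_inv k) = inverse (det k)" by (simp add: inverse_unique)
  then have "det (matrix_inv k) \<in> \<O> - \<mm>"
    using u unit_iff[of "det (matrix_inv k)"] by (auto simp: v_inverse)
  ultimately show ?thesis by (simp add: GLO_def)
qed

lemma GLO_mult: "k \<in> GLO \<Longrightarrow> l \<in> GLO \<Longrightarrow> k ** l \<in> GLO"
  using m_prime[of "det k" "det l"] by (auto simp: GLO_def det_mul)

lemma GLO_1 [simp]: "mat 1 \<in> GLO"
  by (simp add: GLO_def)

lemma GLO_integral: "k \<in> GLO \<Longrightarrow> integral_matrix k"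
  by (simp add: GLO_def)

lemma GLO_inverse_mult: "k \<in> GLO \<Longrightarrow> k ** matrix_inv k = mat 1" "k \<in> GLO \<Longrightarrow> matrix_inv k ** k = mat 1"
  by (simp_all add: matrix_inv_right' matrix_inv_left' GLO_det_nz)

lemma GLO_matrix_inv_inv: "k \<in> GLO \<Longrightarrow> matrix_inv (matrix_inv k) = k"
  by (rule matrix_inv_unique) (rule GLO_inverse_mult)

end

section \<open>Lattices, vertices and frames\<close>

lemma mat_mult_nth: "(mat c ** A) $ i $ j = c * (A :: 'a::comm_ring_1 ^ 'n ^ 'n) $ i $ j"
  by (simp add: matrix_matrix_mult_def mat_def if_distrib if_distribR sum.delta' sum.delta cong: if_cong)

lemma mat_commute: "A ** mat c = mat c ** (A :: 'a::comm_ring_1 ^ 'n ^ 'n)"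
proof -
  have "(A ** mat c) $ i $ j = c * A $ i $ j" for i j
    by (simp add: matrix_matrix_mult_def mat_def if_distrib if_distribR sum.delta' sum.delta mult.commute cong: if_cong)
  then show ?thesis by (simp add: vec_eq_iff mat_mult_nth)
qed

lemma mat_mult_mat: "mat c ** mat d = (mat (c * d) :: 'a::comm_ring_1 ^ 'n ^ 'n)"
  by (simp add: vec_eq_iff mat_mult_nth) (simp add: mat_def)

lemma mat_mult_vec: "mat c *v u = c *s (u :: 'a::comm_ring_1 ^ 'n)"
  by (simp add: vec_eq_iff matrix_vector_mult_def mat_def if_distrib if_distribR sum.delta' sum.delta cong: if_cong)

lemma det_mat3: "det (mat c :: 'a::comm_ring_1 ^ 3 ^ 3) = c ^ 3"
  by (simp add: det_3 mat_def power3_eq_cube)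

lemma matrix_inv_mult:
  fixes A B :: "'a::field ^ 3 ^ 3"
  assumes "det A \<noteq> 0" "det B \<noteq> 0"
  shows "matrix_inv (A ** B) = matrix_inv B ** matrix_inv A"
proof (rule matrix_inv_unique)
  have "A ** B ** (matrix_inv B ** matrix_inv A) = A ** (B ** matrix_inv B) ** matrix_inv A"
    by (simp add: matrix_mul_assoc)
  then show "A ** B ** (matrix_inv B ** matrix_inv A) = mat 1"
    using assms by (simp add: matrix_inv_right')
qed

lemma matrix_inv_mat:
  "c \<noteq> 0 \<Longrightarrow> matrix_inv (mat c :: 'a::field ^ 3 ^ 3) = mat (1 / c)"
  by (rule matrix_inv_unique) (simp add: mat_mult_mat)

lemma det_matrix_inv:
  fixes A :: "'a::field ^ 3 ^ 3"
  assumes "det A \<noteq> 0"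
  shows "det (matrix_inv A) = inverse (det A)"
  using matrix_inv_right'[OF assms] by (metis det_I det_mul inverse_unique)

lemma conj_scaled:
  fixes A B k l Y :: "'a::field ^ 3 ^ 3"
  assumes "a \<noteq> 0" "det A \<noteq> 0" "det k \<noteq> 0"
  shows "matrix_inv (mat a ** A ** k) ** Y ** (mat b ** B ** l)
    = mat (b / a) ** (matrix_inv k ** (matrix_inv A ** Y ** B) ** l)"
proof -
  have "matrix_inv (mat a ** A ** k) = (matrix_inv k ** matrix_inv A) ** mat (1 / a)"
    using assms by (simp add: matrix_inv_mult det_mul det_mat3 matrix_inv_mat matrix_mul_assoc)
  also have "\<dots> = mat (1 / a) ** (matrix_inv k ** matrix_inv A)" by (rule mat_commute)
  finally have "matrix_inv (mat a ** A ** k) ** Y ** (mat b ** B ** l)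
      = mat (1 / a) ** ((matrix_inv k ** matrix_inv A ** Y) ** mat b) ** (B ** l)"
    by (simp add: matrix_mul_assoc)
  also have "(matrix_inv k ** matrix_inv A ** Y) ** mat b = mat b ** (matrix_inv k ** matrix_inv A ** Y)"
    by (rule mat_commute)
  also have "mat (1 / a) ** (mat b ** (matrix_inv k ** matrix_inv A ** Y)) ** (B ** l)
      = mat (1 / a) ** mat b ** (matrix_inv k ** (matrix_inv A ** Y ** B) ** l)"
    by (simp only: matrix_mul_assoc)
  finally show ?thesis by (simp add: mat_mult_mat)
qed

lemma matrix_cancel: "A ** B = mat 1 \<Longrightarrow> A ** (B ** R) = (R :: 'a::semiring_1 ^ 3 ^ 3)"
  by (simp add: matrix_mul_assoc)

context totally_ramified_extension
begin

abbreviation integral_vector :: "'K ^ 3 \<Rightarrow> bool" where "integral_vector a \<equiv> (\<forall>i. a $ i \<in> \<O>)"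

lemma integral_mult_vec: "integral_matrix A \<Longrightarrow> integral_vector a \<Longrightarrow> integral_vector (A *v a)"
  by (simp add: integral_matrix_def matrix_vector_mult_def sum_3)

lemma integral_iff_vec: "integral_matrix A \<longleftrightarrow> (\<forall>a. integral_vector a \<longrightarrow> integral_vector (A *v a))"
proof
  assume *: "\<forall>a. integral_vector a \<longrightarrow> integral_vector (A *v a)"
  have "(A *v axis j 1) $ i = A $ i $ j" for i j
    by (simp add: matrix_vector_mult_def axis_def if_distrib if_distribR sum.delta' sum.delta cong: if_cong)
  moreover have "integral_vector (axis j 1)" for j by (simp add: axis_def)
  ultimately show "integral_matrix A" unfolding integral_matrix_def by (metis *)
qed (use integral_mult_vec in blast)

lemma lattice_subset_iff:
  assumes "det A \<noteq> 0"
  shows "lattice_of B \<subseteq> lattice_of A \<longleftrightarrow> integral_matrix (matrix_inv A ** B)"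
proof
  assume sub: "lattice_of B \<subseteq> lattice_of A"
  show "integral_matrix (matrix_inv A ** B)"
    unfolding integral_iff_vec
  proof (intro allI impI)
    fix a i assume "integral_vector a"
    then have "B *v a \<in> lattice_of A" using sub by (auto simp: lattice_of_def)
    then obtain b where b: "B *v a = A *v b" "integral_vector b" by (auto simp: lattice_of_def)
    have "(matrix_inv A ** B) *v a = (matrix_inv A ** A) *v b"
      by (simp add: b flip: matrix_vector_mul_assoc)
    then show "((matrix_inv A ** B) *v a) $ i \<in> \<O>" using b by (simp add: matrix_inv_left' assms)
  qed
next
  assume int: "integral_matrix (matrix_inv A ** B)"
  show "lattice_of B \<subseteq> lattice_of A"
  proof
    fix u assume "u \<in> lattice_of B"
    then obtain a where a: "u = B *v a" "integral_vector a" by (auto simp: lattice_of_def)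
    have "u = A *v ((matrix_inv A ** B) *v a)"
      by (simp add: a matrix_vector_mul_assoc matrix_mul_assoc matrix_inv_right' assms)
    then show "u \<in> lattice_of A" using integral_mult_vec[OF int a(2)] by (auto simp: lattice_of_def)
  qed
qed

lemma lattice_scale: "(\<lambda>u. c *s u) ` lattice_of A = lattice_of (mat c ** A)"
proof -
  have "(mat c ** A) *v a = c *s (A *v a)" for a
    by (simp add: mat_mult_vec flip: matrix_vector_mul_assoc)
  then show ?thesis by (auto simp: lattice_of_def)
qed

lemma lattice_image: "(\<lambda>u. g *v u) ` lattice_of A = lattice_of (g ** A)"
  by (auto simp: lattice_of_def image_iff simp flip: matrix_vector_mul_assoc)

lemma integral_GLO: "integral_matrix k \<Longrightarrow> integral_matrix l \<Longrightarrow> k ** l = mat 1 \<Longrightarrow> k \<in> GLO"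
proof -
  assume k: "integral_matrix k" "integral_matrix l" and e: "k ** l = mat 1"
  have "det k * det l = 1" using e by (metis det_I det_mul)
  then show "k \<in> GLO"
    using k m_mult_right[of "det k" "det l"] by (auto simp: GLO_def integral_det)
qed

lemma lattice_eq_iff:
  assumes "det A \<noteq> 0" "det B \<noteq> 0"
  shows "lattice_of A = lattice_of B \<longleftrightarrow> matrix_inv A ** B \<in> GLO"
proof -
  have inv: "matrix_inv A ** B ** (matrix_inv B ** A) = mat 1" "matrix_inv (matrix_inv A ** B) = matrix_inv B ** A"
    using matrix_inv_right'[OF assms(2)] matrix_inv_left'[OF assms(1)]
    by (auto intro!: matrix_inv_unique) (metis matrix_mul_assoc matrix_mul_rid)+
  show ?thesis
    using integral_GLO[of "matrix_inv A ** B" "matrix_inv B ** A"] inv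
      GLO_inv[of "matrix_inv A ** B"] lattice_subset_iff[OF assms(1), of B] lattice_subset_iff[OF assms(2), of A]
    by (auto simp: GLO_integral set_eq_subset)
qed

text \<open>The vertex represented by the lattice whose basis is formed by the columns of \<open>A\<close>.\<close>

definition vert :: "'K ^ 3 ^ 3 \<Rightarrow> ('K ^ 3) set set" where
  "vert A = homothety_class (lattice_of A)"

lemma vert_alt: "vert A = {lattice_of (mat c ** A) | c. c \<noteq> 0}"
  by (simp add: vert_def homothety_class_def lattice_scale)

lemma vertices_alt: "vertices = {vert A | A. det A \<noteq> 0}"
  by (auto simp: vertices_def lattices_def vert_def invertible_det_nz)

lemma vert_eq_iff:
  assumes "det A \<noteq> 0" "det B \<noteq> 0"
  shows "vert A = vert B \<longleftrightarrow> (\<exists>c k. c \<noteq> 0 \<and> k \<in> GLO \<and> B = mat c ** A ** k)"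
proof
  assume "vert A = vert B"
  moreover have "lattice_of B \<in> vert B"
    unfolding vert_alt by (intro CollectI exI[of _ 1]) simp
  ultimately have "lattice_of B \<in> vert A" by simp
  then obtain c where c: "c \<noteq> 0" "lattice_of B = lattice_of (mat c ** A)"
    by (auto simp: vert_alt)
  have d: "det (mat c ** A) \<noteq> 0" using c assms by (simp add: det_mul det_mat3)
  then have "matrix_inv (mat c ** A) ** B \<in> GLO" using lattice_eq_iff[OF d assms(2)] c by simp
  moreover have "B = mat c ** A ** (matrix_inv (mat c ** A) ** B)"
    using matrix_cancel[OF matrix_inv_right'[OF d]] by simp
  ultimately show "\<exists>c k. c \<noteq> 0 \<and> k \<in> GLO \<and> B = mat c ** A ** k" using c by blast
next
  assume "\<exists>c k. c \<noteq> 0 \<and> k \<in> GLO \<and> B = mat c ** A ** k"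
  then obtain c k where c: "c \<noteq> 0" and k: "k \<in> GLO" and B: "B = mat c ** A ** k" by blast
  have "lattice_of (mat d ** B) = lattice_of (mat (d * c) ** A)" if "d \<noteq> 0" for d
  proof -
    have nz: "det (mat (d * c) ** A) \<noteq> 0" "det (mat d ** B) \<noteq> 0" using that c assms by (simp_all add: det_mul det_mat3)
    have "mat d ** B = mat (d * c) ** A ** k" by (simp add: B matrix_mul_assoc mat_mult_mat)
    then have "matrix_inv (mat (d * c) ** A) ** (mat d ** B) = k"
      using matrix_cancel[OF matrix_inv_left'[OF nz(1)]] by (simp add: matrix_mul_assoc)
    then show ?thesis using lattice_eq_iff[OF nz] k by simp
  qed
  note lat = this
  show "vert A = vert B"
  proof
    show "vert B \<subseteq> vert A"
    proof
      fix L assume "L \<in> vert B"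
      then obtain d where "d \<noteq> 0" "L = lattice_of (mat (d * c) ** A)" by (auto simp: vert_alt lat)
      then show "L \<in> vert A" unfolding vert_alt using c by (intro CollectI exI[of _ "d * c"]) simp
    qed
    show "vert A \<subseteq> vert B"
    proof
      fix L assume "L \<in> vert A"
      then obtain d where d: "d \<noteq> 0" "L = lattice_of (mat d ** A)" by (auto simp: vert_alt)
      then have "L = lattice_of (mat (d / c) ** B)" using lat[of "d / c"] c by simp
      then show "L \<in> vert B" unfolding vert_alt using c d by (intro CollectI exI[of _ "d / c"]) simp
    qed
  qed
qed

lemma vert_GLO:
  assumes "det A \<noteq> 0" "k \<in> GLO"
  shows "vert (A ** k) = vert A"
proof -
  have "det (A ** k) \<noteq> 0" using assms GLO_det_nz by (simp add: det_mul)
  moreover have "A ** k = mat 1 ** A ** k" by simp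
  ultimately show ?thesis using vert_eq_iff[of A "A ** k"] assms by (metis zero_neq_one)
qed

lemma act_vert: "act g (vert A) = vert (g ** A)"
proof -
  have "(*v) g ` lattice_of (mat c ** A) = lattice_of (mat c ** (g ** A))" for c
    by (simp add: lattice_image matrix_mul_assoc mat_commute)
  note im = this
  have "act g (vert A) = {(*v) g ` lattice_of (mat c ** A) | c. c \<noteq> 0}"
    unfolding act_def vert_alt by blast
  then show ?thesis unfolding im vert_alt .
qed

text \<open>The valuation of the determinant of a basis modulo \<open>3\<close> is the type of the vertex.\<close>

lemma vert_eq_type:
  assumes "det A \<noteq> 0" "det B \<noteq> 0" "vert A = vert B"
  shows "v (det A) mod 3 = v (det B) mod 3"
proof -
  obtain c k where *: "c \<noteq> 0" "k \<in> GLO" "B = mat c ** A ** k" using assms vert_eq_iff by blast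
  have vk: "v (det k) = 0" using *(2) unit_inverse[of "det k"] by (auto simp: GLO_def)
  have "v (c ^ 3) = 3 * v c" using *(1) by (simp add: power3_eq_cube v_mult)
  then have "v (det B) = 3 * v c + v (det A)"
    using * assms GLO_det_nz[of k] vk by (simp add: det_mul det_mat3 v_mult)
  then show ?thesis by simp
qed

text \<open>This is all that can be said about the choice in \<open>frame\<close>: the frame of a vertex is known up to
  homothety and up to a change of basis of the lattice.\<close>

lemma frameE:
  assumes "det A \<noteq> 0"
  obtains c k where "c \<noteq> 0" "k \<in> GLO" "frame (vert A) = mat c ** A ** k"
proof -
  have "\<exists>B. invertible B \<and> vert A = homothety_class (lattice_of B)"
    using assms by (auto simp: vert_def invertible_det_nz intro: exI[of _ A])
  from someI_ex[OF this] have "det (frame (vert A)) \<noteq> 0" "vert A = vert (frame (vert A))"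
    by (auto simp: frame_def vert_def invertible_det_nz)
  then show ?thesis using vert_eq_iff[OF assms] that by blast
qed

text \<open>Multiplication from the right by \<open>dg S\<close> scales the basis vectors with index in \<open>S\<close> by \<open>\<pi>\<close>. In
  a suitable basis of the larger lattice, every lattice between \<open>L\<close> and \<open>\<pi> L\<close> arises in
  this way.\<close>

definition dg :: "3 set \<Rightarrow> 'K ^ 3 ^ 3" where
  "dg S = (\<chi> i j. if i = j then if i \<in> S then \<pi> else 1 else 0)"

lemma mult_diag_nth:
  fixes A :: "'a::comm_ring_1 ^ 3 ^ 3"
  shows "(A ** (\<chi> i j. if i = j then d i else 0)) $ i $ j = A $ i $ j * d j"
    and "((\<chi> i j. if i = j then d i else 0) ** A) $ i $ j = d i * A $ i $ j"
  by (simp_all add: matrix_matrix_mult_def if_distrib if_distribR sum.delta' sum.delta cong: if_cong)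

lemma dg_mult_nth:
  "(A ** dg S) $ i $ j = A $ i $ j * (if j \<in> S then \<pi> else 1)"
  "(dg S ** A) $ i $ j = (if i \<in> S then \<pi> else 1) * A $ i $ j"
  unfolding dg_def by (simp_all add: mult_diag_nth[where d = "\<lambda>i. if i \<in> S then \<pi> else 1"])

lemma dg_compl: "dg S ** dg (- S) = mat \<pi>" "dg (- S) ** dg S = mat \<pi>"
  by (auto simp: vec_eq_iff dg_mult_nth) (auto simp: dg_def mat_def)

lemma integral_dg [simp]: "integral_matrix (dg S)"
  by (auto simp: integral_matrix_def dg_def)

lemma det_dg [simp]: "det (dg S) \<noteq> 0"
proof -
  have "det (dg S) * det (dg (- S)) = \<pi> ^ 3" by (simp add: dg_compl det_mat3 flip: det_mul)
  then show ?thesis by auto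
qed

lemma matrix_inv_dg: "matrix_inv (dg S) = mat (1 / \<pi>) ** dg (- S)"
proof (rule matrix_inv_unique)
  have "dg S ** (mat (1 / \<pi>) ** dg (- S)) = (dg S ** mat (1 / \<pi>)) ** dg (- S)"
    by (rule matrix_mul_assoc)
  also have "\<dots> = mat (1 / \<pi>) ** dg S ** dg (- S)" by (simp only: mat_commute)
  also have "\<dots> = mat (1 / \<pi>) ** (dg S ** dg (- S))" by (rule matrix_mul_assoc[symmetric])
  also have "\<dots> = mat 1" by (simp add: dg_compl mat_mult_mat)
  finally show "dg S ** (mat (1 / \<pi>) ** dg (- S)) = mat 1" .
qed

lemma det_diagonal: "det (\<chi> i j :: 3. if i = j then d i else 0) = (d 1 * d 2 * d 3 :: 'a::comm_ring_1)"
  by (simp add: det_3)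

lemma det_dg_value: "det (dg S) = (if 1 \<in> S then \<pi> else 1) * (if 2 \<in> S then \<pi> else 1) * (if 3 \<in> S then \<pi> else 1)"
  unfolding dg_def by (simp add: det_diagonal[where d = "\<lambda>i. if i \<in> S then \<pi> else 1"])

lemma v_det_dg: "v (det (dg {})) = 0" "v (det (dg {3})) = 1" "v (det (dg {2})) = 1" "v (det (dg {2, 3})) = 2"
  using uniformiser v_mult[of \<pi> \<pi>] by (auto simp: det_dg_value)

lemma dg_empty: "dg {} = mat 1"
  by (auto simp: dg_def mat_def vec_eq_iff)

lemma red_mat: "red (mat c) = mat (\<rho> c)"
  by (simp add: vec_eq_iff mat_def \<rho>_simps)

lemma integral_mat_mult: "c \<in> \<O> \<Longrightarrow> integral_matrix A \<Longrightarrow> integral_matrix (mat c ** A)"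
  by (simp add: integral_matrix_def mat_mult_nth)

lemma integral_mat: "integral_matrix (mat c) \<longleftrightarrow> c \<in> \<O>"
proof
  assume "integral_matrix (mat c)"
  then have "mat c $ 1 $ (1 :: 3) \<in> \<O>" by (rule integral_nth)
  then show "c \<in> \<O>" by (simp add: mat_def)
qed (simp add: integral_matrix_def mat_def)

lemma conj_dg_nth: "(matrix_inv (dg S) ** Z ** dg S) $ i $ j
      = (if i \<in> S then 1 / \<pi> else 1) * Z $ i $ j * (if j \<in> S then \<pi> else 1)"
  by (auto simp: matrix_inv_dg dg_mult_nth mat_mult_nth simp flip: matrix_mul_assoc)

lemma integral_diff_mat_1: "integral_matrix (A - mat 1) \<longleftrightarrow> integral_matrix A"
proof
  assume "integral_matrix (A - mat 1)"
  then have "(A - mat 1) $ i $ j + mat 1 $ i $ j \<in> \<O>" for i j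
    by (intro O_add integral_nth integral_mat_1)
  then show "integral_matrix A" by (simp add: integral_matrix_def)
qed simp

text \<open>The possible values of \<open>g - 1\<close> for \<open>g\<close> in the group attached to the edge between \<open>A\<close> and \<open>A ** dg S\<close>,
  in the basis \<open>A\<close>. The reduction of \<open>Z\<close> may be nonzero only in the block with row not in \<open>S\<close> and
  column in \<open>S\<close>.\<close>

definition edge_condition :: "3 set \<Rightarrow> 'K ^ 3 ^ 3 \<Rightarrow> bool" where
  "edge_condition S Z \<longleftrightarrow> (\<forall>i j. Z $ i $ j \<in> \<O> \<and> (i \<in> S \<or> j \<notin> S \<longrightarrow> Z $ i $ j \<in> \<mm>))"

end

section \<open>The subgroup attached to an edge\<close>

context totally_ramified_extension
begin

text \<open>The transition matrices that occur in the special fibre of an edge, for arbitrary frames of its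
  vertices. Up to scalars and factors in \<open>GL\<^sub>3(\<O>)\<close> they are \<open>dg S\<close> and \<open>dg (- S)\<close>.\<close>

lemma
  assumes A: "det A \<noteq> 0" and k: "det k \<noteq> 0" and l: "det l \<noteq> 0" and ab: "a \<noteq> 0" "b \<noteq> 0"
  shows transition_down: "matrix_inv (mat a ** A ** k) ** mat c ** (mat b ** (A ** dg S) ** l)
      = mat (c * b / a) ** (matrix_inv k ** dg S ** l)" (is ?down)
    and transition_up: "matrix_inv (mat b ** (A ** dg S) ** l) ** mat c ** (mat a ** A ** k)
      = mat (c * a / (b * \<pi>)) ** (matrix_inv l ** dg (- S) ** k)" (is ?up)
    and frame_conj: "matrix_inv (mat a ** A ** k) ** g ** (mat a ** A ** k)
      = matrix_inv k ** (matrix_inv A ** g ** A) ** k"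
proof -
  have AS: "det (A ** dg S) \<noteq> 0" using A by (simp add: det_mul)
  have pull: "matrix_inv k' ** (mat c ** R) ** l' = mat c ** (matrix_inv k' ** R ** l')" for R k' l' :: "'K ^ 3 ^ 3" and c
    by (metis mat_commute matrix_mul_assoc)
  have "matrix_inv A ** mat c ** (A ** dg S) = mat c ** (matrix_inv A ** A) ** dg S"
    by (simp only: mat_commute[of "matrix_inv A"] matrix_mul_assoc)
  then have e: "matrix_inv A ** mat c ** (A ** dg S) = mat c ** dg S" using A by (simp add: matrix_inv_left')
  show ?down
    unfolding conj_scaled[OF ab(1) A k] e pull by (simp add: matrix_mul_assoc mat_mult_mat mult.commute)
  have "matrix_inv (A ** dg S) ** mat c ** A = mat c ** matrix_inv (dg S) ** (matrix_inv A ** A)"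
    using A by (simp add: matrix_inv_mult matrix_mul_assoc mat_commute[of "matrix_inv (dg S) ** matrix_inv A"])
  then have e: "matrix_inv (A ** dg S) ** mat c ** A = mat (c / \<pi>) ** dg (- S)"
    using A by (simp add: matrix_inv_left' matrix_inv_dg matrix_mul_assoc mat_mult_mat)
  show ?up
    unfolding conj_scaled[OF ab(2) AS l] e pull by (simp add: matrix_mul_assoc mat_mult_mat mult.commute)
  show "matrix_inv (mat a ** A ** k) ** g ** (mat a ** A ** k)
      = matrix_inv k ** (matrix_inv A ** g ** A) ** k"
    unfolding conj_scaled[OF ab(1) A k] using ab by simp
qed

text \<open>A diagonal entry of \<open>dg S\<close> is \<open>1\<close>, so only integral scalars give integral transition matrices.
  The conditions of the special fibre for these follow from the one for the scalar \<open>1\<close>.\<close>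

lemma integral_scaled_iff:
  assumes "k \<in> GLO" "l \<in> GLO" "S \<noteq> UNIV"
  shows "integral_matrix (mat c ** (matrix_inv k ** dg S ** l)) \<longleftrightarrow> c \<in> \<O>"
proof
  assume int: "integral_matrix (mat c ** (matrix_inv k ** dg S ** l))"
  have "k ** (mat c ** (matrix_inv k ** dg S ** l)) ** matrix_inv l
      = mat c ** ((k ** matrix_inv k) ** dg S ** (l ** matrix_inv l))"
    by (simp only: matrix_mul_assoc mat_commute[of k])
  then have "integral_matrix (mat c ** dg S)"
    using integral_mult[OF integral_mult[OF GLO_integral[OF assms(1)] int] GLO_integral[OF GLO_inv[OF assms(2)]]]
    by (simp add: GLO_inverse_mult assms)
  moreover obtain i where "i \<notin> S" using assms(3) by blast
  then have "(mat c ** dg S) $ i $ i = c" by (simp add: mat_mult_nth dg_def)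
  ultimately show "c \<in> \<O>" by (metis integral_nth)
qed (intro integral_mat_mult integral_mult GLO_integral GLO_inv assms integral_dg)

lemma red_scaled: "c \<in> \<O> \<Longrightarrow> integral_matrix A \<Longrightarrow> red (mat c ** A) = mat (\<rho> c) ** red A"
  by (simp add: red_mult integral_mat red_mat)

text \<open>The complementary idempotents \<open>dproj (- S)\<close> and \<open>dproj S\<close> project onto the basis vectors that
  \<open>dg S\<close> and \<open>dg (- S)\<close> keep; they provide the splittings required by \<open>edge_maps\<close>.\<close>

definition dproj :: "3 set \<Rightarrow> 'K ^ 3 ^ 3" where
  "dproj S = (\<chi> i j. if i = j then if i \<in> S then 1 else 0 else 0)"

lemma dproj_facts:
  "integral_matrix (dproj S)" "dg S ** dproj (- S) = dproj (- S)" "dproj S ** dg (- S) = dproj S"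
  "dproj (- S) + dproj S = mat 1"
proof -
  show "integral_matrix (dproj S)" by (auto simp: integral_matrix_def dproj_def)
  show "dg S ** dproj (- S) = dproj (- S)" "dproj S ** dg (- S) = dproj S"
    by (auto simp: vec_eq_iff dg_mult_nth) (auto simp: dproj_def)
  show "dproj (- S) + dproj S = mat 1" by (auto simp: vec_eq_iff dproj_def mat_def)
qed

lemma red_add: "integral_matrix A \<Longrightarrow> integral_matrix B \<Longrightarrow> red (A + B) = red A + red B"
  by (simp add: integral_matrix_def vec_eq_iff \<rho>_simps)

lemma small_conj_iff:
  assumes "k \<in> GLO" "l \<in> GLO"
  shows "small_matrix (matrix_inv k ** A ** l) \<longleftrightarrow> small_matrix A"
proof
  assume "small_matrix (matrix_inv k ** A ** l)"
  then have "small_matrix (k ** (matrix_inv k ** A ** l) ** matrix_inv l)"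
    using small_mult_right[OF small_mult_left[OF GLO_integral[OF assms(1)]] GLO_integral[OF GLO_inv[OF assms(2)]]]
    by blast
  also have "k ** (matrix_inv k ** A ** l) ** matrix_inv l = (k ** matrix_inv k) ** A ** (l ** matrix_inv l)"
    by (simp only: matrix_mul_assoc)
  finally show "small_matrix A" by (simp add: GLO_inverse_mult assms)
next
  assume "small_matrix A"
  from small_mult_right[OF small_mult_left[OF GLO_integral[OF GLO_inv[OF assms(1)]] this] GLO_integral[OF assms(2)]]
  show "small_matrix (matrix_inv k ** A ** l)" .
qed

lemma integral_conj_iff:
  assumes "k \<in> GLO" "l \<in> GLO"
  shows "integral_matrix (matrix_inv k ** A ** l) \<longleftrightarrow> integral_matrix A"
proof
  assume "integral_matrix (matrix_inv k ** A ** l)"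
  then have "integral_matrix (k ** (matrix_inv k ** A ** l) ** matrix_inv l)"
    using integral_mult[OF integral_mult[OF GLO_integral[OF assms(1)]] GLO_integral[OF GLO_inv[OF assms(2)]]]
    by blast
  also have "k ** (matrix_inv k ** A ** l) ** matrix_inv l = (k ** matrix_inv k) ** A ** (l ** matrix_inv l)"
    by (simp only: matrix_mul_assoc)
  finally show "integral_matrix A" by (simp add: GLO_inverse_mult assms)
next
  assume "integral_matrix A"
  from integral_mult[OF integral_mult[OF GLO_integral[OF GLO_inv[OF assms(1)]] this] GLO_integral[OF assms(2)]]
  show "integral_matrix (matrix_inv k ** A ** l)" .
qed

text \<open>An element of determinant \<open>1\<close> can fix a homothety class only by preserving each of its lattices: if it
  scales a lattice by \<open>c\<close>, comparing determinants gives \<open>3 * v c = 0\<close>.\<close>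

lemma fixes_vert_iff:
  assumes "det B \<noteq> 0" "det g = 1"
  shows "act g (vert B) = vert B \<longleftrightarrow> integral_matrix (matrix_inv B ** g ** B)"
proof
  have d: "det (g ** B) \<noteq> 0" using assms by (simp add: det_mul)
  have e: "g ** B = B ** (matrix_inv B ** g ** B)"
    using matrix_cancel[OF matrix_inv_right'[OF assms(1)]] by (simp flip: matrix_mul_assoc)
  have dd: "det (matrix_inv B ** g ** B) = 1" using assms by (simp add: det_mul det_matrix_inv)
  {
    assume "act g (vert B) = vert B"
    then obtain c k where c: "c \<noteq> 0" and k: "k \<in> GLO" and B: "g ** B = mat c ** B ** k"
      using vert_eq_iff[OF assms(1) d] by (metis act_vert)
    have e2: "matrix_inv B ** g ** B = mat c ** k"
    proof -
      have "matrix_inv B ** g ** B = matrix_inv B ** (g ** B)" by (simp only: matrix_mul_assoc)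
      also have "\<dots> = (matrix_inv B ** mat c) ** (B ** k)" by (simp only: B matrix_mul_assoc)
      also have "matrix_inv B ** mat c = mat c ** matrix_inv B" by (rule mat_commute)
      also have "mat c ** matrix_inv B ** (B ** k) = mat c ** k"
        using matrix_cancel[OF matrix_inv_left'[OF assms(1)]] by (simp flip: matrix_mul_assoc)
      finally show ?thesis .
    qed
    have vk: "v (det k) = 0" using k unit_inverse[of "det k"] by (auto simp: GLO_def)
    have "c ^ 3 * det k = 1" using dd unfolding e2 by (simp add: det_mul det_mat3)
    moreover have "v (c ^ 3 * det k) = 3 * v c"
      using c vk GLO_det_nz[OF k] by (simp add: power3_eq_cube v_mult)
    ultimately have "v c = 0" by simp
    then have "c \<in> \<O>" by (simp add: in_O_iff)
    then show "integral_matrix (matrix_inv B ** g ** B)"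
      unfolding e2 by (intro integral_mat_mult GLO_integral k)
  }
  assume "integral_matrix (matrix_inv B ** g ** B)"
  then have "matrix_inv B ** g ** B \<in> GLO" by (simp add: GLO_def dd)
  then have "vert (B ** (matrix_inv B ** g ** B)) = vert B" by (rule vert_GLO[OF assms(1)])
  then show "act g (vert B) = vert B" by (simp only: act_vert e)
qed

lemma mat_mult_cancel_left: "mat c ** P ** R = mat c ** (P ** R)" for P R :: "'K ^ 3 ^ 3"
  by (simp only: matrix_mul_assoc)

text \<open>In frames of the two vertices the special fibre is an \<open>edge_fibre\<close>, so its unipotent radical
  is known. The condition that the reduction of \<open>g\<close> fixes the images of \<open>P\<close> and \<open>Q\<close> then translates
  into \<open>Z ** dg S\<close> and \<open>dg (- S) ** Z\<close> being zero modulo \<open>\<pi>\<close>, where \<open>Z\<close> is \<open>g - 1\<close> in the basis \<open>A\<close>; this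
  is the edge condition.\<close>

lemma edge_lemma:
  assumes A: "det A \<noteq> 0" and S: "S \<noteq> {}" "S \<noteq> UNIV" and ne: "vert A \<noteq> vert (A ** dg S)"
  shows "g \<in> I\<^sub>F {vert A, vert (A ** dg S)} \<longleftrightarrow>
    det g = 1 \<and> edge_condition S (matrix_inv A ** g ** A - mat 1)"
proof -
  let ?x = "vert A" and ?y = "vert (A ** dg S)"
  have AS: "det (A ** dg S) \<noteq> 0" using A by (simp add: det_mul)
  obtain a k where a: "a \<noteq> 0" and k: "k \<in> GLO" and fx: "frame ?x = mat a ** A ** k" by (rule frameE[OF A])
  obtain b l where b: "b \<noteq> 0" and l: "l \<in> GLO" and fy: "frame ?y = mat b ** (A ** dg S) ** l" by (rule frameE[OF AS])
  note nz = GLO_det_nz[OF k] GLO_det_nz[OF l]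
  define P\<^sub>0 where "P\<^sub>0 = matrix_inv k ** dg S ** l"
  define Q\<^sub>0 where "Q\<^sub>0 = matrix_inv l ** dg (- S) ** k"
  have T_xy: "matrix_inv (frame ?x) ** mat c ** frame ?y = mat (c * b / a) ** P\<^sub>0" for c
    unfolding fx fy P\<^sub>0_def by (rule transition_down[OF A nz a b])
  have T_yx: "matrix_inv (frame ?y) ** mat c ** frame ?x = mat (c * a / (b * \<pi>)) ** Q\<^sub>0" for c
    unfolding fx fy Q\<^sub>0_def by (rule transition_up[OF A nz a b])
  have dfx: "det (frame ?x) \<noteq> 0" "det (frame ?y) \<noteq> 0"
    unfolding fx fy using A nz a b by (simp_all add: det_mul det_mat3)
  have T_zz: "matrix_inv (frame z) ** mat c ** frame z = mat c" if "z \<in> {?x, ?y}" for c z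
  proof -
    have "matrix_inv (frame z) ** mat c ** frame z = mat c ** (matrix_inv (frame z) ** frame z)"
      by (simp only: mat_commute[of "matrix_inv (frame z)"] matrix_mul_assoc)
    then show ?thesis using that dfx by (auto simp: matrix_inv_left')
  qed
  have P0: "integral_matrix P\<^sub>0" "integral_matrix (mat c ** P\<^sub>0) \<longleftrightarrow> c \<in> \<O>" for c
    unfolding P\<^sub>0_def using integral_scaled_iff[OF k l S(2)] integral_scaled_iff[OF k l S(2), of 1] by simp_all
  have S': "- S \<noteq> UNIV" using S by auto
  have Q0: "integral_matrix Q\<^sub>0" "integral_matrix (mat c ** Q\<^sub>0) \<longleftrightarrow> c \<in> \<O>" for c
    unfolding Q\<^sub>0_def using integral_scaled_iff[OF l k S'] integral_scaled_iff[OF l k S', of 1] by simp_all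
  let ?P = "red P\<^sub>0" and ?Q = "red Q\<^sub>0"
  have comm: "h1 ** (mat r ** P1) = mat r ** (h1 ** P1)" for h1 P1 :: "'p mod_ring alg_closure ^ 3 ^ 3" and r
    by (metis mat_commute matrix_mul_assoc)
  have fibre: "special_fibre {?x, ?y} = edge_fibre ?x ?y ?P ?Q"
  proof -
    have "(\<forall>p\<in>{?x, ?y}. \<forall>q\<in>{?x, ?y}. \<forall>c. let T = matrix_inv (frame p) ** mat c ** frame q in
          integral_matrix T \<longrightarrow> h p ** red T = red T ** h q) \<longleftrightarrow> h ?x ** ?P = ?P ** h ?y \<and> h ?y ** ?Q = ?Q ** h ?x"
      (is "?all \<longleftrightarrow> ?two") for h
    proof
      assume all: ?all
      \<comment> \<open>The scalars are chosen such that the transition matrices become \<open>P\<^sub>0\<close> and \<open>Q\<^sub>0\<close>.\<close>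
      have "integral_matrix (matrix_inv (frame ?x) ** mat (a / b) ** frame ?y) \<longrightarrow>
        h ?x ** red (matrix_inv (frame ?x) ** mat (a / b) ** frame ?y) = red (matrix_inv (frame ?x) ** mat (a / b) ** frame ?y) ** h ?y"
        using all unfolding Let_def by blast
      moreover have "integral_matrix (matrix_inv (frame ?y) ** mat (b * \<pi> / a) ** frame ?x) \<longrightarrow>
        h ?y ** red (matrix_inv (frame ?y) ** mat (b * \<pi> / a) ** frame ?x) = red (matrix_inv (frame ?y) ** mat (b * \<pi> / a) ** frame ?x) ** h ?x"
        using all unfolding Let_def by blast
      ultimately show ?two unfolding T_xy T_yx using a b P0(1) Q0(1) by simp
    next
      assume two: ?two
      have xy: "h ?x ** red (mat c ** P\<^sub>0) = red (mat c ** P\<^sub>0) ** h ?y" if "integral_matrix (mat c ** P\<^sub>0)" for c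
        using two that P0 by (simp add: red_scaled comm mat_mult_cancel_left)
           (simp flip: matrix_mul_assoc)
      have yx: "h ?y ** red (mat c ** Q\<^sub>0) = red (mat c ** Q\<^sub>0) ** h ?x" if "integral_matrix (mat c ** Q\<^sub>0)" for c
        using two that Q0 by (simp add: red_scaled comm mat_mult_cancel_left)
           (simp flip: matrix_mul_assoc)
      have zz: "h z ** red (mat c) = red (mat c) ** h z" for z c
        unfolding red_mat by (rule mat_commute)
      show ?all
        unfolding Let_def using T_zz[of ?x] T_zz[of ?y] by (auto simp: T_xy T_yx intro: xy yx zz)
    qed
    then show ?thesis unfolding special_fibre_def edge_fibre_def by simp
  qed
  have kl: "integral_matrix k" "integral_matrix l" "integral_matrix (matrix_inv k)" "integral_matrix (matrix_inv l)"
    using k l by (auto intro: GLO_integral GLO_inv)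
  have cancel: "k ** matrix_inv k = mat 1" "matrix_inv k ** k = mat 1" "l ** matrix_inv l = mat 1" "matrix_inv l ** l = mat 1"
    using k l by (simp_all add: GLO_inverse_mult)
  have PQ0: "P\<^sub>0 ** Q\<^sub>0 = mat \<pi>" "Q\<^sub>0 ** P\<^sub>0 = mat \<pi>"
  proof -
    have "P\<^sub>0 ** Q\<^sub>0 = matrix_inv k ** (dg S ** (l ** (matrix_inv l ** (dg (- S) ** k))))"
      by (simp add: P\<^sub>0_def Q\<^sub>0_def flip: matrix_mul_assoc)
    also have "\<dots> = matrix_inv k ** (dg S ** dg (- S)) ** k"
      by (simp only: matrix_cancel[OF cancel(3)]) (simp only: matrix_mul_assoc)
    also have "\<dots> = mat \<pi> ** (matrix_inv k ** k)"
      by (simp only: dg_compl mat_commute[of "matrix_inv k"] matrix_mul_assoc)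
    finally show "P\<^sub>0 ** Q\<^sub>0 = mat \<pi>" by (simp add: cancel)
    have "Q\<^sub>0 ** P\<^sub>0 = matrix_inv l ** (dg (- S) ** (k ** (matrix_inv k ** (dg S ** l))))"
      by (simp add: P\<^sub>0_def Q\<^sub>0_def flip: matrix_mul_assoc)
    also have "\<dots> = matrix_inv l ** (dg (- S) ** dg S) ** l"
      by (simp only: matrix_cancel[OF cancel(1)]) (simp only: matrix_mul_assoc)
    also have "\<dots> = mat \<pi> ** (matrix_inv l ** l)"
      by (simp only: dg_compl mat_commute[of "matrix_inv l"] matrix_mul_assoc)
    finally show "Q\<^sub>0 ** P\<^sub>0 = mat \<pi>" by (simp add: cancel)
  qed
  have red_pi: "red (mat \<pi>) = 0" using \<rho>_simps(6)[of \<pi>] by (simp add: red_mat)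
  \<comment> \<open>Integral splittings, whose reductions show that the sequence given by the reductions of \<open>P\<^sub>0\<close> and \<open>Q\<^sub>0\<close> is exact.\<close>
  define A\<^sub>1 where "A\<^sub>1 = matrix_inv l ** dproj (- S) ** k"
  define A\<^sub>2 where "A\<^sub>2 = matrix_inv k ** dproj S ** l"
  have int12: "integral_matrix A\<^sub>1" "integral_matrix A\<^sub>2"
    unfolding A\<^sub>1_def A\<^sub>2_def by (intro integral_mult kl dproj_facts)+
  have split_x: "P\<^sub>0 ** A\<^sub>1 + A\<^sub>2 ** Q\<^sub>0 = mat 1"
  proof -
    have "P\<^sub>0 ** A\<^sub>1 = matrix_inv k ** (dg S ** (l ** (matrix_inv l ** (dproj (- S) ** k))))"
      by (simp add: P\<^sub>0_def A\<^sub>1_def flip: matrix_mul_assoc)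
    also have "\<dots> = matrix_inv k ** dproj (- S) ** k"
      by (simp only: matrix_cancel[OF cancel(3)]) (simp only: matrix_mul_assoc dproj_facts flip: matrix_mul_assoc[of _ "dg S"])
    finally have 1: "P\<^sub>0 ** A\<^sub>1 = matrix_inv k ** dproj (- S) ** k" .
    have "A\<^sub>2 ** Q\<^sub>0 = matrix_inv k ** (dproj S ** (l ** (matrix_inv l ** (dg (- S) ** k))))"
      by (simp add: Q\<^sub>0_def A\<^sub>2_def flip: matrix_mul_assoc)
    also have "\<dots> = matrix_inv k ** (dproj S ** dg (- S)) ** k"
      by (simp only: matrix_cancel[OF cancel(3)]) (simp only: matrix_mul_assoc)
    finally have 2: "A\<^sub>2 ** Q\<^sub>0 = matrix_inv k ** dproj S ** k" by (simp only: dproj_facts)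
    have "matrix_inv k ** dproj (- S) ** k + matrix_inv k ** dproj S ** k = matrix_inv k ** (dproj (- S) + dproj S) ** k"
      by (simp only: matrix_add_ldistrib matrix_add_rdistrib')
    then show ?thesis by (simp add: 1 2 dproj_facts cancel)
  qed
  have split_y: "Q\<^sub>0 ** A\<^sub>2 + A\<^sub>1 ** P\<^sub>0 = mat 1"
  proof -
    have dp: "dg (- S) ** dproj S = dproj S" "dproj (- S) ** dg S = dproj (- S)"
      using dproj_facts(2,3)[of "- S"] by simp_all
    have "Q\<^sub>0 ** A\<^sub>2 = matrix_inv l ** (dg (- S) ** (k ** (matrix_inv k ** (dproj S ** l))))"
      by (simp add: Q\<^sub>0_def A\<^sub>2_def flip: matrix_mul_assoc)
    also have "\<dots> = matrix_inv l ** (dg (- S) ** dproj S) ** l"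
      by (simp only: matrix_cancel[OF cancel(1)]) (simp only: matrix_mul_assoc)
    finally have 1: "Q\<^sub>0 ** A\<^sub>2 = matrix_inv l ** dproj S ** l" by (simp only: dp)
    have "A\<^sub>1 ** P\<^sub>0 = matrix_inv l ** (dproj (- S) ** (k ** (matrix_inv k ** (dg S ** l))))"
      by (simp add: P\<^sub>0_def A\<^sub>1_def flip: matrix_mul_assoc)
    also have "\<dots> = matrix_inv l ** (dproj (- S) ** dg S) ** l"
      by (simp only: matrix_cancel[OF cancel(1)]) (simp only: matrix_mul_assoc)
    finally have 2: "A\<^sub>1 ** P\<^sub>0 = matrix_inv l ** dproj (- S) ** l" by (simp only: dp)
    have "matrix_inv l ** dproj S ** l + matrix_inv l ** dproj (- S) ** l = matrix_inv l ** (dproj (- S) + dproj S) ** l"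
      by (simp only: matrix_add_ldistrib matrix_add_rdistrib' add.commute)
    then show ?thesis by (simp add: 1 2 dproj_facts cancel)
  qed
  interpret e: edge_maps ?x ?y ?P ?Q "red A\<^sub>1" "red A\<^sub>2" "red A\<^sub>2" "red A\<^sub>1"
  proof
    show "?x \<noteq> ?y" by (rule ne)
    show "?P ** ?Q = 0" "?Q ** ?P = 0"
      using PQ0 red_pi by (simp_all add: P0 Q0 flip: red_mult)
    show "?P ** red A\<^sub>1 + red A\<^sub>2 ** ?Q = mat 1"
      using split_x by (simp add: P0 Q0 int12 flip: red_mult red_add)
    show "?Q ** red A\<^sub>2 + red A\<^sub>1 ** ?P = mat 1"
      using split_y by (simp add: P0 Q0 int12 flip: red_mult red_add)
  qed
  have rad: "unipotent_radical {?x, ?y} (special_fibre {?x, ?y}) = edge_radical ?x ?y ?P ?Q"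
    unfolding fibre by (rule e.unipotent_radical_edge[OF infinite_alg_closed_field])
  define Z where "Z = matrix_inv A ** g ** A - mat 1"
  define gx where "gx = matrix_inv (frame ?x) ** g ** frame ?x"
  define gy where "gy = matrix_inv (frame ?y) ** g ** frame ?y"
  have gx: "gx = matrix_inv k ** (matrix_inv A ** g ** A) ** k"
    unfolding gx_def fx by (rule frame_conj[OF A nz(1) nz(1) a a])
  have gy: "gy = matrix_inv l ** (matrix_inv (A ** dg S) ** g ** (A ** dg S)) ** l"
    unfolding gy_def fy by (rule frame_conj[OF AS nz(2) nz(2) b b])
  have gx1: "gx - mat 1 = matrix_inv k ** Z ** k"
    by (simp add: gx Z_def matrix_diff_ldistrib matrix_diff_rdistrib cancel)
  have "matrix_inv (A ** dg S) ** g ** (A ** dg S) = matrix_inv (dg S) ** (matrix_inv A ** g ** A) ** dg S"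
    using A by (simp add: matrix_inv_mult matrix_mul_assoc)
  then have gy1: "gy - mat 1 = matrix_inv l ** (matrix_inv (dg S) ** Z ** dg S) ** l"
    by (simp add: gy Z_def matrix_diff_ldistrib matrix_diff_rdistrib cancel matrix_inv_left')
  have gxP: "(gx - mat 1) ** P\<^sub>0 = matrix_inv k ** (Z ** dg S) ** l"
  proof -
    have "(gx - mat 1) ** P\<^sub>0 = matrix_inv k ** (Z ** (k ** (matrix_inv k ** (dg S ** l))))"
      by (simp add: gx1 P\<^sub>0_def flip: matrix_mul_assoc)
    also have "\<dots> = matrix_inv k ** (Z ** (dg S ** l))" by (simp only: matrix_cancel[OF cancel(1)])
    finally show ?thesis by (simp only: matrix_mul_assoc)
  qed
  have gyQ: "(gy - mat 1) ** Q\<^sub>0 = matrix_inv l ** (dg (- S) ** Z) ** k"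
  proof -
    have "(gy - mat 1) ** Q\<^sub>0 = matrix_inv l ** (matrix_inv (dg S) ** (Z ** (dg S ** (l ** (matrix_inv l ** (dg (- S) ** k))))))"
      by (simp add: gy1 Q\<^sub>0_def flip: matrix_mul_assoc)
    also have "\<dots> = matrix_inv l ** matrix_inv (dg S) ** (Z ** (dg S ** dg (- S))) ** k"
      by (simp only: matrix_cancel[OF cancel(3)]) (simp only: matrix_mul_assoc)
    also have "\<dots> = matrix_inv l ** (matrix_inv (dg S) ** mat \<pi>) ** Z ** k"
      by (simp only: dg_compl mat_commute[of Z] matrix_mul_assoc)
    also have "matrix_inv (dg S) ** mat \<pi> = dg (- S)"
      by (simp add: matrix_inv_dg matrix_mul_assoc mat_mult_mat mat_commute[of _ \<pi>])
    finally show ?thesis by (simp only: matrix_mul_assoc)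
  qed
  have redx: "red gx ** ?P = ?P \<longleftrightarrow> small_matrix (Z ** dg S)" if "integral_matrix gx"
  proof -
    have "red gx ** ?P = ?P \<longleftrightarrow> red (gx ** P\<^sub>0 - P\<^sub>0) = 0" using that P0 by (simp add: red_mult red_diff)
    also have "gx ** P\<^sub>0 - P\<^sub>0 = (gx - mat 1) ** P\<^sub>0" by (simp add: matrix_diff_rdistrib)
    also have "red \<dots> = 0 \<longleftrightarrow> small_matrix ((gx - mat 1) ** P\<^sub>0)"
      using that P0 by (intro red_eq_0_iff) simp
    finally show ?thesis unfolding gxP by (simp add: small_conj_iff k l)
  qed
  have redy: "red gy ** ?Q = ?Q \<longleftrightarrow> small_matrix (dg (- S) ** Z)" if "integral_matrix gy"
  proof -
    have "red gy ** ?Q = ?Q \<longleftrightarrow> red (gy ** Q\<^sub>0 - Q\<^sub>0) = 0" using that Q0 by (simp add: red_mult red_diff)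
    also have "gy ** Q\<^sub>0 - Q\<^sub>0 = (gy - mat 1) ** Q\<^sub>0" by (simp add: matrix_diff_rdistrib)
    also have "red \<dots> = 0 \<longleftrightarrow> small_matrix ((gy - mat 1) ** Q\<^sub>0)"
      using that Q0 by (intro red_eq_0_iff) simp
    finally show ?thesis unfolding gyQ by (simp add: small_conj_iff k l)
  qed
  have cond: "edge_condition S Z \<longleftrightarrow> small_matrix (Z ** dg S) \<and> small_matrix (dg (- S) ** Z)
     \<and> integral_matrix Z"
    unfolding edge_condition_def small_matrix_def integral_matrix_def dg_mult_nth
    by (auto simp: m_imp_O split: if_splits)
  have xJ: "act g ?x = ?x \<longleftrightarrow> integral_matrix gx" "act g ?y = ?y \<longleftrightarrow> integral_matrix gy" if "det g = 1"
    using fixes_vert_iff[OF A that] fixes_vert_iff[OF AS that] by (simp_all add: gx gy integral_conj_iff k l)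
  have intx: "integral_matrix gx \<longleftrightarrow> integral_matrix Z"
  proof -
    have "integral_matrix gx \<longleftrightarrow> integral_matrix (matrix_inv A ** g ** A)" unfolding gx by (rule integral_conj_iff[OF k k])
    also have "\<dots> \<longleftrightarrow> integral_matrix Z" by (simp add: Z_def integral_diff_mat_1)
    finally show ?thesis .
  qed
  have inty: "integral_matrix gy" if c: "edge_condition S Z"
  proof -
    have "integral_matrix (matrix_inv (dg S) ** Z ** dg S)"
      unfolding integral_matrix_def conj_dg_nth using c by (auto simp: edge_condition_def m_iff_pi)
    then have "integral_matrix (gy - mat 1)" unfolding gy1 by (simp add: integral_conj_iff l)
    then show ?thesis by (simp only: integral_diff_mat_1)
  qed
  \<comment> \<open>Multiplication by \<open>g\<close> commutes with the scalar that defines the transition matrix.\<close>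
  have inter: "gx ** P\<^sub>0 = P\<^sub>0 ** gy" "gy ** Q\<^sub>0 = Q\<^sub>0 ** gx"
  proof -
    let ?X = "frame ?x" and ?Y = "frame ?y"
    have 1: "P\<^sub>0 = matrix_inv ?X ** mat (a / b) ** ?Y" using T_xy[of "a / b"] a b by simp
    have 2: "Q\<^sub>0 = matrix_inv ?Y ** mat (b * \<pi> / a) ** ?X" using T_yx[of "b * \<pi> / a"] a b by simp
    have gen: "(matrix_inv W ** g ** W) ** (matrix_inv W ** mat r ** V) = (matrix_inv W ** mat r ** V) ** (matrix_inv V ** g ** V)"
      if "det V \<noteq> 0" "det W \<noteq> 0" for V W :: "'K ^ 3 ^ 3" and r
    proof -
      have "(matrix_inv W ** g ** W) ** (matrix_inv W ** mat r ** V) = matrix_inv W ** (g ** (W ** (matrix_inv W ** (mat r ** V))))"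
        by (simp only: matrix_mul_assoc)
      also have "\<dots> = matrix_inv W ** (g ** mat r) ** V"
        by (simp only: matrix_cancel[OF matrix_inv_right'[OF that(2)]]) (simp only: matrix_mul_assoc)
      also have "g ** mat r = mat r ** g" by (rule mat_commute)
      also have "matrix_inv W ** (mat r ** g) ** V = matrix_inv W ** (mat r ** (V ** (matrix_inv V ** (g ** V))))"
        by (simp only: matrix_cancel[OF matrix_inv_right'[OF that(1)]]) (simp only: matrix_mul_assoc)
      finally show ?thesis by (simp only: matrix_mul_assoc)
    qed
    show "gx ** P\<^sub>0 = P\<^sub>0 ** gy" unfolding gx_def gy_def 1 by (rule gen[OF dfx(2,1)])
    show "gy ** Q\<^sub>0 = Q\<^sub>0 ** gx" unfolding gx_def gy_def 2 by (rule gen[OF dfx])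
  qed
  have redn: "reduction {?x, ?y} g ?x = red gx" "reduction {?x, ?y} g ?y = red gy"
    "reduction {?x, ?y} g \<in> extensional {?x, ?y}"
    by (simp_all add: reduction_def gx_def gy_def)
  have dets: "det gx = det g" "det gy = det g"
    using dfx by (simp_all add: gx_def gy_def det_mul det_matrix_inv)
  show ?thesis
  proof
    assume "g \<in> I\<^sub>F {?x, ?y}"
    then have g: "det g = 1" "act g ?x = ?x" "act g ?y = ?y" and r: "reduction {?x, ?y} g \<in> edge_radical ?x ?y ?P ?Q"
      by (simp_all add: I\<^sub>F_def J_def rad)
    have ii: "integral_matrix gx" "integral_matrix gy" using g xJ by auto
    have "red gx ** ?P = ?P" "red gy ** ?Q = ?Q" using r by (simp_all add: edge_radical_def redn)
    then show "det g = 1 \<and> edge_condition S (matrix_inv A ** g ** A - mat 1)"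
      using g(1) cond redx redy ii intx by (simp flip: Z_def)
  next
    assume "det g = 1 \<and> edge_condition S (matrix_inv A ** g ** A - mat 1)"
    then have g: "det g = 1" and c: "edge_condition S Z" by (simp_all flip: Z_def)
    have ii: "integral_matrix gx" "integral_matrix gy" using cond c intx inty by auto
    have "red gx ** ?P = ?P ** red gy" "red gy ** ?Q = ?Q ** red gx"
      using ii inter by (simp_all add: P0 Q0 flip: red_mult)
    moreover have "red gx ** ?P = ?P" "red gy ** ?Q = ?Q" using redx redy ii c cond by auto
    moreover have "det (red gx) = 1" "det (red gy) = 1"
      using ii g by (simp_all add: det_red dets \<rho>_simps)
    ultimately have "reduction {?x, ?y} g \<in> edge_radical ?x ?y ?P ?Q"
      by (simp add: edge_radical_def carrier_edge_fibre redn)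
    then show "g \<in> I\<^sub>F {?x, ?y}" using g xJ ii by (simp add: I\<^sub>F_def J_def rad)
  qed
qed

end

section \<open>Subgroups attached to the facets at the central vertex\<close>

context totally_ramified_extension
begin

lemma three_distinct [simp]: "(1::3) \<noteq> 2" "(1::3) \<noteq> 3" "(2::3) \<noteq> 3" "(2::3) \<noteq> 1" "(3::3) \<noteq> 1" "(3::3) \<noteq> 2"
  by simp_all

text \<open>The kernel of the reduction map on \<open>SL\<^sub>3(\<O>)\<close>.\<close>

definition \<Gamma> :: "('K ^ 3 ^ 3) set" where
  "\<Gamma> = {g. det g = 1 \<and> small_matrix (g - mat 1)}"

lemma I_iff: "g \<in> I \<longleftrightarrow> det g = 1 \<and> integral_matrix g \<and> (\<forall>i. g $ i $ i - 1 \<in> \<mm>)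
     \<and> g $ 2 $ 1 \<in> \<mm> \<and> g $ 3 $ 1 \<in> \<mm> \<and> g $ 3 $ 2 \<in> \<mm>"
  by (simp add: I_def)

lemma I_mult: "g \<in> I \<Longrightarrow> h \<in> I \<Longrightarrow> g ** h \<in> I"
proof -
  assume g: "g \<in> I" and h: "h \<in> I"
  have gO: "g $ i $ j \<in> \<O>" "h $ i $ j \<in> \<O>" for i j using g h by (auto simp: I_iff integral_nth)
  have low: "g $ 2 $ 1 \<in> \<mm>" "g $ 3 $ 1 \<in> \<mm>" "g $ 3 $ 2 \<in> \<mm>" "h $ 2 $ 1 \<in> \<mm>" "h $ 3 $ 1 \<in> \<mm>" "h $ 3 $ 2 \<in> \<mm>"
    using g h by (auto simp: I_iff)
  have d: "g $ i $ i * h $ i $ i - 1 \<in> \<mm>" for i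
  proof -
    have e: "g $ i $ i * h $ i $ i - 1 = g $ i $ i * (h $ i $ i - 1) + (g $ i $ i - 1)" by (simp add: algebra_simps)
    show ?thesis unfolding e by (intro m_add m_mult_left gO) (use g h in \<open>auto simp: I_iff\<close>)
  qed
  have off: "g $ i $ j * h $ j $ i \<in> \<mm>" if "i \<noteq> j" for i j
    using exhaust_3[of i] exhaust_3[of j] low gO that by (auto intro: m_mult_left m_mult_right)
  have e: "(g ** h) $ 1 $ 1 - 1 = (g $ 1 $ 1 * h $ 1 $ 1 - 1) + g $ 1 $ 2 * h $ 2 $ 1 + g $ 1 $ 3 * h $ 3 $ 1"
    "(g ** h) $ 2 $ 2 - 1 = (g $ 2 $ 2 * h $ 2 $ 2 - 1) + g $ 2 $ 1 * h $ 1 $ 2 + g $ 2 $ 3 * h $ 3 $ 2"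
    "(g ** h) $ 3 $ 3 - 1 = (g $ 3 $ 3 * h $ 3 $ 3 - 1) + g $ 3 $ 1 * h $ 1 $ 3 + g $ 3 $ 2 * h $ 2 $ 3"
    by (simp_all add: matrix_matrix_mult_def sum_3)
  have "\<forall>i. (g ** h) $ i $ i - 1 \<in> \<mm>"
    unfolding forall_3 e by (intro conjI m_add d off three_distinct)
  moreover have "(g ** h) $ 2 $ 1 \<in> \<mm>" "(g ** h) $ 3 $ 1 \<in> \<mm>" "(g ** h) $ 3 $ 2 \<in> \<mm>"
    using low gO by (auto simp: matrix_matrix_mult_def sum_3 intro!: m_add intro: m_mult_left m_mult_right)
  ultimately show "g ** h \<in> I" using g h by (simp add: I_iff det_mul)
qed

lemma I_inv: "g \<in> I \<Longrightarrow> matrix_inv g \<in> I"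
proof -
  assume g: "g \<in> I"
  have gO: "g $ i $ j \<in> \<O>" for i j using g by (auto simp: I_iff integral_nth)
  have low: "g $ 2 $ 1 \<in> \<mm>" "g $ 3 $ 1 \<in> \<mm>" "g $ 3 $ 2 \<in> \<mm>" and det: "det g = 1"
    using g by (auto simp: I_iff)
  have e: "matrix_inv g = adj3 g" using matrix_inv_adj3[of g] det by (simp add: vec_eq_iff)
  have "det (adj3 g) = 1" unfolding e[symmetric] using det by (simp add: det_matrix_inv)
  moreover have diag: "x * y - z - 1 \<in> \<mm>" if "x - 1 \<in> \<mm>" "y - 1 \<in> \<mm>" "z \<in> \<mm>" "y \<in> \<O>" for x y z
  proof -
    have e: "x * y - z - 1 = (x - 1) * y + (y - 1) - z" by (simp add: algebra_simps)
    show ?thesis unfolding e by (intro m_diff m_add m_mult_right that)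
  qed
  have "adj3 g $ 1 $ 1 - 1 \<in> \<mm>" "adj3 g $ 2 $ 2 - 1 \<in> \<mm>" "adj3 g $ 3 $ 3 - 1 \<in> \<mm>"
    using g low gO by (auto simp: adj3_def I_iff intro!: diag intro: m_mult_left m_mult_right)
  then have "\<forall>i. adj3 g $ i $ i - 1 \<in> \<mm>" unfolding forall_3 by simp
  moreover have "adj3 g $ 2 $ 1 \<in> \<mm>" "adj3 g $ 3 $ 1 \<in> \<mm>" "adj3 g $ 3 $ 2 \<in> \<mm>"
    using low gO by (auto simp: adj3_def intro!: m_diff intro: m_mult_left m_mult_right)
  moreover have "integral_matrix (adj3 g)"
    using gO by (simp add: integral_matrix_def forall_3 adj3_def)
  ultimately show "matrix_inv g \<in> I" unfolding e by (simp add: I_iff)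
qed

lemma conj_mult_dg:
  "det A \<noteq> 0 \<Longrightarrow> matrix_inv (A ** dg S) ** g ** (A ** dg S) = matrix_inv (dg S) ** (matrix_inv A ** g ** A) ** dg S"
  by (simp add: matrix_inv_mult matrix_mul_assoc)

lemma v\<^sub>0_eq: "k \<in> GLO \<Longrightarrow> v\<^sub>0 = vert k"
proof -
  assume k: "k \<in> GLO"
  have "{vector [a, b, c] | a b c. a \<in> \<O> \<and> b \<in> \<O> \<and> c \<in> \<O>} = lattice_of (mat 1)"
  proof -
    have "u = vector [u $ 1, u $ 2, u $ 3]" for u :: "'K ^ 3" by (simp add: vec_eq_iff forall_3)
    then show ?thesis by (auto simp: lattice_of_def forall_3)
  qed
  then have "v\<^sub>0 = vert (mat 1)" by (simp add: v\<^sub>0_def vert_def)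
  also have "\<dots> = vert (mat 1 ** k)" using k by (intro vert_GLO[symmetric]) simp_all
  finally show ?thesis by simp
qed

lemma dg_union: "S \<inter> T = {} \<Longrightarrow> dg S ** dg T = dg (S \<union> T)"
  by (auto simp: vec_eq_iff dg_mult_nth) (auto simp: dg_def)

text \<open>The neighbours of \<open>v\<^sub>0\<close> are the lattices strictly between \<open>\<O>\<^sup>3\<close> and \<open>\<pi> \<O>\<^sup>3\<close>, that is, the proper
  subspaces of the reduction of \<open>\<O>\<^sup>3\<close>. In the projective plane over the residue field, \<open>point_of k\<close> is the point spanned
  by the first column of \<open>k\<close>, and \<open>line_of k\<close> is the line spanned by the first two.\<close>

abbreviation "line_of k \<equiv> vert (k ** dg {3})"
abbreviation "point_of k \<equiv> vert (k ** dg {2, 3})"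

lemma proper_subsets: "{2} \<noteq> (UNIV :: 3 set)" "{3} \<noteq> (UNIV :: 3 set)" "{2, 3} \<noteq> (UNIV :: 3 set)"
  using three_distinct by blast+

lemma v_det_GLO: "k \<in> GLO \<Longrightarrow> v (det k) = 0"
  using unit_inverse[of "det k"] by (auto simp: GLO_def)

lemma v_det_line_point:
  assumes "k \<in> GLO"
  shows "v (det (k ** dg {3})) = 1" "v (det (k ** dg {2, 3})) = 2" "v (det k) = 0"
    "det (k ** dg S) \<noteq> 0"
  using assms GLO_det_nz[OF assms] by (simp_all add: det_mul v_mult v_det_GLO v_det_dg)

lemma vertex_types:
  assumes k: "k \<in> GLO" and l: "l \<in> GLO"
  shows "line_of k \<noteq> point_of l" "v\<^sub>0 \<noteq> line_of k" "v\<^sub>0 \<noteq> point_of k"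
  using vert_eq_type[of "k ** dg {3}" "l ** dg {2, 3}"] vert_eq_type[of k "k ** dg {3}"]
    vert_eq_type[of k "k ** dg {2, 3}"] v_det_line_point[OF k] v_det_line_point[OF l] GLO_det_nz[OF k]
  by (auto simp: v\<^sub>0_eq[OF k])

lemma edge_v\<^sub>0_line:
  assumes k: "k \<in> GLO"
  shows "g \<in> I\<^sub>F {v\<^sub>0, line_of k} \<longleftrightarrow> det g = 1 \<and> edge_condition {3} (matrix_inv k ** g ** k - mat 1)"
  unfolding v\<^sub>0_eq[OF k]
  by (rule edge_lemma) (use vertex_types(2)[OF k k] GLO_det_nz[OF k] proper_subsets in \<open>simp_all add: v\<^sub>0_eq[OF k]\<close>)

lemma edge_v\<^sub>0_point:
  assumes k: "k \<in> GLO"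
  shows "g \<in> I\<^sub>F {v\<^sub>0, point_of k} \<longleftrightarrow> det g = 1 \<and> edge_condition {2, 3} (matrix_inv k ** g ** k - mat 1)"
  unfolding v\<^sub>0_eq[OF k]
  by (rule edge_lemma) (use vertex_types(3)[OF k k] GLO_det_nz[OF k] proper_subsets in \<open>simp_all add: v\<^sub>0_eq[OF k]\<close>)

text \<open>This is the edge condition for the frame \<open>k ** dg {3}\<close> and \<open>S = {2}\<close>. Passing from \<open>k\<close> to this frame
  divides the third row by \<open>\<pi>\<close> and multiplies the third column by \<open>\<pi>\<close>, which turns one of the congruences into one modulo \<open>\<pi>\<^sup>2\<close>.\<close>

lemma edge_line_point:
  assumes k: "k \<in> GLO" and g: "matrix_inv k ** g ** k \<in> I" and small: "(matrix_inv k ** g ** k) $ 3 $ 1 / \<pi> \<in> \<mm>"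
  shows "g \<in> I\<^sub>F {line_of k, point_of k}"
proof -
  have e: "k ** dg {2, 3} = k ** dg {3} ** dg {2}"
    using dg_union[of "{3}" "{2}"] by (simp add: insert_commute flip: matrix_mul_assoc)
  define W where "W = matrix_inv k ** g ** k"
  have dk: "det k \<noteq> 0" using k by (rule GLO_det_nz)
  have dg1: "det g = 1" using g dk by (simp add: I_iff det_mul det_matrix_inv field_simps)
  have c: "matrix_inv (k ** dg {3}) ** g ** (k ** dg {3}) - mat 1 = matrix_inv (dg {3}) ** (W - mat 1) ** dg {3}"
    using dk by (simp add: conj_mult_dg W_def matrix_diff_ldistrib matrix_diff_rdistrib matrix_inv_left')
  have W: "integral_matrix W" "\<And>i. W $ i $ i - 1 \<in> \<mm>" "W $ 2 $ 1 \<in> \<mm>" "W $ 3 $ 1 \<in> \<mm>" "W $ 3 $ 2 \<in> \<mm>"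
    using g by (auto simp: I_iff W_def)
  have WO: "W $ i $ j \<in> \<O>" for i j using W(1) by (rule integral_nth)
  have "edge_condition {2} (matrix_inv (dg {3}) ** (W - mat 1) ** dg {3})"
    unfolding edge_condition_def conj_dg_nth forall_3
    using W WO small
    by (simp add: mat_def m_imp_O m_iff_pi flip: W_def) (metis W(2) m_iff_pi m_imp_O)?
  moreover have "line_of k \<noteq> vert (k ** dg {3} ** dg {2})" using vertex_types(1)[OF k k] by (simp add: e)
  ultimately show ?thesis
    using edge_lemma[of "k ** dg {3}" "{2}" g] dg1 proper_subsets v_det_line_point(4)[OF k]
    by (simp add: e c)
qed

lemma edge_v\<^sub>0_imp_I:
  assumes k: "k \<in> GLO" and "g \<in> I\<^sub>F {v\<^sub>0, line_of k} \<or> g \<in> I\<^sub>F {v\<^sub>0, point_of k}"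
  shows "matrix_inv k ** g ** k \<in> I"
proof -
  define W where "W = matrix_inv k ** g ** k"
  have "det g = 1" "edge_condition {3} (W - mat 1) \<or> edge_condition {2, 3} (W - mat 1)"
    using assms by (auto simp: edge_v\<^sub>0_line edge_v\<^sub>0_point W_def)
  moreover have "det W = det g" using GLO_det_nz[OF k] by (simp add: W_def det_mul det_matrix_inv)
  ultimately have d: "det W = 1" and c: "edge_condition {3} (W - mat 1) \<or> edge_condition {2, 3} (W - mat 1)" by auto
  have "integral_matrix (W - mat 1)" using c by (auto simp: edge_condition_def integral_matrix_def)
  then have "integral_matrix W" by (simp only: integral_diff_mat_1)
  then show "matrix_inv k ** g ** k \<in> I"
    using c d unfolding W_def[symmetric] I_iff edge_condition_def forall_3 by (auto simp: mat_def)
qed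

lemma \<Gamma>_conj: "k \<in> GLO \<Longrightarrow> g \<in> \<Gamma> \<Longrightarrow> matrix_inv k ** g ** k \<in> \<Gamma>"
proof -
  assume k: "k \<in> GLO" and g: "g \<in> \<Gamma>"
  have "matrix_inv k ** g ** k - mat 1 = matrix_inv k ** (g - mat 1) ** k"
    using k by (simp add: matrix_diff_ldistrib matrix_diff_rdistrib GLO_inverse_mult)
  then show ?thesis
    using k g GLO_det_nz[OF k] by (simp add: \<Gamma>_def small_conj_iff det_mul det_matrix_inv)
qed

lemma \<Gamma>_edge_v\<^sub>0:
  assumes "k \<in> GLO" "g \<in> \<Gamma>"
  shows "g \<in> I\<^sub>F {v\<^sub>0, line_of k}" "g \<in> I\<^sub>F {v\<^sub>0, point_of k}"
  using \<Gamma>_conj[OF assms] assms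
  by (auto simp: edge_v\<^sub>0_line edge_v\<^sub>0_point \<Gamma>_def edge_condition_def small_matrix_def intro: m_imp_O)

lemma \<Gamma>_subset_I: "g \<in> \<Gamma> \<Longrightarrow> g \<in> I"
proof -
  assume g: "g \<in> \<Gamma>"
  have "matrix_inv (mat 1) ** g ** mat 1 \<in> I"
    by (rule edge_v\<^sub>0_imp_I[OF GLO_1]) (use \<Gamma>_edge_v\<^sub>0[OF GLO_1 g] in blast)
  moreover have "matrix_inv (mat 1) = (mat 1 :: 'K ^ 3 ^ 3)" by (rule matrix_inv_unique) simp
  ultimately show ?thesis by simp
qed

lemma triangular_power:
  fixes N :: "'a::field ^ 3 ^ 3"
  assumes "N $ 2 $ 1 = 0" "N $ 3 $ 1 = 0" "N $ 3 $ 2 = 0"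
  shows "(((**) N) ^^ n) (mat 1) $ 2 $ 1 = 0 \<and> (((**) N) ^^ n) (mat 1) $ 3 $ 1 = 0 \<and> (((**) N) ^^ n) (mat 1) $ 3 $ 2 = 0
    \<and> (\<forall>i. (((**) N) ^^ n) (mat 1) $ i $ i = (N $ i $ i) ^ n)"
proof (induction n)
  case (Suc n)
  define P where "P = (((**) N) ^^ n) (mat 1)"
  have e: "(((**) N) ^^ Suc n) (mat 1) = N ** P" by (simp add: P_def)
  have "P $ 2 $ 1 = 0 \<and> P $ 3 $ 1 = 0 \<and> P $ 3 $ 2 = 0 \<and> (\<forall>i. P $ i $ i = (N $ i $ i) ^ n)"
    using Suc unfolding P_def .
  then have "(N ** P) $ 2 $ 1 = 0 \<and> (N ** P) $ 3 $ 1 = 0 \<and> (N ** P) $ 3 $ 2 = 0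
      \<and> (\<forall>i. (N ** P) $ i $ i = (N $ i $ i) ^ Suc n)"
    using assms unfolding forall_3 by (simp add: matrix_matrix_mult_def sum_3)
  then show ?case unfolding e .
qed (auto simp: mat_def)

lemma nilpotent_conj:
  fixes N u u' :: "'a::field ^ 3 ^ 3"
  assumes "u ** u' = mat 1"
  shows "(((**) (u' ** N ** u)) ^^ n) (mat 1) = u' ** (((**) N) ^^ n) (mat 1) ** u"
proof (induction n)
  case 0
  have "u' ** u = mat 1" using assms matrix_left_right_inverse by blast
  then show ?case by simp
next
  case (Suc n)
  have "u' ** N ** u ** (u' ** (((**) N) ^^ n) (mat 1) ** u) = u' ** (N ** (u ** (u' ** ((((**) N) ^^ n) (mat 1) ** u))))"
    by (simp only: matrix_mul_assoc)
  also have "\<dots> = u' ** (N ** ((((**) N) ^^ n) (mat 1) ** u))" by (simp only: matrix_cancel[OF assms])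
  finally show ?case using Suc by (simp add: matrix_mul_assoc)
qed

text \<open>An element that fixes the three vertices is upper triangular modulo \<open>\<pi>\<close> in the basis \<open>k\<close>. Its
  reduction at \<open>v\<^sub>0\<close> is conjugate to this triangular matrix and unipotent, so the
  diagonal entries reduce to \<open>1\<close>.\<close>

lemma chamber_imp_I:
  assumes k: "k \<in> GLO" and g: "g \<in> I\<^sub>F {v\<^sub>0, line_of k, point_of k}"
  shows "matrix_inv k ** g ** k \<in> I"
proof -
  define W where "W = matrix_inv k ** g ** k"
  have dk: "det k \<noteq> 0" using k by (rule GLO_det_nz)
  have g1: "det g = 1" and fixes_v: "act g v\<^sub>0 = v\<^sub>0" "act g (line_of k) = line_of k" "act g (point_of k) = point_of k"
    and r: "reduction {v\<^sub>0, line_of k, point_of k} g \<in> unipotent_radical {v\<^sub>0, line_of k, point_of k} (special_fibre {v\<^sub>0, line_of k, point_of k})"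
    using g by (auto simp: I\<^sub>F_def J_def)
  have W: "integral_matrix W"
    using fixes_vert_iff[OF dk g1] fixes_v(1) by (simp add: W_def v\<^sub>0_eq[OF k])
  have "integral_matrix (matrix_inv (dg {3}) ** W ** dg {3})" "integral_matrix (matrix_inv (dg {2, 3}) ** W ** dg {2, 3})"
    using fixes_vert_iff[OF v_det_line_point(4)[OF k] g1] fixes_v(2,3)
    by (simp_all add: W_def conj_mult_dg[OF dk])
  from integral_nth[OF this(1), of 3 1] integral_nth[OF this(1), of 3 2] integral_nth[OF this(2), of 2 1]
  have low: "W $ 3 $ 1 \<in> \<mm>" "W $ 3 $ 2 \<in> \<mm>" "W $ 2 $ 1 \<in> \<mm>"
    by (simp_all add: conj_dg_nth m_iff_pi)
  obtain a l where a: "a \<noteq> 0" and l: "l \<in> GLO" and fr: "frame v\<^sub>0 = mat a ** mat 1 ** l"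
    using frameE[of "mat 1"] by (auto simp: v\<^sub>0_eq[OF GLO_1])
  define gx where "gx = matrix_inv l ** g ** l"
  have "matrix_inv (frame v\<^sub>0) ** g ** frame v\<^sub>0 = matrix_inv l ** (matrix_inv (mat 1) ** g ** mat 1) ** l"
    unfolding fr by (rule frame_conj) (use a l GLO_det_nz in auto)
  moreover have "matrix_inv (mat 1) = (mat 1 :: 'K ^ 3 ^ 3)" by (rule matrix_inv_unique) simp
  ultimately have "reduction {v\<^sub>0, line_of k, point_of k} g v\<^sub>0 = red gx" by (simp add: reduction_def gx_def)
  moreover have "unipotent_matrix (reduction {v\<^sub>0, line_of k, point_of k} g v\<^sub>0)"
    using r by (auto simp: unipotent_radical_def)
  ultimately obtain n where n: "(((**) (red gx - mat 1)) ^^ n) (mat 1) = 0" by (auto simp: unipotent_matrix_def)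
  \<comment> \<open>The change of basis between \<open>k\<close> and the frame chosen for \<open>v\<^sub>0\<close>.\<close>
  define u where "u = matrix_inv l ** k"
  define u' where "u' = matrix_inv k ** l"
  have ui: "integral_matrix u" "integral_matrix u'"
    unfolding u_def u'_def by (intro integral_mult GLO_integral GLO_inv k l)+
  have uu: "u ** u' = mat 1"
  proof -
    have "u ** u' = matrix_inv l ** (k ** (matrix_inv k ** l))" by (simp only: u_def u'_def matrix_mul_assoc)
    then show ?thesis by (simp only: matrix_cancel[OF GLO_inverse_mult(1)[OF k]] GLO_inverse_mult(2)[OF l])
  qed
  have Wu: "W - mat 1 = u' ** (gx - mat 1) ** u"
  proof -
    have "u' ** gx ** u = matrix_inv k ** (l ** (matrix_inv l ** (g ** (l ** (matrix_inv l ** k)))))"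
      by (simp only: u_def u'_def gx_def matrix_mul_assoc)
    also have "\<dots> = W" by (simp only: matrix_cancel[OF GLO_inverse_mult(1)[OF l]]) (simp only: W_def matrix_mul_assoc)
    finally show ?thesis
      using uu matrix_left_right_inverse[of u u'] by (simp add: matrix_diff_ldistrib matrix_diff_rdistrib)
  qed
  have gxi: "integral_matrix gx"
    using fixes_vert_iff[OF GLO_det_nz[OF l] g1] fixes_v(1) by (simp add: gx_def v\<^sub>0_eq[OF l])
  define N where "N = red W - mat 1"
  have "N = red (u' ** (gx - mat 1) ** u)" using W by (simp add: N_def red_diff flip: Wu)
  also have "\<dots> = red u' ** (red gx - mat 1) ** red u" using ui gxi by (simp add: red_mult red_diff)
  finally have N: "N = red u' ** (red gx - mat 1) ** red u" .
  have "red u ** red u' = mat 1" using uu ui by (simp flip: red_mult)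
  then have N0: "(((**) N) ^^ n) (mat 1) = 0" by (simp only: N nilpotent_conj n matrix_mul_zero)
  have "N $ 2 $ 1 = 0" "N $ 3 $ 1 = 0" "N $ 3 $ 2 = 0"
    using low W by (simp_all add: N_def mat_def \<rho>_simps integral_nth)
  from triangular_power[OF this, of n] have "(N $ i $ i) ^ n = 0" for i unfolding N0 by simp
  then have "N $ i $ i = 0" for i by simp
  then have "\<rho> (W $ i $ i) - \<rho> 1 = 0" for i by (simp add: N_def mat_def \<rho>_simps)
  then have "W $ i $ i - 1 \<in> \<mm>" for i
    using W \<rho>_simps(5)[of "W $ i $ i" 1] \<rho>_simps(6)[of "W $ i $ i - 1"] by (simp add: integral_nth)
  moreover have "det W = 1" using g1 dk by (simp add: W_def det_mul det_matrix_inv)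
  ultimately show ?thesis using W low by (simp add: I_iff flip: W_def)
qed

text \<open>In the basis \<open>k\<close> the only condition for \<open>{line_of k, point_of k}\<close> beyond those of \<open>I\<close> is the
  congruence modulo \<open>\<pi>\<^sup>2\<close> for the lower left entry. It is achieved by a row operation with the elementary
  matrix \<open>1 + E\<close>, which is \<open>1\<close> modulo \<open>\<pi>\<close>.\<close>

lemma I_conj_factor:
  assumes k: "k \<in> GLO" and g: "matrix_inv k ** g ** k \<in> I"
  obtains g\<^sub>1 g\<^sub>2 where "g = g\<^sub>1 ** g\<^sub>2" "g\<^sub>1 \<in> \<Gamma>" "g\<^sub>2 \<in> I\<^sub>F {line_of k, point_of k}"
proof -
  define W where "W = matrix_inv k ** g ** k"
  have W: "W \<in> I" using g by (simp add: W_def)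
  have WO: "W $ i $ j \<in> \<O>" for i j using W by (simp add: I_iff integral_nth)
  have c: "W $ 3 $ 1 \<in> \<mm>" using W by (simp add: I_iff)
  define E :: "'K ^ 3 ^ 3" where "E = (\<chi> i j. if i = 3 \<and> j = 1 then W $ 3 $ 1 else 0)"
  have EE: "E ** E = 0" by (simp add: E_def mat3_simps)
  have e: "(mat 1 + E) ** (mat 1 - E) = mat 1"
    by (simp add: matrix_add_rdistrib' matrix_diff_ldistrib EE)
  define V where "V = (mat 1 - E) ** W"
  have kk: "k ** matrix_inv k = mat 1" "matrix_inv k ** k = mat 1" using k by (simp_all add: GLO_inverse_mult)
  have smallE: "small_matrix E" using c by (simp add: small_matrix_def E_def)
  have dE: "det (mat 1 + E) = 1" by (rule square_zero_det[OF EE])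
  have g1: "mat 1 + E \<in> \<Gamma>" using smallE dE by (simp add: \<Gamma>_def)
  have kinv: "matrix_inv k \<in> GLO" "matrix_inv (matrix_inv k) = k" using k by (simp_all add: GLO_inv GLO_matrix_inv_inv)
  have 1: "k ** (mat 1 + E) ** matrix_inv k \<in> \<Gamma>" using \<Gamma>_conj[OF kinv(1) g1] by (simp add: kinv)
  have "mat 1 - E \<in> I"
  proof -
    have "matrix_inv (mat 1 + E) = mat 1 - E" using e by (rule matrix_inv_unique)
    then show ?thesis using I_inv[OF \<Gamma>_subset_I[OF g1]] by simp
  qed
  then have V: "V \<in> I" unfolding V_def using W by (rule I_mult)
  have "V $ 3 $ 1 = W $ 3 $ 1 * (1 - W $ 1 $ 1)"
    by (simp add: V_def E_def matrix_matrix_mult_def sum_3 mat_def algebra_simps)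
  moreover have "W $ 3 $ 1 / \<pi> \<in> \<O>" using c by (simp add: m_iff_pi)
  moreover have "1 - W $ 1 $ 1 \<in> \<mm>" using W m_minus[of "W $ 1 $ 1 - 1"] by (simp add: I_iff)
  ultimately have V31: "V $ 3 $ 1 / \<pi> \<in> \<mm>" using m_mult_left[of "W $ 3 $ 1 / \<pi>" "1 - W $ 1 $ 1"] by simp
  have V': "matrix_inv k ** (k ** V ** matrix_inv k) ** k = V"
  proof -
    have "matrix_inv k ** (k ** V ** matrix_inv k) ** k = matrix_inv k ** (k ** (V ** (matrix_inv k ** k)))"
      by (simp only: matrix_mul_assoc)
    then show ?thesis by (simp only: matrix_cancel[OF kk(2)] kk matrix_mul_rid)
  qed
  have 2: "k ** V ** matrix_inv k \<in> I\<^sub>F {line_of k, point_of k}"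
    by (rule edge_line_point[OF k]) (simp_all only: V' V V31)
  have "k ** (mat 1 + E) ** matrix_inv k ** (k ** V ** matrix_inv k)
      = k ** ((mat 1 + E) ** (matrix_inv k ** (k ** ((mat 1 - E) ** (W ** matrix_inv k)))))"
    by (simp only: V_def matrix_mul_assoc)
  also have "\<dots> = k ** (W ** matrix_inv k)" by (simp only: matrix_cancel[OF kk(2)] matrix_cancel[OF e])
  also have "\<dots> = k ** (matrix_inv k ** (g ** (k ** matrix_inv k)))" by (simp only: W_def matrix_mul_assoc)
  also have "\<dots> = g" by (simp only: matrix_cancel[OF kk(1)] kk matrix_mul_rid)
  finally show thesis using that[OF _ 1 2] by simp
qed

end

section \<open>Double cosets of the Iwahori subgroup\<close>

text \<open>The position of a row or column. The order of the type \<^typ>\<open>3\<close> itself is of no use, since it has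
  \<open>3 = 0\<close>.\<close>

definition rk :: "3 \<Rightarrow> nat" where "rk i = (if i = 1 then 1 else if i = 2 then 2 else 3)"

lemma rk_simps [simp]: "rk 1 = 1" "rk 2 = 2" "rk 3 = 3"
  by (simp_all add: rk_def)

definition elem :: "3 \<Rightarrow> 3 \<Rightarrow> 'a \<Rightarrow> 'a::comm_ring_1 ^ 3 ^ 3" where
  "elem i j c = (\<chi> a b. if a = i \<and> b = j then c else 0)"

lemma mult_elem: "A ** elem i j c = (\<chi> a b. if b = j then A $ a $ i * c else 0)"
  and elem_mult: "elem i j c ** A = (\<chi> a b. if a = i then c * A $ j $ b else 0)"
  using exhaust_3[of i] exhaust_3[of j] by (auto simp: elem_def vec_eq_iff matrix_matrix_mult_def sum_3)

lemma elem_square: "i \<noteq> j \<Longrightarrow> elem i j c ** elem i j d = 0"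
  by (auto simp: mult_elem vec_eq_iff) (simp add: elem_def)

definition col_swap :: "3 \<Rightarrow> 3 \<Rightarrow> 'a::comm_ring_1 ^ 3 ^ 3" where
  "col_swap c d = (\<chi> a b. if a = Transposition.transpose c d b then 1 else 0)"

lemma mult_col_swap: "(A ** col_swap c d) $ a $ b = A $ a $ Transposition.transpose c d b"
  by (simp add: col_swap_def matrix_matrix_mult_def if_distrib if_distribR sum.delta' sum.delta cong: if_cong)

lemma col_swap_square: "col_swap c d ** col_swap c d = mat 1"
  by (auto simp: vec_eq_iff mult_col_swap) (auto simp: col_swap_def mat_def Transposition.transpose_eq_iff split: if_splits)

context totally_ramified_extension
begin

text \<open>The relation of lying in the same double coset of \<open>I\<close> and \<open>GL\<^sub>3(\<O>)\<close>.\<close>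

definition reach :: "'K ^ 3 ^ 3 \<Rightarrow> 'K ^ 3 ^ 3 \<Rightarrow> bool" where
  "reach g g' \<longleftrightarrow> (\<exists>i\<in>I. \<exists>k\<in>GLO. g' = i ** g ** k)"

lemma I_1: "mat 1 \<in> I"
  by (simp add: I_iff mat_def)  (simp add: flip: mat_def)

lemma reach_trans: "reach g g' \<Longrightarrow> reach g' g'' \<Longrightarrow> reach g g''"
proof -
  assume "reach g g'" "reach g' g''"
  then obtain i k i' k' where *: "i \<in> I" "k \<in> GLO" "i' \<in> I" "k' \<in> GLO" "g' = i ** g ** k" "g'' = i' ** g' ** k'"
    by (auto simp: reach_def)
  have "g'' = (i' ** i) ** g ** (k ** k')" unfolding * by (simp only: matrix_mul_assoc)
  then show ?thesis unfolding reach_def using * I_mult GLO_mult by blast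
qed

lemma reach_det: "reach g g' \<Longrightarrow> det g \<noteq> 0 \<Longrightarrow> det g' \<noteq> 0"
  by (auto simp: reach_def det_mul I_iff GLO_det_nz)

lemma reach_swap: "reach g (g ** col_swap c d)"
proof -
  have "integral_matrix (col_swap c d)" by (auto simp: integral_matrix_def col_swap_def)
  then have "col_swap c d \<in> GLO" using integral_GLO col_swap_square by blast
  then show ?thesis unfolding reach_def using I_1 by (metis matrix_mul_lid)
qed

text \<open>One pivot step. The entries in the column of the pivot are cleared by row operations; those on rows
  below the pivot have coefficients in \<open>\<mm>\<close>, so the row operations form an element of \<open>I\<close>. The
  entries in its row are cleared by arbitrary integral column operations.\<close>

lemma reach_clear:
  assumes "g $ r $ c \<noteq> 0"
    and col: "\<And>a. g $ a $ c / g $ r $ c \<in> \<O>" "\<And>a. rk r < rk a \<Longrightarrow> g $ a $ c / g $ r $ c \<in> \<mm>"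
    and row: "\<And>b. g $ r $ b / g $ r $ c \<in> \<O>"
  shows "reach g (\<chi> a b. if b = c then if a = r then g $ r $ c else 0
           else if a = r then 0 else g $ a $ b - g $ a $ c * g $ r $ b / g $ r $ c)"
proof -
  define i :: "'K ^ 3 ^ 3" where "i = (\<chi> a b. if a = b then 1 else if b = r then - (g $ a $ c / g $ r $ c) else 0)"
  define k :: "'K ^ 3 ^ 3" where "k = (\<chi> a b. if a = b then 1 else if a = c then - (g $ r $ b / g $ r $ c) else 0)"
  have "det i = 1" using exhaust_3[of r] by (auto simp: i_def det_3)
  moreover have "integral_matrix i" using col by (auto simp: i_def integral_matrix_def)
  moreover have "i $ 2 $ 1 \<in> \<mm>" "i $ 3 $ 1 \<in> \<mm>" "i $ 3 $ 2 \<in> \<mm>" using col(2) by (auto simp: i_def)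
  ultimately have iI: "i \<in> I" unfolding I_iff by (auto simp: i_def)
  have "det k = 1" using exhaust_3[of c] by (auto simp: k_def det_3)
  moreover have "integral_matrix k" using row by (auto simp: k_def integral_matrix_def)
  ultimately have kG: "k \<in> GLO" by (simp add: GLO_def)
  have ig: "(i ** g) $ a $ b = (if a = r then g $ r $ b else g $ a $ b - g $ a $ c / g $ r $ c * g $ r $ b)" for a b
    using exhaust_3[of a] exhaust_3[of r] by (auto simp: i_def matrix_matrix_mult_def sum_3)
  have mk: "(m ** k) $ a $ b = (if b = c then m $ a $ c else m $ a $ b - m $ a $ c * (g $ r $ b / g $ r $ c))" for m a b
    using exhaust_3[of b] exhaust_3[of c] by (auto simp: k_def matrix_matrix_mult_def sum_3)
  have "i ** g ** k = (\<chi> a b. if b = c then if a = r then g $ r $ c else 0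
           else if a = r then 0 else g $ a $ b - g $ a $ c * g $ r $ b / g $ r $ c)"
    using assms(1) by (simp add: vec_eq_iff mk ig)
  then show ?thesis unfolding reach_def using iI kG by metis
qed

lemma rk_bounds: "1 \<le> rk a" "rk a \<le> 3"
  by (auto simp: rk_def)

text \<open>The pivot is an entry of least valuation in the block \<open>Rs\<close> times \<open>Cs\<close>, in the lowest possible row;
  then the quotients by it satisfy the hypotheses of \<open>reach_clear\<close>. Afterwards its column is
  swapped with the column \<open>d\<close>.\<close>

lemma pivot_step:
  fixes Rs Cs :: "3 set"
  assumes d: "d \<in> Cs" and nz: "a\<^sub>0 \<in> Rs" "b\<^sub>0 \<in> Cs" "g $ a\<^sub>0 $ b\<^sub>0 \<noteq> 0"
    and z: "\<And>a b. a \<notin> Rs \<Longrightarrow> b \<in> Cs \<Longrightarrow> g $ a $ b = 0" "\<And>a b. a \<in> Rs \<Longrightarrow> b \<notin> Cs \<Longrightarrow> g $ a $ b = 0"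
  obtains g' r c where "reach g g'" "r \<in> Rs" "c \<in> Cs" "g $ r $ c = g' $ r $ d" "g' $ r $ d \<noteq> 0"
    "\<And>a. a \<noteq> r \<Longrightarrow> g' $ a $ d = 0" "\<And>b. b \<noteq> d \<Longrightarrow> g' $ r $ b = 0"
    "\<And>a b. a \<notin> Rs \<Longrightarrow> b \<in> Cs \<Longrightarrow> g' $ a $ b = 0" "\<And>a b. a \<in> Rs \<Longrightarrow> b \<notin> Cs \<Longrightarrow> g' $ a $ b = 0"
    "\<And>a b. a \<notin> Rs \<Longrightarrow> b \<notin> Cs \<Longrightarrow> g' $ a $ b = g $ a $ b"
    "\<And>a b. a \<in> Rs \<Longrightarrow> b \<in> Cs \<Longrightarrow> g' $ a $ b / g' $ r $ d \<in> \<O>"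
proof -
  define E where "E = {(a, b). a \<in> Rs \<and> b \<in> Cs \<and> g $ a $ b \<noteq> 0}"
  \<comment> \<open>The factor exceeds all row numbers, so that these only break ties between equal valuations.\<close>
  define key where "key = (\<lambda>(a, b). 4 * v (g $ a $ b) - int (rk a))"
  have "finite E" "E \<noteq> {}" using nz by (auto simp: E_def)
  then obtain r c where rc: "(r, c) \<in> E" and min: "\<And>a b. (a, b) \<in> E \<Longrightarrow> key (r, c) \<le> key (a, b)"
    using arg_min_if_finite[of E key] by (metis not_le_imp_less surj_pair)
  have r: "r \<in> Rs" and c: "c \<in> Cs" and g0: "g $ r $ c \<noteq> 0" using rc by (auto simp: E_def)
  have val: "v (g $ r $ c) \<le> v (g $ a $ b)" "rk r < rk a \<Longrightarrow> v (g $ r $ c) < v (g $ a $ b)"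
    if "a \<in> Rs" "b \<in> Cs" "g $ a $ b \<noteq> 0" for a b
    using min[of a b] that rk_bounds[of a] rk_bounds[of r] by (auto simp: E_def key_def)
  have quot: "g $ a $ b / g $ r $ c \<in> \<O>" "rk r < rk a \<Longrightarrow> g $ a $ b / g $ r $ c \<in> \<mm>"
    if "a \<in> Rs" "b \<in> Cs" for a b
    using val[OF that] g0 by (cases "g $ a $ b = 0"; force simp: in_O_iff in_m_iff v_divide)+
  have col: "g $ a $ c / g $ r $ c \<in> \<O>" "rk r < rk a \<Longrightarrow> g $ a $ c / g $ r $ c \<in> \<mm>" for a
    using quot[of a c] z(1)[of a c] c by (cases "a \<in> Rs"; simp)+
  have row: "g $ r $ b / g $ r $ c \<in> \<O>" for b
    using quot[of r b] z(2)[of r b] r by (cases "b \<in> Cs"; simp)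
  define g\<^sub>1 where "g\<^sub>1 = (\<chi> a b. if b = c then if a = r then g $ r $ c else 0
           else if a = r then 0 else g $ a $ b - g $ a $ c * g $ r $ b / g $ r $ c)"
  have re: "reach g g\<^sub>1" unfolding g\<^sub>1_def by (rule reach_clear[OF g0 col row])
  define \<tau> where "\<tau> = Transposition.transpose c d"
  have \<tau>: "\<tau> d = c" "b \<noteq> d \<Longrightarrow> \<tau> b \<noteq> c" "b \<in> Cs \<Longrightarrow> \<tau> b \<in> Cs" "b \<notin> Cs \<Longrightarrow> \<tau> b = b" for b
    using c d by (auto simp: \<tau>_def Transposition.transpose_def)
  define g' where "g' = g\<^sub>1 ** col_swap c d"
  have g': "g' $ a $ b = g\<^sub>1 $ a $ \<tau> b" for a b by (simp add: g'_def mult_col_swap \<tau>_def)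
  show thesis
  proof (rule that[of g' r c])
    show "reach g g'" unfolding g'_def using re reach_swap by (rule reach_trans)
    show "r \<in> Rs" "c \<in> Cs" by (rule r, rule c)
    have rd: "g' $ r $ d = g $ r $ c" by (simp add: g' \<tau> g\<^sub>1_def)
    then show "g $ r $ c = g' $ r $ d" "g' $ r $ d \<noteq> 0" using g0 by simp_all
    show "g' $ a $ d = 0" if "a \<noteq> r" for a using that by (simp add: g' \<tau> g\<^sub>1_def)
    show "g' $ r $ b = 0" if "b \<noteq> d" for b using \<tau>(2)[OF that] by (simp add: g' g\<^sub>1_def)
    show "g' $ a $ b = 0" if "a \<notin> Rs" "b \<in> Cs" for a b
      using z(1)[OF that(1) c] z(1)[OF that(1) \<tau>(3)[OF that(2)]] that r by (auto simp: g' g\<^sub>1_def)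
    show "g' $ a $ b = 0" if "a \<in> Rs" "b \<notin> Cs" for a b
      using z(2)[OF that] z(2)[OF r that(2)] \<tau>(4)[OF that(2)] that c by (auto simp: g' g\<^sub>1_def)
    show "g' $ a $ b = g $ a $ b" if "a \<notin> Rs" "b \<notin> Cs" for a b
      using z(1)[OF that(1) c] \<tau>(4)[OF that(2)] that c r by (auto simp: g' g\<^sub>1_def)
    show "g' $ a $ b / g' $ r $ d \<in> \<O>" if ab: "a \<in> Rs" "b \<in> Cs" for a b
    proof -
      have "(g $ a $ b' - g $ a $ c * g $ r $ b' / g $ r $ c) / g $ r $ c \<in> \<O>" if "b' \<in> Cs" for b'
      proof -
        have e: "(g $ a $ b' - g $ a $ c * g $ r $ b' / g $ r $ c) / g $ r $ c
          = g $ a $ b' / g $ r $ c - (g $ a $ c / g $ r $ c) * (g $ r $ b' / g $ r $ c)"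
          by (simp add: diff_divide_distrib)
        show ?thesis unfolding e by (intro O_diff O_mult quot ab that c r)
      qed
      then show ?thesis unfolding rd g' using \<tau>(3)[OF ab(2)] g0 by (auto simp: g\<^sub>1_def)
    qed
  qed
qed

text \<open>The columns are treated from the last to the first. As each pivot divides what remains, the
  valuations of the pivots weakly decrease with the column index.\<close>

lemma monomial_form:
  assumes "det g \<noteq> 0"
  obtains m \<sigma> where "reach g m" "inj \<sigma>" "\<And>a b. a \<noteq> \<sigma> b \<Longrightarrow> m $ a $ b = 0" "\<And>b. m $ \<sigma> b $ b \<noteq> 0"
    "\<And>i j. rk i < rk j \<Longrightarrow> m $ \<sigma> i $ i / m $ \<sigma> j $ j \<in> \<O>"
proof -
  have "\<exists>a\<^sub>0 b\<^sub>0. g $ a\<^sub>0 $ b\<^sub>0 \<noteq> 0"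
  proof (rule ccontr)
    assume "\<not> ?thesis"
    then have "det g = 0" by (simp add: det_3)
    then show False using assms by simp
  qed
  then obtain a\<^sub>0 b\<^sub>0 where nz: "g $ a\<^sub>0 $ b\<^sub>0 \<noteq> 0" by blast
  obtain g\<^sub>1 r\<^sub>3 c\<^sub>3 where 1: "reach g g\<^sub>1" "g\<^sub>1 $ r\<^sub>3 $ 3 \<noteq> 0" "\<And>a. a \<noteq> r\<^sub>3 \<Longrightarrow> g\<^sub>1 $ a $ 3 = 0"
    "\<And>b. b \<noteq> 3 \<Longrightarrow> g\<^sub>1 $ r\<^sub>3 $ b = 0" "\<And>a b. g\<^sub>1 $ a $ b / g\<^sub>1 $ r\<^sub>3 $ 3 \<in> \<O>"
    by (rule pivot_step[of 3 UNIV a\<^sub>0 UNIV b\<^sub>0 g]) (use nz in auto)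
  have d1: "det g\<^sub>1 \<noteq> 0" using reach_det[OF 1(1) assms] .
  have "\<exists>a b. a \<noteq> r\<^sub>3 \<and> b \<noteq> 3 \<and> g\<^sub>1 $ a $ b \<noteq> 0"
  proof (rule ccontr)
    assume "\<not> ?thesis"
    then have "g\<^sub>1 $ a $ b = 0" if "b \<noteq> 3" for a b using that 1(4)[of b] by (cases "a = r\<^sub>3") auto
    then have "det g\<^sub>1 = 0" by (simp add: det_3)
    then show False using d1 by simp
  qed
  then obtain a\<^sub>1 b\<^sub>1 where nz1: "a\<^sub>1 \<noteq> r\<^sub>3" "b\<^sub>1 \<noteq> 3" "g\<^sub>1 $ a\<^sub>1 $ b\<^sub>1 \<noteq> 0" by blast
  obtain g\<^sub>2 r\<^sub>2 c\<^sub>2 where 2: "reach g\<^sub>1 g\<^sub>2" "r\<^sub>2 \<noteq> r\<^sub>3" "g\<^sub>1 $ r\<^sub>2 $ c\<^sub>2 = g\<^sub>2 $ r\<^sub>2 $ 2" "g\<^sub>2 $ r\<^sub>2 $ 2 \<noteq> 0"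
    "\<And>a. a \<noteq> r\<^sub>2 \<Longrightarrow> g\<^sub>2 $ a $ 2 = 0" "\<And>b. b \<noteq> 2 \<Longrightarrow> g\<^sub>2 $ r\<^sub>2 $ b = 0"
    "\<And>b. b \<noteq> 3 \<Longrightarrow> g\<^sub>2 $ r\<^sub>3 $ b = 0" "\<And>a. a \<noteq> r\<^sub>3 \<Longrightarrow> g\<^sub>2 $ a $ 3 = 0" "g\<^sub>2 $ r\<^sub>3 $ 3 = g\<^sub>1 $ r\<^sub>3 $ 3"
    "\<And>a b. a \<noteq> r\<^sub>3 \<Longrightarrow> b \<noteq> 3 \<Longrightarrow> g\<^sub>2 $ a $ b / g\<^sub>2 $ r\<^sub>2 $ 2 \<in> \<O>"
    by (rule pivot_step[of 2 "- {3}" a\<^sub>1 "- {r\<^sub>3}" b\<^sub>1 g\<^sub>1]) (use nz1 1 in auto)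
  have "\<exists>r\<^sub>1. r\<^sub>1 \<noteq> r\<^sub>2 \<and> r\<^sub>1 \<noteq> r\<^sub>3"
    using exhaust_3[of r\<^sub>2] exhaust_3[of r\<^sub>3] three_distinct by metis
  then obtain r\<^sub>1 where r1: "r\<^sub>1 \<noteq> r\<^sub>2" "r\<^sub>1 \<noteq> r\<^sub>3" by blast
  have rows: "a = r\<^sub>1 \<or> a = r\<^sub>2 \<or> a = r\<^sub>3" for a
    using exhaust_3[of a] exhaust_3[of r\<^sub>1] exhaust_3[of r\<^sub>2] exhaust_3[of r\<^sub>3] r1 2(2) by auto
  have col1: "g\<^sub>2 $ a $ 1 = 0" if "a \<noteq> r\<^sub>1" for a using rows[of a] that 2(6)[of 1] 2(7)[of 1] by auto
  have d2: "det g\<^sub>2 \<noteq> 0" using reach_det[OF 2(1) d1] .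
  have n1: "g\<^sub>2 $ r\<^sub>1 $ 1 \<noteq> 0"
  proof
    assume "g\<^sub>2 $ r\<^sub>1 $ 1 = 0"
    then have "g\<^sub>2 $ a $ 1 = 0" for a using col1[of a] by (cases "a = r\<^sub>1") auto
    then have "det g\<^sub>2 = 0" by (simp add: det_3)
    then show False using d2 by simp
  qed
  define \<sigma> where "\<sigma> b = (if b = 1 then r\<^sub>1 else if b = 2 then r\<^sub>2 else r\<^sub>3)" for b :: 3
  have q32: "g\<^sub>2 $ r\<^sub>2 $ 2 / g\<^sub>2 $ r\<^sub>3 $ 3 \<in> \<O>" unfolding 2(3)[symmetric] 2(9) by (rule 1(5))
  have q21: "g\<^sub>2 $ r\<^sub>1 $ 1 / g\<^sub>2 $ r\<^sub>2 $ 2 \<in> \<O>" by (rule 2(10)) (use r1 in auto)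
  have q31: "g\<^sub>2 $ r\<^sub>1 $ 1 / g\<^sub>2 $ r\<^sub>3 $ 3 \<in> \<O>" using O_mult[OF q21 q32] 2(4) by simp
  show thesis
  proof (rule that[of g\<^sub>2 \<sigma>])
    show "reach g g\<^sub>2" using 1(1) 2(1) by (rule reach_trans)
    show "inj \<sigma>" using r1 2(2) exhaust_3 unfolding inj_def \<sigma>_def by metis
    show "g\<^sub>2 $ a $ b = 0" if "a \<noteq> \<sigma> b" for a b
      using exhaust_3[of b] that col1 2(5) 2(8) by (auto simp: \<sigma>_def)
    show "g\<^sub>2 $ \<sigma> b $ b \<noteq> 0" for b
      using exhaust_3[of b] n1 2(4) 2(9) 1(2) by (auto simp: \<sigma>_def)
    show "g\<^sub>2 $ \<sigma> i $ i / g\<^sub>2 $ \<sigma> j $ j \<in> \<O>" if "rk i < rk j" for i j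
      using exhaust_3[of i] exhaust_3[of j] that q21 q31 q32 by (auto simp: \<sigma>_def)
  qed
qed

text \<open>Write \<open>h\<^sup>-\<^sup>1 = p\<^sup>-\<^sup>1 m \<kappa>\<^sup>-\<^sup>1\<close> with \<open>p\<close> in \<open>I\<close> and \<open>m\<close> in monomial form. Conjugating
  \<open>1 + elem i j (\<pi> s)\<close> by \<open>m\<close> multiplies its entry by the quotient of the pivots in the columns \<open>i\<close> and
  \<open>j\<close>, which is integral for \<open>i < j\<close>. The result is \<open>1\<close> modulo \<open>\<pi>\<close>, hence in \<open>I\<close>.\<close>

lemma stabiliser_contains_unipotents:
  assumes h: "det h = 1"
  obtains \<kappa> where "\<kappa> \<in> GLO"
    "\<And>i j s. rk i < rk j \<Longrightarrow> s \<in> \<O> \<Longrightarrow>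
       matrix_inv h ** (\<kappa> ** (mat 1 + elem i j (\<pi> * s)) ** matrix_inv \<kappa>) ** h \<in> I"
proof -
  have "det (matrix_inv h) \<noteq> 0" using h by (simp add: det_matrix_inv)
  then obtain m \<sigma> where m: "reach (matrix_inv h) m" "inj \<sigma>" "\<And>a b. a \<noteq> \<sigma> b \<Longrightarrow> m $ a $ b = 0" "\<And>b. m $ \<sigma> b $ b \<noteq> 0"
    "\<And>i j. rk i < rk j \<Longrightarrow> m $ \<sigma> i $ i / m $ \<sigma> j $ j \<in> \<O>"
    using monomial_form by blast
  obtain p \<kappa> where p: "p \<in> I" and \<kappa>: "\<kappa> \<in> GLO" and me: "m = p ** matrix_inv h ** \<kappa>"
    using m(1) by (auto simp: reach_def)
  have hh: "h ** matrix_inv h = mat 1" using h by (simp add: matrix_inv_right')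
  have pp: "matrix_inv p ** p = mat 1" using p by (simp add: matrix_inv_left' I_iff)
  have kk: "\<kappa> ** matrix_inv \<kappa> = mat 1" using \<kappa> by (simp add: GLO_inverse_mult)
  have pull: "m ** elem i j c = elem (\<sigma> i) (\<sigma> j) (c * (m $ \<sigma> i $ i / m $ \<sigma> j $ j)) ** m" for i j c
  proof -
    have "(if b = j then m $ a $ i * c else 0)
        = (if a = \<sigma> i then c * (m $ \<sigma> i $ i / m $ \<sigma> j $ j) * m $ \<sigma> j $ b else 0)" for a b
      using m(3)[of a i] m(3)[of "\<sigma> j" b] m(4)[of j] injD[OF m(2), of j b]
      by (cases "b = j"; cases "a = \<sigma> i") auto
    then show ?thesis unfolding mult_elem elem_mult by (simp add: vec_eq_iff)
  qed
  show thesis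
  proof (rule that[OF \<kappa>])
    fix i j s assume ij: "rk i < rk j" and s: "s \<in> \<O>"
    define q where "q = m $ \<sigma> i $ i / m $ \<sigma> j $ j"
    have "\<pi> * s \<in> \<mm>" using s by simp
    from m_mult_right[OF this m(5)[OF ij]] have q: "\<pi> * s * q \<in> \<mm>" unfolding q_def .
    define E where "E = elem (\<sigma> i) (\<sigma> j) (\<pi> * s * q)"
    have ne: "\<sigma> i \<noteq> \<sigma> j" using ij injD[OF m(2)] by auto
    have "det (mat 1 + E) = 1" unfolding E_def by (rule square_zero_det) (rule elem_square[OF ne])
    then have "mat 1 + E \<in> \<Gamma>" using q by (simp add: \<Gamma>_def small_matrix_def E_def elem_def)
    then have EI: "mat 1 + E \<in> I" by (rule \<Gamma>_subset_I)
    have mE: "m ** (mat 1 + elem i j (\<pi> * s)) = (mat 1 + E) ** m"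
      unfolding E_def q_def by (simp add: matrix_add_ldistrib matrix_add_rdistrib' pull)
    have "matrix_inv h ** (\<kappa> ** (mat 1 + elem i j (\<pi> * s)) ** matrix_inv \<kappa>) ** h
        = matrix_inv p ** (p ** (matrix_inv h ** (\<kappa> ** ((mat 1 + elem i j (\<pi> * s)) ** (matrix_inv \<kappa> ** h)))))"
      by (simp only: matrix_cancel[OF pp]) (simp only: matrix_mul_assoc)
    also have "\<dots> = matrix_inv p ** (m ** (mat 1 + elem i j (\<pi> * s))) ** (matrix_inv \<kappa> ** h)"
      by (simp only: me matrix_mul_assoc)
    also have "\<dots> = matrix_inv p ** (mat 1 + E) ** (p ** (matrix_inv h ** (\<kappa> ** (matrix_inv \<kappa> ** h))))"
      unfolding mE by (simp only: me matrix_mul_assoc)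
    also have "\<dots> = matrix_inv p ** (mat 1 + E) ** p"
      using matrix_inv_left'[of h] h by (simp add: matrix_cancel[OF kk])
    finally show "matrix_inv h ** (\<kappa> ** (mat 1 + elem i j (\<pi> * s)) ** matrix_inv \<kappa>) ** h \<in> I"
      using I_mult[OF I_mult[OF I_inv[OF p] EI] p] by simp
  qed
qed

end

section \<open>Chambers at the central vertex\<close>

context totally_ramified_extension
begin

definition submodule :: "('K ^ 3) set \<Rightarrow> bool" where
  "submodule L \<longleftrightarrow> (\<forall>u\<in>L. \<forall>w\<in>L. u + w \<in> L) \<and> (\<forall>c\<in>\<O>. \<forall>u\<in>L. c *s u \<in> L)"

lemma submodule_add: "submodule L \<Longrightarrow> u \<in> L \<Longrightarrow> w \<in> L \<Longrightarrow> u + w \<in> L"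
  and submodule_smult: "submodule L \<Longrightarrow> c \<in> \<O> \<Longrightarrow> u \<in> L \<Longrightarrow> c *s u \<in> L"
  by (auto simp: submodule_def)

lemma submodule_diff: "submodule L \<Longrightarrow> u \<in> L \<Longrightarrow> w \<in> L \<Longrightarrow> u - w \<in> L"
proof -
  assume *: "submodule L" "u \<in> L" "w \<in> L"
  have "- 1 \<in> \<O>" by simp
  from submodule_add[OF *(1,2) submodule_smult[OF *(1) this *(3)]] show ?thesis by simp
qed

lemma submodule_lattice: "submodule (lattice_of A)"
proof -
  have "A *v a + A *v b \<in> lattice_of A" if "integral_vector a" "integral_vector b" for a b
    unfolding lattice_of_def using that by (intro CollectI exI[of _ "a + b"]) (simp add: matrix_vector_right_distrib)
  moreover have "c *s (A *v a) \<in> lattice_of A" if "integral_vector a" "c \<in> \<O>" for a c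
    unfolding lattice_of_def using that by (intro CollectI exI[of _ "c *s a"]) (simp add: vector_scalar_commute)
  ultimately show ?thesis unfolding submodule_def by (auto simp: lattice_of_def)
qed

abbreviation "L\<^sub>0 \<equiv> lattice_of (mat 1)"

lemma L\<^sub>0_iff: "u \<in> L\<^sub>0 \<longleftrightarrow> integral_vector u"
  by (auto simp: lattice_of_def)

lemma scaled_lattice_iff: "c \<noteq> 0 \<Longrightarrow> u \<in> lattice_of (mat c ** A) \<longleftrightarrow> (1 / c) *s u \<in> lattice_of A"
proof -
  assume c: "c \<noteq> 0"
  have e: "u = c *s ((1 / c) *s u)" using c by simp
  show ?thesis
  proof
    assume "(1 / c) *s u \<in> lattice_of A"
    then have "c *s ((1 / c) *s u) \<in> (\<lambda>u. c *s u) ` lattice_of A" by (rule imageI)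
    then show "u \<in> lattice_of (mat c ** A)" unfolding lattice_scale using e by simp
  qed (use c in \<open>auto simp flip: lattice_scale\<close>)
qed

lemma \<pi>L\<^sub>0_iff: "u \<in> lattice_of (mat \<pi>) \<longleftrightarrow> (\<forall>i. u $ i \<in> \<mm>)"
  using scaled_lattice_iff[of \<pi> u "mat 1"] by (simp add: L\<^sub>0_iff m_iff_pi)

lemma dg_mult_vec: "(dg S *v a) $ i = (if i \<in> S then \<pi> else 1) * a $ i"
  using exhaust_3[of i] by (auto simp: dg_def matrix_vector_mult_def sum_3)

lemma lattice_GLO_dg: "lattice_of (k ** dg S) = {k *v b | b. integral_vector b \<and> (\<forall>i\<in>S. b $ i \<in> \<mm>)}"
proof (rule subset_antisym; rule subsetI)
  fix u assume "u \<in> lattice_of (k ** dg S)"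
  then obtain a where "u = k *v (dg S *v a)" "integral_vector a"
    by (auto simp: lattice_of_def matrix_vector_mul_assoc)
  then show "u \<in> {k *v b | b. integral_vector b \<and> (\<forall>i\<in>S. b $ i \<in> \<mm>)}"
    by (intro CollectI exI[of _ "dg S *v a"]) (auto simp: dg_mult_vec)
next
  fix u assume "u \<in> {k *v b | b. integral_vector b \<and> (\<forall>i\<in>S. b $ i \<in> \<mm>)}"
  then obtain b where b: "u = k *v b" "integral_vector b" "\<forall>i\<in>S. b $ i \<in> \<mm>" by blast
  define a where "a = (\<chi> i. if i \<in> S then b $ i / \<pi> else b $ i)"
  have "b = dg S *v a" by (simp add: vec_eq_iff dg_mult_vec a_def)
  moreover have "integral_vector a" using b by (auto simp: a_def m_iff_pi)
  ultimately show "u \<in> lattice_of (k ** dg S)"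
    unfolding lattice_of_def using b(1) by (intro CollectI exI[of _ a]) (simp add: matrix_vector_mul_assoc)
qed

text \<open>Adjacency is symmetric: \<open>L \<supseteq> L' \<supseteq> \<pi> L\<close> gives \<open>L' \<supseteq> \<pi> L \<supseteq> \<pi> L'\<close>, and \<open>\<pi> L\<close> represents the same vertex
  as \<open>L\<close>.\<close>

lemma adjacentI:
  assumes "vert A \<noteq> vert B" "lattice_of B \<subseteq> lattice_of A" "lattice_of (mat \<pi> ** A) \<subseteq> lattice_of B"
  shows "adjacent (vert A) (vert B)" "adjacent (vert B) (vert A)"
proof -
  have self: "lattice_of D \<in> vert D" for D unfolding vert_alt by (intro CollectI exI[of _ 1]) simp
  have scaled_A: "(\<lambda>u. \<pi> *s u) ` lattice_of A \<subseteq> lattice_of B"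
    using assms(3) unfolding lattice_scale .
  show "adjacent (vert A) (vert B)"
    unfolding adjacent_def
    by (intro conjI bexI[of _ "lattice_of A"] bexI[of _ "lattice_of B"] self scaled_A assms(1,2))
  have in_A: "lattice_of (mat \<pi> ** A) \<in> vert A"
    unfolding vert_alt by (intro CollectI exI[of _ \<pi>] conjI refl pi_nz)
  have scaled: "(\<lambda>u. \<pi> *s u) ` lattice_of B \<subseteq> lattice_of (mat \<pi> ** A)"
    unfolding lattice_scale[symmetric] by (rule image_mono[OF assms(2)])
  show "adjacent (vert B) (vert A)"
    unfolding adjacent_def
    by (intro conjI bexI[of _ "lattice_of B"] bexI[of _ "lattice_of (mat \<pi> ** A)"] self in_A scaled
      assms(1)[symmetric] assms(3))
qed

lemma adjacentE:
  assumes "adjacent (vert B) (vert A)"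
  obtains c where "c \<noteq> 0" "lattice_of (mat c ** A) \<subseteq> lattice_of B" "lattice_of (mat \<pi> ** B) \<subseteq> lattice_of (mat c ** A)"
proof -
  obtain d e where d: "d \<noteq> 0" "e \<noteq> 0" and sub: "lattice_of (mat e ** A) \<subseteq> lattice_of (mat d ** B)"
    "(\<lambda>u. \<pi> *s u) ` lattice_of (mat d ** B) \<subseteq> lattice_of (mat e ** A)"
    using assms by (auto simp: adjacent_def vert_alt)
  show thesis
  proof (rule that[of "e / d"])
    show "e / d \<noteq> 0" using d by simp
    show "lattice_of (mat (e / d) ** A) \<subseteq> lattice_of B"
    proof
      fix u assume "u \<in> lattice_of (mat (e / d) ** A)"
      then have "(1 / e) *s (d *s u) \<in> lattice_of A" using d by (simp add: scaled_lattice_iff)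
      then have "d *s u \<in> lattice_of (mat e ** A)" using d by (simp add: scaled_lattice_iff)
      then have "d *s u \<in> lattice_of (mat d ** B)" using sub by blast
      then show "u \<in> lattice_of B" using d by (simp add: scaled_lattice_iff)
    qed
    show "lattice_of (mat \<pi> ** B) \<subseteq> lattice_of (mat (e / d) ** A)"
    proof
      fix u assume "u \<in> lattice_of (mat \<pi> ** B)"
      then have "(1 / \<pi>) *s u \<in> lattice_of B" by (simp add: scaled_lattice_iff)
      then have "d *s ((1 / \<pi>) *s u) \<in> lattice_of (mat d ** B)" using d by (simp add: scaled_lattice_iff)
      then have "\<pi> *s (d *s ((1 / \<pi>) *s u)) \<in> lattice_of (mat e ** A)" using sub(2) by blast
      then have "d *s u \<in> lattice_of (mat e ** A)" by simp
      then show "u \<in> lattice_of (mat (e / d) ** A)" using d by (simp add: scaled_lattice_iff)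
    qed
  qed
qed

lemma chamber_of_facet:
  assumes k: "k \<in> GLO"
  shows "{v\<^sub>0, line_of k, point_of k} \<in> facets 2"
proof -
  have d: "det k \<noteq> 0" "det (k ** dg S) \<noteq> 0" for S using k v_det_line_point(4) GLO_det_nz by auto
  have v: "v\<^sub>0 \<in> vertices" "line_of k \<in> vertices" "point_of k \<in> vertices"
    using d unfolding v\<^sub>0_eq[OF k] vertices_alt by blast+
  have adj: "adjacent (vert (k ** dg S)) (vert (k ** dg T))" "adjacent (vert (k ** dg T)) (vert (k ** dg S))"
    if "S \<subseteq> T" "vert (k ** dg S) \<noteq> vert (k ** dg T)" for S T
  proof -
    have 1: "lattice_of (k ** dg T) \<subseteq> lattice_of (k ** dg S)" using that(1) by (auto simp: lattice_GLO_dg)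
    have "\<pi> *s (k *v b) = k *v (\<pi> *s b)" for b by (simp add: vector_scalar_commute)
    then have 2: "lattice_of (mat \<pi> ** (k ** dg S)) \<subseteq> lattice_of (k ** dg T)"
      unfolding lattice_scale[symmetric] lattice_GLO_dg by fastforce
    show "adjacent (vert (k ** dg S)) (vert (k ** dg T))" "adjacent (vert (k ** dg T)) (vert (k ** dg S))"
      using adjacentI[OF that(2) 1 2] by auto
  qed
  have v0: "v\<^sub>0 = vert (k ** dg {})" by (simp add: dg_empty v\<^sub>0_eq[OF k])
  have ne: "v\<^sub>0 \<noteq> line_of k" "v\<^sub>0 \<noteq> point_of k" "line_of k \<noteq> point_of k" using vertex_types[OF k k] by auto
  have "adjacent v\<^sub>0 (line_of k)" "adjacent (line_of k) v\<^sub>0" "adjacent v\<^sub>0 (point_of k)" "adjacent (point_of k) v\<^sub>0"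
    "adjacent (line_of k) (point_of k)" "adjacent (point_of k) (line_of k)"
    using adj[of "{}" "{3}"] adj[of "{}" "{2, 3}"] adj[of "{3}" "{2, 3}"] ne unfolding v0 by auto
  then show ?thesis using v ne unfolding facets_def by auto
qed

lemma of_nat_O: "of_nat n \<in> \<O>"
  by (induction n) auto

lemma residue_rep:
  assumes "x \<in> \<O>"
  obtains n where "n < CARD('p)" "x - of_nat n \<in> \<mm>"
proof -
  obtain n where n: "n < CARD('p)" "residue_map x = of_nat n" using surj_of_nat_mod_ring by blast
  have "residue_map (x - of_nat n) = 0"
    using n assms by (simp add: residue_map_diff of_nat_O residue_map_of_nat)
  then show thesis using that n residue_map_eq_0_iff[of "x - of_nat n"] assms by (simp add: of_nat_O)
qed

text \<open>If the determinant is not a unit, the reduction of \<open>k\<close> is singular, and a vector in its kernel lifts to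
  one that contradicts the assumption.\<close>

lemma GLO_if_independent:
  assumes int: "integral_matrix k"
    and ind: "\<And>a. integral_vector a \<Longrightarrow> (\<forall>i. (k *v a) $ i \<in> \<mm>) \<Longrightarrow> \<forall>i. a $ i \<in> \<mm>"
  shows "k \<in> GLO"
proof (rule ccontr)
  assume "k \<notin> GLO"
  then have dm: "det k \<in> \<mm>" using int by (auto simp: GLO_def integral_det)
  define kb :: "'p mod_ring ^ 3 ^ 3" where "kb = (\<chi> i j. residue_map (k $ i $ j))"
  have kO: "k $ i $ j \<in> \<O>" for i j using int by (rule integral_nth)
  have "det kb = residue_map (det k)"
    by (simp add: det_3 kb_def kO residue_map_add residue_map_diff residue_map_mult)
  also have "\<dots> = 0" using dm by (simp add: residue_map_eq_0_iff m_imp_O)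
  finally have "\<not> invertible kb" by (simp add: invertible_det_nz)
  then have "\<not> (\<exists>B. B ** kb = mat 1)" by (simp add: invertible_left_inverse)
  then obtain x where x: "kb *v x = 0" "x \<noteq> 0" unfolding matrix_left_invertible_ker by blast
  have "\<exists>a. a \<in> \<O> \<and> residue_map a = x $ i" for i
    using surj_of_nat_mod_ring[of "x $ i"] residue_map_of_nat of_nat_O by metis
  then obtain f where f: "\<And>i. f i \<in> \<O>" "\<And>i. residue_map (f i) = x $ i" by metis
  define a :: "'K ^ 3" where "a = (\<chi> i. f i)"
  have "residue_map ((k *v a) $ i) = (kb *v x) $ i" for i
    by (simp add: matrix_vector_mult_def sum_3 a_def kb_def f kO residue_map_add residue_map_mult)
  then have "residue_map ((k *v a) $ i) = 0" for i by (simp add: x)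
  moreover have "(k *v a) $ i \<in> \<O>" for i by (simp add: matrix_vector_mult_def sum_3 a_def f kO)
  ultimately have "(k *v a) $ i \<in> \<mm>" for i by (simp add: residue_map_eq_0_iff)
  then have "\<forall>i. a $ i \<in> \<mm>" using ind[of a] by (simp add: a_def f)
  then have "x $ i = 0" for i using f residue_map_eq_0_iff[of "f i"] by (simp add: a_def)
  then show False using x(2) by (simp add: vec_eq_iff)
qed

lemma unit_smult_cancel: "submodule L \<Longrightarrow> c \<in> \<O> \<Longrightarrow> c \<notin> \<mm> \<Longrightarrow> c *s u \<in> L \<Longrightarrow> u \<in> L"
  using submodule_smult[of L "inverse c" "c *s u"] unit_inverse[of c] by simp

text \<open>One vector is taken from each of the three steps of the chain from \<open>\<pi> \<O>\<^sup>3\<close> to \<open>\<O>\<^sup>3\<close>. Because the vectors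
  lie in different steps they are independent modulo \<open>\<pi>\<close>, so they form a basis of \<open>\<O>\<^sup>3\<close>.\<close>

lemma adapted_basis:
  assumes sub: "submodule L" "submodule L'"
    and chain: "lattice_of (mat \<pi>) \<subseteq> L" "L \<subseteq> L'" "L' \<subseteq> L\<^sub>0"
    and strict: "L \<noteq> lattice_of (mat \<pi>)" "L \<noteq> L'" "L' \<noteq> L\<^sub>0"
  obtains k where "k \<in> GLO" "L' = lattice_of (k ** dg {3})" "L = lattice_of (k ** dg {2, 3})"
proof -
  obtain e\<^sub>1 e\<^sub>2 e\<^sub>3 where e: "e\<^sub>1 \<in> L" "e\<^sub>1 \<notin> lattice_of (mat \<pi>)" "e\<^sub>2 \<in> L'" "e\<^sub>2 \<notin> L" "e\<^sub>3 \<in> L\<^sub>0" "e\<^sub>3 \<notin> L'"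
    using chain strict by blast
  define k :: "'K ^ 3 ^ 3" where "k = (\<chi> i j. if j = 1 then e\<^sub>1 $ i else if j = 2 then e\<^sub>2 $ i else e\<^sub>3 $ i)"
  have ka: "k *v a = a $ 1 *s e\<^sub>1 + a $ 2 *s e\<^sub>2 + a $ 3 *s e\<^sub>3" for a
    by (simp add: vec_eq_iff k_def matrix_vector_mult_def sum_3 mult.commute)
  have subs: "submodule L\<^sub>0" "submodule (lattice_of (mat \<pi>))" by (rule submodule_lattice)+
  have eL: "e\<^sub>1 \<in> L'" "e\<^sub>1 \<in> L\<^sub>0" "e\<^sub>2 \<in> L\<^sub>0" using e chain by auto
  have m_smult: "c *s u \<in> lattice_of (mat \<pi>)" if "c \<in> \<mm>" "u \<in> L\<^sub>0" for c u
    using that by (simp add: \<pi>L\<^sub>0_iff L\<^sub>0_iff m_mult_right)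
  have a3: "a $ 3 \<in> \<mm>" if a: "integral_vector a" "k *v a \<in> L'" for a
  proof (rule ccontr)
    assume u: "a $ 3 \<notin> \<mm>"
    have "k *v a - a $ 1 *s e\<^sub>1 - a $ 2 *s e\<^sub>2 \<in> L'"
      by (intro submodule_diff[OF sub(2)] submodule_smult[OF sub(2)]) (use a e eL in auto)
    then have "a $ 3 *s e\<^sub>3 \<in> L'" by (simp add: ka)
    then show False using unit_smult_cancel[OF sub(2)] a u e by blast
  qed
  have a2: "a $ 2 \<in> \<mm>" if a: "integral_vector a" "k *v a \<in> L" for a
  proof (rule ccontr)
    assume u: "a $ 2 \<notin> \<mm>"
    have "a $ 3 *s e\<^sub>3 \<in> L" using m_smult[OF a3[OF a(1)] e(5)] a(2) chain by blast
    then have "k *v a - a $ 1 *s e\<^sub>1 - a $ 3 *s e\<^sub>3 \<in> L"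
      using submodule_diff[OF sub(1) submodule_diff[OF sub(1) a(2) submodule_smult[OF sub(1) _ e(1)]]] a(1) by blast
    then have "a $ 2 *s e\<^sub>2 \<in> L" by (simp add: ka)
    then show False using unit_smult_cancel[OF sub(1)] a u e by blast
  qed
  have a1: "a $ 1 \<in> \<mm>" if a: "integral_vector a" "k *v a \<in> lattice_of (mat \<pi>)" for a
  proof (rule ccontr)
    assume u: "a $ 1 \<notin> \<mm>"
    have "k *v a \<in> L" "k *v a \<in> L'" using a chain by auto
    then have "a $ 3 *s e\<^sub>3 \<in> lattice_of (mat \<pi>)" "a $ 2 *s e\<^sub>2 \<in> lattice_of (mat \<pi>)"
      using m_smult a2 a3 a(1) e eL by auto
    then have "k *v a - a $ 2 *s e\<^sub>2 - a $ 3 *s e\<^sub>3 \<in> lattice_of (mat \<pi>)"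
      by (intro submodule_diff[OF subs(2)] a)
    then have "a $ 1 *s e\<^sub>1 \<in> lattice_of (mat \<pi>)" by (simp add: ka)
    then show False using unit_smult_cancel[OF subs(2)] a u e by blast
  qed
  have "integral_matrix k" using e eL by (auto simp: integral_matrix_def k_def L\<^sub>0_iff)
  then have k: "k \<in> GLO"
  proof (rule GLO_if_independent)
    fix a assume a: "integral_vector a" "\<forall>i. (k *v a) $ i \<in> \<mm>"
    then have m: "k *v a \<in> lattice_of (mat \<pi>)" by (simp add: \<pi>L\<^sub>0_iff)
    then show "\<forall>i. a $ i \<in> \<mm>" unfolding forall_3 using a1[OF a(1)] a2[OF a(1)] a3[OF a(1)] chain by blast
  qed
  have coord: "\<exists>b. u = k *v b \<and> integral_vector b" if "u \<in> L\<^sub>0" for u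
  proof (intro exI conjI)
    show "u = k *v (matrix_inv k *v u)" by (simp add: matrix_vector_mul_assoc GLO_inverse_mult k)
    show "integral_vector (matrix_inv k *v u)"
      using that integral_mult_vec[OF GLO_integral[OF GLO_inv[OF k]]] by (simp add: L\<^sub>0_iff)
  qed
  show thesis
  proof (rule that[OF k])
    show "L' = lattice_of (k ** dg {3})"
    proof
      show "L' \<subseteq> lattice_of (k ** dg {3})"
        unfolding lattice_GLO_dg using coord a3 chain by fastforce
      show "lattice_of (k ** dg {3}) \<subseteq> L'"
        unfolding lattice_GLO_dg
      proof clarify
        fix b assume b: "integral_vector b" "\<forall>i\<in>{3}. b $ i \<in> \<mm>"
        have "b $ 3 *s e\<^sub>3 \<in> L'" using m_smult[OF _ e(5), of "b $ 3"] b chain by auto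
        then show "k *v b \<in> L'"
          unfolding ka
          by (intro submodule_add[OF sub(2) submodule_add[OF sub(2) submodule_smult[OF sub(2)] submodule_smult[OF sub(2)]]])
            (use b e eL in auto)
      qed
    qed
    show "L = lattice_of (k ** dg {2, 3})"
    proof
      show "L \<subseteq> lattice_of (k ** dg {2, 3})"
        unfolding lattice_GLO_dg using coord a2 a3 chain by fastforce
      show "lattice_of (k ** dg {2, 3}) \<subseteq> L"
        unfolding lattice_GLO_dg
      proof clarify
        fix b assume b: "integral_vector b" "\<forall>i\<in>{2, 3}. b $ i \<in> \<mm>"
        have "b $ 3 *s e\<^sub>3 \<in> L" "b $ 2 *s e\<^sub>2 \<in> L" using m_smult[OF _ e(5), of "b $ 3"] m_smult[OF _ eL(3), of "b $ 2"] b chain by auto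
        then show "k *v b \<in> L"
          unfolding ka
          by (intro submodule_add[OF sub(1) submodule_add[OF sub(1) submodule_smult[OF sub(1)]]])
            (use b e eL in auto)
      qed
    qed
  qed
qed

text \<open>Let \<open>c\<close> be the scalar that makes \<open>c L\<^sub>B\<close> lie between \<open>L\<^sub>A\<close> and \<open>\<pi> L\<^sub>A\<close>. If \<open>c\<close> is a unit then
  \<open>L\<^sub>B \<subseteq> L\<^sub>A\<close>; if \<open>\<pi>\<close> divides \<open>c\<close> then \<open>L\<^sub>A \<subseteq> L\<^sub>B\<close>; otherwise \<open>L\<^sub>B\<close> would be \<open>\<pi> \<O>\<^sup>3\<close>.\<close>

lemma nested_representatives:
  assumes A: "det A \<noteq> 0" and B: "det B \<noteq> 0" and adj: "adjacent (vert A) (vert B)" and v0: "vert B \<noteq> v\<^sub>0"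
    and LA: "lattice_of A \<subseteq> L\<^sub>0"
    and LB: "lattice_of B \<subseteq> L\<^sub>0" "lattice_of (mat \<pi>) \<subseteq> lattice_of B"
  shows "lattice_of B \<subseteq> lattice_of A \<or> lattice_of A \<subseteq> lattice_of B"
proof -
  obtain c where c: "c \<noteq> 0" and sub: "lattice_of (mat c ** B) \<subseteq> lattice_of A" "lattice_of (mat \<pi> ** A) \<subseteq> lattice_of (mat c ** B)"
    using adjacentE[OF adj] by blast
  have cB: "c *s u \<in> lattice_of A" if "u \<in> lattice_of B" for u
    using sub(1) that c scaled_lattice_iff[of c "c *s u" B] by auto
  have \<pi>A: "(\<pi> / c) *s u \<in> lattice_of B" if "u \<in> lattice_of A" for u
    using sub(2) that c scaled_lattice_iff[of c "\<pi> *s u" B] scaled_lattice_iff[of \<pi> "\<pi> *s u" A] by (auto simp: mult.commute)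
  consider "v c = 0" | "1 \<le> v c" | "v c < 0" by linarith
  then show ?thesis
  proof cases
    case 1
    then have "inverse c \<in> \<O>" using c by (simp add: in_O_iff v_inverse)
    then have "u \<in> lattice_of A" if "u \<in> lattice_of B" for u
      using submodule_smult[OF submodule_lattice _ cB[OF that], of "inverse c"] c by simp
    then show ?thesis by blast
  next
    case 2
    then have "c / \<pi> \<in> \<O>" using c m_iff_pi[of c] by (simp add: in_m_iff)
    then have "u \<in> lattice_of B" if "u \<in> lattice_of A" for u
      using submodule_smult[OF submodule_lattice _ \<pi>A[OF that], of "c / \<pi>"] c by simp
    then show ?thesis by blast
  next
    case 3
    then have cm: "inverse c \<in> \<mm>" using c by (simp add: in_m_iff v_inverse)
    have "u \<in> lattice_of (mat \<pi>)" if "u \<in> lattice_of B" for u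
    proof -
      have "c *s u \<in> L\<^sub>0" using cB[OF that] LA by blast
      then have "inverse c * (c * u $ i) \<in> \<mm>" for i by (intro m_mult_right cm) (simp add: L\<^sub>0_iff)
      then show ?thesis using c by (simp add: \<pi>L\<^sub>0_iff flip: mult.assoc)
    qed
    then have e: "lattice_of B = lattice_of (mat \<pi>)" using LB(2) by blast
    have "vert (mat \<pi>) = vert (mat 1)"
    proof -
      have "det (mat \<pi> :: 'K ^ 3 ^ 3) \<noteq> 0" by (simp add: det_mat3)
      moreover have "mat \<pi> = mat \<pi> ** mat 1 ** (mat 1 :: 'K ^ 3 ^ 3)" by simp
      ultimately show ?thesis using vert_eq_iff[of "mat 1" "mat \<pi>"] GLO_1 pi_nz by (metis det_I one_neq_zero)
    qed
    then have "vert B = v\<^sub>0" using e by (simp add: vert_def v\<^sub>0_eq[OF GLO_1])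
    then show ?thesis using v0 by simp
  qed
qed

text \<open>The representatives of the two other vertices between \<open>\<O>\<^sup>3\<close> and \<open>\<pi> \<O>\<^sup>3\<close> are nested, so there is a
  basis adapted to both.\<close>

lemma chamber_at_v\<^sub>0:
  assumes F: "F \<in> facets 2" and v0: "v\<^sub>0 \<in> F"
  obtains k where "k \<in> GLO" "F = {v\<^sub>0, line_of k, point_of k}"
proof -
  have "card F = 3" using F by (simp add: facets_def)
  then have "card (F - {v\<^sub>0}) = 2" using v0 by (simp add: card_Diff_singleton)
  then obtain x y where xy: "F - {v\<^sub>0} = {x, y}" "x \<noteq> y" by (meson card_2_iff)
  then have F_eq: "F = {v\<^sub>0, x, y}" and ne: "x \<noteq> v\<^sub>0" "y \<noteq> v\<^sub>0" using v0 by blast+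
  have adj: "adjacent v\<^sub>0 x" "adjacent v\<^sub>0 y" "adjacent x y" and vx: "x \<in> vertices" "y \<in> vertices"
    using F ne xy(2) unfolding F_eq facets_def by auto
  have rep: "\<exists>A. z = vert A \<and> det A \<noteq> 0 \<and> lattice_of A \<subseteq> L\<^sub>0 \<and> lattice_of (mat \<pi>) \<subseteq> lattice_of A
     \<and> lattice_of A \<noteq> L\<^sub>0 \<and> lattice_of A \<noteq> lattice_of (mat \<pi>)"
    if z: "z \<in> vertices" "adjacent v\<^sub>0 z" "z \<noteq> v\<^sub>0" for z
  proof -
    obtain B where B: "z = vert B" "det B \<noteq> 0" using z(1) by (auto simp: vertices_alt)
    obtain c where c: "c \<noteq> 0" "lattice_of (mat c ** B) \<subseteq> L\<^sub>0" "lattice_of (mat \<pi> ** mat 1) \<subseteq> lattice_of (mat c ** B)"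
      using adjacentE[of "mat 1" B] z(2) unfolding B(1) v\<^sub>0_eq[OF GLO_1] by blast
    have d: "det (mat c ** B) \<noteq> 0" using c B by (simp add: det_mul det_mat3)
    have zc: "z = vert (mat c ** B)"
      unfolding B(1) using vert_eq_iff[OF B(2) d] c(1) GLO_1 by (metis matrix_mul_rid)
    have "vert (mat \<pi>) = v\<^sub>0"
      using vert_eq_iff[of "mat 1" "mat \<pi>"] pi_nz GLO_1 unfolding v\<^sub>0_eq[OF GLO_1]
      by (metis det_I det_mat3 matrix_mul_rid one_neq_zero power_not_zero)
    then have "lattice_of (mat c ** B) \<noteq> L\<^sub>0 \<and> lattice_of (mat c ** B) \<noteq> lattice_of (mat \<pi>)"
      using zc z(3) v\<^sub>0_eq[OF GLO_1] by (metis vert_def)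
    then show ?thesis using zc d c by (intro exI[of _ "mat c ** B"]) simp
  qed
  obtain A B where A: "x = vert A" "det A \<noteq> 0" "lattice_of A \<subseteq> L\<^sub>0" "lattice_of (mat \<pi>) \<subseteq> lattice_of A"
      "lattice_of A \<noteq> L\<^sub>0" "lattice_of A \<noteq> lattice_of (mat \<pi>)"
    and B: "y = vert B" "det B \<noteq> 0" "lattice_of B \<subseteq> L\<^sub>0" "lattice_of (mat \<pi>) \<subseteq> lattice_of B"
      "lattice_of B \<noteq> L\<^sub>0" "lattice_of B \<noteq> lattice_of (mat \<pi>)"
    using rep[OF vx(1) adj(1) ne(1)] rep[OF vx(2) adj(2) ne(2)] by blast
  have neq: "lattice_of A \<noteq> lattice_of B" using xy(2) A(1) B(1) by (auto simp: vert_def)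
  have "lattice_of B \<subseteq> lattice_of A \<or> lattice_of A \<subseteq> lattice_of B"
    by (rule nested_representatives[OF A(2) B(2)]) (use A B ne adj in auto)
  then show thesis
  proof
    assume "lattice_of B \<subseteq> lattice_of A"
    then obtain k where k: "k \<in> GLO" "lattice_of A = lattice_of (k ** dg {3})" "lattice_of B = lattice_of (k ** dg {2, 3})"
      by (rule adapted_basis[OF submodule_lattice submodule_lattice B(4) _ A(3) B(6) neq[symmetric] A(5)])
    then have "F = {v\<^sub>0, line_of k, point_of k}" unfolding F_eq A(1) B(1) by (simp add: vert_def)
    then show thesis using that k(1) by blast
  next
    assume "lattice_of A \<subseteq> lattice_of B"
    then obtain k where k: "k \<in> GLO" "lattice_of B = lattice_of (k ** dg {3})" "lattice_of A = lattice_of (k ** dg {2, 3})"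
      by (rule adapted_basis[OF submodule_lattice submodule_lattice A(4) _ B(3) A(6) neq B(5)])
    then have "F = {v\<^sub>0, line_of k, point_of k}" unfolding F_eq A(1) B(1) by (auto simp: vert_def)
    then show thesis using that k(1) by blast
  qed
qed

text \<open>A lattice between \<open>L\<close> and \<open>\<pi> L\<close> is determined by the combinations of a basis of \<open>L\<close> it contains
  whose coefficients lie in a finite set of representatives of the residue field.\<close>

lemma finite_neighbours:
  assumes "x \<in> vertices"
  shows "finite {y \<in> vertices. adjacent x y}"
proof -
  obtain B where B: "x = vert B" "det B \<noteq> 0" using assms by (auto simp: vertices_alt)
  define R :: "'K set" where "R = of_nat ` {..<CARD('p)}"
  define RV :: "('K ^ 3) set" where "RV = (\<lambda>(a, b, c). vector [a, b, c]) ` (R \<times> R \<times> R)"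
  have "finite RV" by (simp add: RV_def R_def)
  have RV: "\<exists>a\<in>RV. \<forall>i. (b - a) $ i \<in> \<mm>" if "integral_vector b" for b
  proof -
    have "\<exists>r\<in>R. b $ i - r \<in> \<mm>" for i
      using residue_rep[of "b $ i"] that by (auto simp: R_def)
    then obtain f where f: "\<And>i. f i \<in> R \<and> b $ i - f i \<in> \<mm>" by metis
    show ?thesis
    proof (rule bexI)
      show "vector [f 1, f 2, f 3] \<in> RV" unfolding RV_def using f by (intro image_eqI[of _ _ "(f 1, f 2, f 3)"]) auto
      show "\<forall>i. (b - vector [f 1, f 2, f 3]) $ i \<in> \<mm>" using f by (simp add: forall_3)
    qed
  qed
  define LL where "LL = {L. submodule L \<and> L \<subseteq> lattice_of B \<and> lattice_of (mat \<pi> ** B) \<subseteq> L}"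
  have "inj_on (\<lambda>L. {a \<in> RV. B *v a \<in> L}) LL"
  proof -
    have "L \<subseteq> L'" if L: "L \<in> LL" "L' \<in> LL" and eq: "{a \<in> RV. B *v a \<in> L} = {a \<in> RV. B *v a \<in> L'}" for L L'
    proof
      fix u assume u: "u \<in> L"
      then obtain b where b: "u = B *v b" "integral_vector b" using L(1) by (auto simp: LL_def lattice_of_def)
      obtain a where a: "a \<in> RV" "\<forall>i. (b - a) $ i \<in> \<mm>" using RV[OF b(2)] by blast
      have "b - a \<in> lattice_of (mat \<pi>)" unfolding \<pi>L\<^sub>0_iff by (rule a(2))
      then have "(1 / \<pi>) *s (b - a) \<in> L\<^sub>0" using scaled_lattice_iff[of \<pi> "b - a" "mat 1"] by simp
      then have "B *v ((1 / \<pi>) *s (b - a)) \<in> lattice_of B" by (auto simp: lattice_of_def)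
      then have "(1 / \<pi>) *s (B *v (b - a)) \<in> lattice_of B" by (simp only: vector_scalar_commute)
      then have d: "B *v (b - a) \<in> lattice_of (mat \<pi> ** B)" by (simp only: scaled_lattice_iff[OF pi_nz])
      have "B *v a = u - B *v (b - a)" by (simp add: b matrix_vector_mult_diff_distrib)
      also have "\<dots> \<in> L" using L(1) u d by (intro submodule_diff) (auto simp: LL_def)
      finally have "a \<in> {a \<in> RV. B *v a \<in> L}" using a by simp
      then have "B *v a \<in> L'" using eq by blast
      then have "B *v a + B *v (b - a) \<in> L'" using L(2) d by (intro submodule_add) (auto simp: LL_def)
      then show "u \<in> L'" by (simp add: b flip: matrix_vector_right_distrib)
    qed
    then show ?thesis by (intro inj_onI) blast
  qed
  moreover have "finite ((\<lambda>L. {a \<in> RV. B *v a \<in> L}) ` LL)"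
    by (rule finite_subset[of _ "Pow RV"]) (use \<open>finite RV\<close> in auto)
  ultimately have "finite LL" by (rule finite_imageD[rotated])
  moreover have "{y \<in> vertices. adjacent x y} \<subseteq> homothety_class ` LL"
  proof clarify
    fix y assume y: "y \<in> vertices" "adjacent x y"
    then obtain A where A: "y = vert A" "det A \<noteq> 0" by (auto simp: vertices_alt)
    obtain c where c: "c \<noteq> 0" "lattice_of (mat c ** A) \<subseteq> lattice_of B" "lattice_of (mat \<pi> ** B) \<subseteq> lattice_of (mat c ** A)"
      using adjacentE[of B A] y A B by blast
    have "det (mat c ** A) \<noteq> 0" using c A by (simp add: det_mul det_mat3)
    then have "vert A = vert (mat c ** A)" using vert_eq_iff[OF A(2)] c(1) GLO_1 by (metis matrix_mul_rid)
    then show "y \<in> homothety_class ` LL"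
      using c submodule_lattice unfolding A(1) vert_def[of "mat c ** A"] LL_def by blast
  qed
  ultimately show ?thesis using finite_subset by blast
qed

end

section \<open>Orientations and boundaries in low dimension\<close>

lemma permutes_one: "s permutes {..<Suc 0} \<longleftrightarrow> s = id"
proof -
  have "{..<Suc 0} = {0}" by auto
  then show ?thesis by (metis permutes_sing)
qed

lemma permutes_two: "s permutes {..<2::nat} \<longleftrightarrow> s = id \<or> s = Transposition.transpose 0 1"
proof
  assume s: "s permutes {..<2}"
  have "s 0 < 2" "s 1 < 2" "s 0 \<noteq> s 1" "\<And>i. 2 \<le> i \<Longrightarrow> s i = i"
    using permutes_in_image[OF s] permutes_not_in[OF s] permutes_inj[OF s] by (auto dest: injD)
  then have "(s 0 = 0 \<and> s 1 = 1) \<or> (s 0 = 1 \<and> s 1 = 0)" by linarith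
  moreover have "i = 0 \<or> i = 1 \<or> 2 \<le> i" for i :: nat by linarith
  ultimately show "s = id \<or> s = Transposition.transpose 0 1"
    using \<open>\<And>i. 2 \<le> i \<Longrightarrow> s i = i\<close>
    by (auto simp: fun_eq_iff Transposition.transpose_def) (metis One_nat_def)+
qed (auto simp: permutes_id intro: permutes_swap_id)

lemma permutes_three: "s permutes {..<3::nat} \<longleftrightarrow>
    (\<exists>b p. b < 3 \<and> p permutes {..<2} \<and> s = Transposition.transpose 2 b \<circ> p)"
proof -
  have 3: "{..<3} = insert 2 {..<2::nat}" by auto
  have "s \<in> {s. s permutes {..<3}} \<longleftrightarrow> s \<in> (\<lambda>(b, p). Transposition.transpose 2 b \<circ> p) ` {(b, p). b \<in> {..<3} \<and> p \<in> {p. p permutes {..<2}}}"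
    unfolding 3 permutes_insert by simp
  then show ?thesis by auto
qed

lemma permute_list_three: "permute_list s [x, y, z] = [[x, y, z] ! s 0, [x, y, z] ! s 1, [x, y, z] ! s 2]"
  by (simp add: permute_list_def upt_rec numeral_2_eq_2)

lemma permute_list_two: "permute_list s [x, y] = [[x, y] ! s 0, [x, y] ! s 1]"
  by (simp add: permute_list_def upt_rec)

text \<open>The orientation of a triangle: the even permutations of three vertices are the rotations.\<close>

definition cyc :: "'a \<Rightarrow> 'a \<Rightarrow> 'a \<Rightarrow> 'a list set" where
  "cyc x y z = {[x, y, z], [y, z, x], [z, x, y]}"

lemma orientation_one: "orientation [x] = {[x]}"
  by (simp add: orientation_def permutes_one permute_list_def)

lemma orientation_two: "orientation [x, y] = {[x, y]}"
  by (auto simp: orientation_def numeral_2_eq_2[symmetric] permutes_two evenperm_swap permute_list_two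
    intro: exI[of _ id])

lemma transpose_01_ne_id: "Transposition.transpose 0 (1::nat) \<noteq> id"
  by (metis id_apply transpose_apply_first zero_neq_one)

lemma evenperm_three:
  assumes p: "p permutes {..<2::nat}"
  shows "evenperm (Transposition.transpose 2 b \<circ> p) \<longleftrightarrow> (b = 2) = (p = id)"
proof -
  have "permutation p" using p permutation_permutes by blast
  then have "evenperm (Transposition.transpose 2 b \<circ> p) \<longleftrightarrow> evenperm (Transposition.transpose 2 b) = evenperm p"
    by (rule evenperm_comp[OF permutation_swap_id])
  moreover have "evenperm (Transposition.transpose 2 b) \<longleftrightarrow> b = 2" by (auto simp: evenperm_swap)
  moreover have "evenperm p \<longleftrightarrow> p = id"
    using p transpose_01_ne_id evenperm_swap[of 0 "1::nat"] unfolding permutes_two by auto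
  ultimately show ?thesis by simp
qed

lemma even_three: "s permutes {..<3} \<and> evenperm s \<longleftrightarrow> s \<in> {id, Transposition.transpose 2 0 \<circ> Transposition.transpose 0 1,
    Transposition.transpose 2 1 \<circ> Transposition.transpose 0 (1::nat)}"
proof
  assume s: "s permutes {..<3} \<and> evenperm s"
  then obtain b p where b: "b < 3" "p permutes {..<2}" "s = Transposition.transpose 2 b \<circ> p"
    using permutes_three by blast
  then have "(b = 2) = (p = id)" using evenperm_three s by blast
  moreover have "b = 0 \<or> b = 1 \<or> b = 2" using b by linarith
  ultimately show "s \<in> {id, Transposition.transpose 2 0 \<circ> Transposition.transpose 0 1, Transposition.transpose 2 1 \<circ> Transposition.transpose 0 1}"
    using b by (auto simp: permutes_two)
next
  have "Transposition.transpose 2 b \<circ> Transposition.transpose 0 1 permutes {..<3} \<and> evenperm (Transposition.transpose 2 b \<circ> Transposition.transpose 0 1)"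
    if "b < 2" for b :: nat
    using that transpose_01_ne_id evenperm_three[of "Transposition.transpose 0 1" b]
    unfolding permutes_three by (auto simp: permutes_two intro!: exI[of _ b])
  from this[of 0] this[of 1]
  show "s \<in> {id, Transposition.transpose 2 0 \<circ> Transposition.transpose 0 1, Transposition.transpose 2 1 \<circ> Transposition.transpose 0 1} \<Longrightarrow> s permutes {..<3} \<and> evenperm s"
    by (auto simp: permutes_id)
qed

lemma odd_three: "s permutes {..<3} \<and> \<not> evenperm s \<longleftrightarrow> s \<in> {Transposition.transpose 0 1, Transposition.transpose 2 0, Transposition.transpose 2 (1::nat)}"
proof
  assume s: "s permutes {..<3} \<and> \<not> evenperm s"
  then obtain b p where b: "b < 3" "p permutes {..<2}" "s = Transposition.transpose 2 b \<circ> p"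
    using permutes_three by blast
  then have "(b = 2) \<noteq> (p = id)" using evenperm_three s by blast
  moreover have "b = 0 \<or> b = 1 \<or> b = 2" using b by linarith
  ultimately show "s \<in> {Transposition.transpose 0 1, Transposition.transpose 2 0, Transposition.transpose 2 1}"
    using b by (auto simp: permutes_two)
qed (auto simp: evenperm_swap intro: permutes_swap_id)

lemma orientation_three: "orientation [x, y, z] = cyc x y z"
proof -
  have "orientation [x, y, z] = (\<lambda>s. permute_list s [x, y, z]) ` {s. s permutes {..<3} \<and> evenperm s}"
    by (auto simp: orientation_def numeral_3_eq_3)
  then show ?thesis
    unfolding even_three Collect_mem_eq image_insert image_empty by (simp add: permute_list_three cyc_def Transposition.transpose_def insert_commute)
qed

lemma opposite_two: "opposite {[x, y]} = {[y, x]}"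
proof -
  have "opposite {[x, y]} = (\<lambda>s. permute_list s [x, y]) ` {s. s permutes {..<2} \<and> \<not> evenperm s}"
    by (auto simp: opposite_def numeral_2_eq_2)
  also have "{s. s permutes {..<2::nat} \<and> \<not> evenperm s} = {Transposition.transpose 0 1}"
    by (auto simp: permutes_two evenperm_swap)
  finally show ?thesis by (simp add: permute_list_two)
qed

lemma opposite_cyc: "opposite (cyc x y z) = cyc y x z"
proof -
  have "opposite (cyc x y z) = (\<Union>ys\<in>cyc x y z. (\<lambda>s. permute_list s ys) ` {s. s permutes {..<length ys} \<and> \<not> evenperm s})"
    by (auto simp: opposite_def)
  also have "\<dots> = (\<Union>ys\<in>cyc x y z. (\<lambda>s. permute_list s ys) ` {s. s permutes {..<3} \<and> \<not> evenperm s})"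
    by (simp add: cyc_def numeral_3_eq_3)
  finally show ?thesis
    unfolding odd_three Collect_mem_eq image_insert image_empty by (auto simp: permute_list_three cyc_def Transposition.transpose_def)
qed

lemma cyc_rotate: "cyc x y z = cyc y z x"
  by (auto simp: cyc_def)

lemma cyc_eq:
  assumes "cyc x y z = cyc x y' z'" "x \<noteq> y" "x \<noteq> z"
  shows "y = y' \<and> z = z'"
proof -
  have "[x, y, z] \<in> cyc x y z" by (simp add: cyc_def)
  then have "[x, y, z] \<in> cyc x y' z'" by (simp only: assms(1))
  then show ?thesis using assms(2,3) by (auto simp: cyc_def)
qed

lemma underlying_simps: "underlying {[x]} = {x}" "underlying {[x, y]} = {x, y}" "underlying (cyc x y z) = {x, y, z}"
  by (auto simp: underlying_def cyc_def)

lemma extend_one: "x \<noteq> y \<Longrightarrow> extend_orientation {[x]} {x, y} = {[y, x]}"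
  by (auto simp: extend_orientation_def underlying_simps orientation_two)

lemma extend_two: "z \<noteq> x \<Longrightarrow> z \<noteq> y \<Longrightarrow> extend_orientation {[x, y]} {x, y, z} = cyc z x y"
proof -
  assume z: "z \<noteq> x" "z \<noteq> y"
  then have "{x, y, z} - {x, y} = {z}" by auto
  then show ?thesis by (simp add: extend_orientation_def underlying_simps orientation_three)
qed

context totally_ramified_extension
begin

lemma facets_one_iff: "{x, y} \<in> facets 1 \<longleftrightarrow> x \<noteq> y \<and> x \<in> vertices \<and> y \<in> vertices \<and> adjacent x y \<and> adjacent y x"
  by (auto simp: facets_def card_insert_if split: if_splits)

lemmas facets_one_iffs = facets_one_iff facets_one_iff[unfolded One_nat_def]

lemma facets_two_iff: "{x, y, z} \<in> facets 2 \<longleftrightarrow> x \<noteq> y \<and> x \<noteq> z \<and> y \<noteq> z \<and> x \<in> vertices \<and> y \<in> vertices \<and> z \<in> vertices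
    \<and> adjacent x y \<and> adjacent y x \<and> adjacent x z \<and> adjacent z x \<and> adjacent y z \<and> adjacent z y"
  by (auto simp: facets_def card_insert_if numeral_2_eq_2 split: if_splits)

lemma facets_zero_iff: "{x} \<in> facets 0 \<longleftrightarrow> x \<in> vertices"
  by (auto simp: facets_def)

lemma facets_oneE:
  assumes "F \<in> facets 1" "x \<in> F"
  obtains y where "F = {x, y}" "y \<noteq> x"
proof -
  have "card F = 2" using assms by (simp add: facets_def)
  then obtain a b where "F = {a, b}" "a \<noteq> b" by (meson card_2_iff)
  then show thesis using that assms(2) by (metis insert_commute insertE singletonD)
qed

lemma facets_twoE:
  assumes "F \<in> facets 2" "{x, y} \<subseteq> F" "x \<noteq> y"
  obtains z where "F = {x, y, z}" "z \<noteq> x" "z \<noteq> y"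
proof -
  have F: "card F = 3" "finite F" using assms by (auto simp: facets_def)
  have "card {x, y} = 2" using assms(3) by simp
  then have "card (F - {x, y}) = 1" using card_Diff_subset[of "{x, y}" F] F assms(2) by simp
  then obtain z where z: "F - {x, y} = {z}" by (meson card_1_singletonE)
  have "F = {x, y} \<union> (F - {x, y})" using assms(2) by (rule Diff_partition[symmetric])
  then have "F = {x, y, z}" unfolding z by (simp add: insert_commute)
  moreover have "z \<notin> {x, y}" using z by (metis DiffD2 singletonI)
  ultimately show thesis using that by simp
qed

lemma oriented_facets_zero: "c \<in> oriented_facets 0 \<longleftrightarrow> (\<exists>x. c = {[x]} \<and> x \<in> vertices)"
proof
  assume "c \<in> oriented_facets 0"
  then obtain ys where ys: "c = orientation ys" "distinct ys" "set ys \<in> facets 0" by (auto simp: oriented_facets_def)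
  then have "length ys = 1" using distinct_card[of ys] by (auto simp: facets_def)
  then obtain x where "ys = [x]" by (metis One_nat_def length_0_conv length_Suc_conv)
  then show "\<exists>x. c = {[x]} \<and> x \<in> vertices" using ys by (auto simp: orientation_one facets_zero_iff)
next
  assume "\<exists>x. c = {[x]} \<and> x \<in> vertices"
  then obtain x where x: "c = {[x]}" "x \<in> vertices" by blast
  then show "c \<in> oriented_facets 0"
    unfolding oriented_facets_def by (intro CollectI exI[of _ "[x]"]) (simp add: orientation_one facets_zero_iff)
qed

lemma oriented_facets_one: "c \<in> oriented_facets 1 \<longleftrightarrow> (\<exists>x y. c = {[x, y]} \<and> {x, y} \<in> facets 1)"
proof
  assume "c \<in> oriented_facets 1"
  then obtain ys where ys: "c = orientation ys" "distinct ys" "set ys \<in> facets 1" by (auto simp: oriented_facets_def)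
  then have "length ys = 2" using distinct_card[of ys] by (auto simp: facets_def)
  then obtain x y where "ys = [x, y]" by (auto simp: numeral_2_eq_2 length_Suc_conv)
  then show "\<exists>x y. c = {[x, y]} \<and> {x, y} \<in> facets 1" using ys by (auto simp: orientation_two)
next
  assume "\<exists>x y. c = {[x, y]} \<and> {x, y} \<in> facets 1"
  then obtain x y where xy: "c = {[x, y]}" "{x, y} \<in> facets 1" by blast
  then have "x \<noteq> y" by (simp add: facets_one_iffs)
  then show "c \<in> oriented_facets 1"
    unfolding oriented_facets_def using xy by (intro CollectI exI[of _ "[x, y]"]) (simp add: orientation_two)
qed

lemma oriented_facets_two: "c \<in> oriented_facets 2 \<longleftrightarrow> (\<exists>x y z. c = cyc x y z \<and> {x, y, z} \<in> facets 2)"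
proof
  assume "c \<in> oriented_facets 2"
  then obtain ys where ys: "c = orientation ys" "distinct ys" "set ys \<in> facets 2" by (auto simp: oriented_facets_def)
  then have "length ys = 3" using distinct_card[of ys] by (auto simp: facets_def)
  then obtain x y z where "ys = [x, y, z]" by (auto simp: numeral_3_eq_3 length_Suc_conv)
  then show "\<exists>x y z. c = cyc x y z \<and> {x, y, z} \<in> facets 2" using ys by (auto simp: orientation_three)
next
  assume "\<exists>x y z. c = cyc x y z \<and> {x, y, z} \<in> facets 2"
  then obtain x y z where xy: "c = cyc x y z" "{x, y, z} \<in> facets 2" by blast
  then have "distinct [x, y, z]" by (simp add: facets_two_iff)
  then show "c \<in> oriented_facets 2"
    unfolding oriented_facets_def using xy by (intro CollectI exI[of _ "[x, y, z]"]) (simp add: orientation_three)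
qed

text \<open>The oriented edge \<open>[y, x]\<close> has target \<open>x\<close>, whence the order of the vertices.\<close>

lemma boundary_vertex:
  assumes "x \<in> vertices"
  shows "boundary 0 \<alpha> {[x]} = (\<Sum>y | {x, y} \<in> facets 1. \<alpha> {[y, x]})"
proof -
  have "boundary 0 \<alpha> {[x]} = (\<Sum>F | F \<in> facets 1 \<and> {x} \<subseteq> F. \<alpha> (extend_orientation {[x]} F))"
    using assms by (auto simp: boundary_def oriented_facets_zero underlying_simps)
  also have "{F. F \<in> facets 1 \<and> {x} \<subseteq> F} = (\<lambda>y. {x, y}) ` {y. {x, y} \<in> facets 1}"
  proof (rule subset_antisym; rule subsetI)
    fix F assume F: "F \<in> {F. F \<in> facets 1 \<and> {x} \<subseteq> F}"
    then have "F \<in> facets 1" "x \<in> F" by simp_all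
    then obtain y where y: "F = {x, y}" by (rule facets_oneE)
    then have "{x, y} \<in> facets 1" using F by simp
    then show "F \<in> (\<lambda>y. {x, y}) ` {y. {x, y} \<in> facets 1}" unfolding y by (rule imageI[OF CollectI])
  qed auto
  also have "(\<Sum>F\<in>(\<lambda>y. {x, y}) ` {y. {x, y} \<in> facets 1}. \<alpha> (extend_orientation {[x]} F))
      = (\<Sum>y | {x, y} \<in> facets 1. \<alpha> (extend_orientation {[x]} {x, y}))"
    by (subst sum.reindex) (auto simp: inj_on_def doubleton_eq_iff)
  also have "\<dots> = (\<Sum>y | {x, y} \<in> facets 1. \<alpha> {[y, x]})"
    by (intro sum.cong refl) (auto simp: extend_one facets_one_iffs)
  finally show ?thesis .
qed

lemma boundary_edge:
  assumes "{x, y} \<in> facets 1"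
  shows "boundary 1 \<alpha> {[x, y]} = (\<Sum>z | {x, y, z} \<in> facets 2. \<alpha> (cyc z x y))"
proof -
  have xy: "x \<noteq> y" using assms by (simp add: facets_one_iffs)
  have "boundary 1 \<alpha> {[x, y]} = (\<Sum>F | F \<in> facets 2 \<and> {x, y} \<subseteq> F. \<alpha> (extend_orientation {[x, y]} F))"
    using assms by (auto simp: boundary_def oriented_facets_one[unfolded One_nat_def] underlying_simps numeral_2_eq_2)
  also have "{F. F \<in> facets 2 \<and> {x, y} \<subseteq> F} = (\<lambda>z. {x, y, z}) ` {z. {x, y, z} \<in> facets 2}"
  proof (rule subset_antisym; rule subsetI)
    fix F assume F: "F \<in> {F. F \<in> facets 2 \<and> {x, y} \<subseteq> F}"
    then have "F \<in> facets 2" "{x, y} \<subseteq> F" by simp_all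
    then obtain z where z: "F = {x, y, z}" using xy by (rule facets_twoE)
    then have "{x, y, z} \<in> facets 2" using F by simp
    then show "F \<in> (\<lambda>z. {x, y, z}) ` {z. {x, y, z} \<in> facets 2}" unfolding z by (rule imageI[OF CollectI])
  qed auto
  also have "(\<Sum>F\<in>(\<lambda>z. {x, y, z}) ` {z. {x, y, z} \<in> facets 2}. \<alpha> (extend_orientation {[x, y]} F))
      = (\<Sum>z | {x, y, z} \<in> facets 2. \<alpha> (extend_orientation {[x, y]} {x, y, z}))"
    by (subst sum.reindex) (auto simp: inj_on_def facets_two_iff)
  also have "\<dots> = (\<Sum>z | {x, y, z} \<in> facets 2. \<alpha> (cyc z x y))"
    by (intro sum.cong refl arg_cong[of _ _ \<alpha>] extend_two) (auto simp: facets_two_iff)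
  finally show ?thesis .
qed

lemma finite_edges_at: "x \<in> vertices \<Longrightarrow> finite {y. {x, y} \<in> facets 1}"
  by (rule finite_subset[OF _ finite_neighbours[of x]]) (auto simp: facets_one_iffs)

lemma finite_chambers_at: "x \<in> vertices \<Longrightarrow> finite {z. {x, y, z} \<in> facets 2}"
  by (rule finite_subset[OF _ finite_neighbours[of x]]) (auto simp: facets_two_iff)

section \<open>The regions C and Star\<close>

lemma GLO_lattice: "lattice_of (mat 1 ** dg S) = {b. integral_vector b \<and> (\<forall>i\<in>S. b $ i \<in> \<mm>)}"
  unfolding lattice_GLO_dg by simp

lemma v\<^sub>1_eq: "v\<^sub>1 = line_of (mat 1)"
proof -
  have "{vector [a, b, \<pi> * c] | a b c. a \<in> \<O> \<and> b \<in> \<O> \<and> c \<in> \<O>} = lattice_of (mat 1 ** dg {3})"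
  proof (rule subset_antisym; rule subsetI)
    fix u assume "u \<in> lattice_of (mat 1 ** dg {3})"
    then have "u = vector [u $ 1, u $ 2, \<pi> * (u $ 3 / \<pi>)]" "u $ 1 \<in> \<O>" "u $ 2 \<in> \<O>" "u $ 3 / \<pi> \<in> \<O>"
      unfolding GLO_lattice by (auto simp: vec_eq_iff forall_3 m_iff_pi)
    then show "u \<in> {vector [a, b, \<pi> * c] | a b c. a \<in> \<O> \<and> b \<in> \<O> \<and> c \<in> \<O>}" by blast
  qed (auto simp: GLO_lattice[unfolded matrix_mul_lid] forall_3)
  then show ?thesis by (simp add: v\<^sub>1_def vert_def)
qed

lemma v\<^sub>2_eq: "v\<^sub>2 = point_of (mat 1)"
proof -
  have "{vector [a, \<pi> * b, \<pi> * c] | a b c. a \<in> \<O> \<and> b \<in> \<O> \<and> c \<in> \<O>} = lattice_of (mat 1 ** dg {2, 3})"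
  proof (rule subset_antisym; rule subsetI)
    fix u assume "u \<in> lattice_of (mat 1 ** dg {2, 3})"
    then have "u = vector [u $ 1, \<pi> * (u $ 2 / \<pi>), \<pi> * (u $ 3 / \<pi>)]" "u $ 1 \<in> \<O>" "u $ 2 / \<pi> \<in> \<O>" "u $ 3 / \<pi> \<in> \<O>"
      unfolding GLO_lattice by (auto simp: vec_eq_iff forall_3 m_iff_pi)
    then show "u \<in> {vector [a, \<pi> * b, \<pi> * c] | a b c. a \<in> \<O> \<and> b \<in> \<O> \<and> c \<in> \<O>}" by blast
  qed (auto simp: GLO_lattice[unfolded matrix_mul_lid] forall_3)
  then show ?thesis by (simp add: v\<^sub>2_def vert_def)
qed

lemma C_facet: "C \<in> facets 2"
  using chamber_of_facet[OF GLO_1] by (simp only: C_def v\<^sub>1_eq v\<^sub>2_eq)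

lemma Star_iff: "x \<in> Star v\<^sub>0 \<longleftrightarrow> (\<exists>F\<in>facets 2. v\<^sub>0 \<in> F \<and> x \<in> F)"
  by (auto simp: Star_def)

lemma C_subset_Star: "C \<subseteq> Star v\<^sub>0"
proof
  fix x assume "x \<in> C"
  moreover have "v\<^sub>0 \<in> C" by (simp add: C_def)
  ultimately show "x \<in> Star v\<^sub>0" unfolding Star_iff using C_facet by blast
qed

lemma Star_vertices: "Star v\<^sub>0 \<subseteq> vertices"
  by (auto simp: Star_iff facets_def)

lemma Star_adjacent: "x \<in> Star v\<^sub>0 \<Longrightarrow> x \<noteq> v\<^sub>0 \<Longrightarrow> adjacent v\<^sub>0 x \<and> adjacent x v\<^sub>0 \<and> x \<in> vertices \<and> v\<^sub>0 \<in> vertices"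
  by (auto simp: Star_iff facets_def)

lemma edge_in_Star:
  assumes "{x, y} \<in> facets 1" "x \<in> Star v\<^sub>0" "y \<in> Star v\<^sub>0" "x \<noteq> v\<^sub>0" "y \<noteq> v\<^sub>0"
  shows "{v\<^sub>0, x, y} \<in> facets 2"
  using assms Star_adjacent[of x] Star_adjacent[of y] unfolding facets_two_iff facets_one_iffs by auto

text \<open>The edges of the link of \<open>v\<^sub>0\<close> are the flags of the projective plane.\<close>

lemma link_edge:
  assumes "{v\<^sub>0, x, y} \<in> facets 2"
  obtains k where "k \<in> GLO" "{x, y} = {line_of k, point_of k}"
proof -
  obtain k where k: "k \<in> GLO" "{v\<^sub>0, x, y} = {v\<^sub>0, line_of k, point_of k}"
    using chamber_at_v\<^sub>0[OF assms] by blast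
  have "{x, y} = {v\<^sub>0, x, y} - {v\<^sub>0}" using assms unfolding facets_two_iff by auto
  also have "\<dots> = {line_of k, point_of k}" unfolding k(2) using vertex_types(2,3)[OF k(1) k(1)] by auto
  finally show thesis by (rule that[OF k(1)])
qed

lemma finite_Star: "finite (Star v\<^sub>0)"
proof -
  have "v\<^sub>0 \<in> vertices" using C_facet by (simp add: C_def facets_def)
  then have "finite (insert v\<^sub>0 {y \<in> vertices. adjacent v\<^sub>0 y})" using finite_neighbours by blast
  then show ?thesis by (rule rev_finite_subset) (use Star_adjacent in blast)
qed

lemma act_mult: "act g (act h x) = act (g ** h) x"
  by (simp add: act_def image_image matrix_vector_mul_assoc)

lemma act_1: "act (mat 1) x = x"
  by (simp add: act_def)

lemma act_inverse:
  assumes "det g = 1"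
  shows "act (matrix_inv g) (act g x) = x" "act g (act (matrix_inv g) x) = x"
  using assms by (simp_all add: act_mult matrix_inv_left' matrix_inv_right' act_1)

lemma adjacent_act: "det g = 1 \<Longrightarrow> adjacent x y \<Longrightarrow> adjacent (act g x) (act g y)"
proof -
  assume g: "det g = 1" and adj: "adjacent x y"
  then obtain L\<^sub>1 L\<^sub>2 where L: "x \<noteq> y" "L\<^sub>1 \<in> x" "L\<^sub>2 \<in> y" "L\<^sub>2 \<subseteq> L\<^sub>1" "(\<lambda>u. \<pi> *s u) ` L\<^sub>1 \<subseteq> L\<^sub>2"
    by (auto simp: adjacent_def)
  have "act g x \<noteq> act g y" using L(1) act_inverse(1)[OF g] by metis
  moreover have "(\<lambda>u. g *v u) ` L\<^sub>1 \<in> act g x" "(\<lambda>u. g *v u) ` L\<^sub>2 \<in> act g y" using L by (auto simp: act_def)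
  moreover have "(\<lambda>u. g *v u) ` L\<^sub>2 \<subseteq> (\<lambda>u. g *v u) ` L\<^sub>1" using L by blast
  moreover have "(\<lambda>u. \<pi> *s u) ` (\<lambda>u. g *v u) ` L\<^sub>1 = (\<lambda>u. g *v u) ` (\<lambda>u. \<pi> *s u) ` L\<^sub>1"
    by (simp add: image_image vector_scalar_commute)
  then have "(\<lambda>u. \<pi> *s u) ` (\<lambda>u. g *v u) ` L\<^sub>1 \<subseteq> (\<lambda>u. g *v u) ` L\<^sub>2" using L(5) by auto
  ultimately show ?thesis unfolding adjacent_def by blast
qed

lemma vertices_act: "det g = 1 \<Longrightarrow> x \<in> vertices \<Longrightarrow> act g x \<in> vertices"
proof -
  assume g: "det g = 1" and "x \<in> vertices"
  then obtain A where "x = vert A" "det A \<noteq> 0" by (auto simp: vertices_alt)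
  then have "act g x = vert (g ** A)" "det (g ** A) \<noteq> 0" using g by (simp_all add: act_vert det_mul)
  then show "act g x \<in> vertices" unfolding vertices_alt by blast
qed

lemma facet_act: "det g = 1 \<Longrightarrow> {x, y, z} \<in> facets 2 \<Longrightarrow> {act g x, act g y, act g z} \<in> facets 2"
  unfolding facets_two_iff using adjacent_act vertices_act by (auto simp: adjacent_def)

lemma I_fixes_C: "g \<in> I \<Longrightarrow> act g v\<^sub>0 = v\<^sub>0 \<and> act g v\<^sub>1 = v\<^sub>1 \<and> act g v\<^sub>2 = v\<^sub>2"
proof -
  assume g: "g \<in> I"
  have d: "det g = 1" using g by (simp add: I_iff)
  have m1: "matrix_inv (mat 1) = (mat 1 :: 'K ^ 3 ^ 3)" by (rule matrix_inv_unique) simp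
  have "act g (vert (mat 1 ** dg S)) = vert (mat 1 ** dg S)" if "S = {} \<or> S = {3} \<or> S = {2, 3}" for S
  proof -
    have gO: "g $ i $ j \<in> \<O>" for i j using g by (simp add: I_iff integral_nth)
    have low: "g $ 2 $ 1 / \<pi> \<in> \<O>" "g $ 3 $ 1 / \<pi> \<in> \<O>" "g $ 3 $ 2 / \<pi> \<in> \<O>"
      using g by (simp_all add: I_iff flip: m_iff_pi)
    have "integral_matrix (matrix_inv (dg S) ** g ** dg S)"
      using that unfolding integral_matrix_def forall_3 conj_dg_nth
      by (elim disjE) (simp_all add: gO low)
    then show ?thesis using fixes_vert_iff[of "mat 1 ** dg S" g] d by simp
  qed
  from this[of "{}"] this[of "{3}"] this[of "{2, 3}"] show ?thesis
    by (simp add: v\<^sub>0_eq[OF GLO_1] v\<^sub>1_eq v\<^sub>2_eq dg_empty)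
qed

lemma invariant_C: "invariant_region C"
  using C_facet I_fixes_C by (auto simp: invariant_region_def facets_def C_def)

lemma invariant_Star: "invariant_region (Star v\<^sub>0)"
proof -
  have sub: "act g x \<in> Star v\<^sub>0" if g: "g \<in> I" and x: "x \<in> Star v\<^sub>0" for g x
  proof (cases "x = v\<^sub>0")
    case True
    then show ?thesis using I_fixes_C[OF g] x by simp
  next
    case False
    obtain F where F: "F \<in> facets 2" "v\<^sub>0 \<in> F" "x \<in> F" using x by (auto simp: Star_iff)
    then have "{v\<^sub>0, x} \<subseteq> F" by simp
    with F(1) obtain z where z: "F = {v\<^sub>0, x, z}" by (rule facets_twoE) (use False in simp)
    have "det g = 1" using g by (simp add: I_iff)
    from facet_act[OF this F(1)[unfolded z]] have "{v\<^sub>0, act g x, act g z} \<in> facets 2"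
      using I_fixes_C[OF g] by simp
    then show ?thesis unfolding Star_iff by (rule bexI[rotated]) simp
  qed
  have "act g ` Star v\<^sub>0 = Star v\<^sub>0" if g: "g \<in> I" for g
  proof
    show "act g ` Star v\<^sub>0 \<subseteq> Star v\<^sub>0" using sub[OF g] by (rule image_subsetI)
    show "Star v\<^sub>0 \<subseteq> act g ` Star v\<^sub>0"
    proof
      fix x assume "x \<in> Star v\<^sub>0"
      then have "act (matrix_inv g) x \<in> Star v\<^sub>0" by (rule sub[OF I_inv[OF g]])
      moreover have "x = act g (act (matrix_inv g) x)" using act_inverse(2)[of g x] g by (simp add: I_iff)
      ultimately show "x \<in> act g ` Star v\<^sub>0" by (rule rev_image_eqI)
    qed
  qed
  then show ?thesis using Star_vertices by (simp add: invariant_region_def)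
qed

end

section \<open>Values on cosets\<close>

lemma ball_point: "(\<forall>i\<in>{2, 3 :: 3}. \<forall>j\<in>- {2, 3 :: 3}. P i j) \<longleftrightarrow> P 2 1 \<and> P 3 1"
proof -
  have "x \<in> - {2, 3} \<longleftrightarrow> x \<in> {1}" for x :: 3 using exhaust_3[of x] by auto
  then have "- {2, 3} = {1 :: 3}" unfolding set_eq_iff by (intro allI)
  then show ?thesis by simp
qed

lemma ball_line: "(\<forall>i\<in>{3 :: 3}. \<forall>j\<in>- {3 :: 3}. P i j) \<longleftrightarrow> P 3 1 \<and> P 3 2"
proof -
  have "x \<in> - {3} \<longleftrightarrow> x \<in> {1, 2}" for x :: 3 using exhaust_3[of x] by auto
  then have "- {3} = {1, 2 :: 3}" unfolding set_eq_iff by (intro allI)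
  then show ?thesis by simp
qed

context totally_ramified_extension
begin

lemma l_coset_SL3: "l_coset SL3 g S = (\<lambda>s. g ** s) ` S"
  by (auto simp: l_coset_def)

lemma l_coset_mult: "l_coset SL3 g (l_coset SL3 h S) = l_coset SL3 (g ** h) S"
  by (simp add: l_coset_SL3 image_image matrix_mul_assoc)

lemma l_coset_one: "l_coset SL3 (mat 1) S = S"
  by (simp add: l_coset_SL3)

lemma coset_absorb: "i \<in> I \<Longrightarrow> l_coset SL3 i I = I"
proof
  assume i: "i \<in> I"
  show "l_coset SL3 i I \<subseteq> I" using I_mult[OF i] by (auto simp: l_coset_SL3)
  show "I \<subseteq> l_coset SL3 i I"
  proof
    fix x assume "x \<in> I"
    then have "matrix_inv i ** x \<in> I" using I_inv[OF i] I_mult by simp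
    moreover have "x = i ** (matrix_inv i ** x)"
      using matrix_cancel[OF matrix_inv_right'[of i]] i by (simp add: I_iff)
    ultimately show "x \<in> l_coset SL3 i I" unfolding l_coset_SL3 by (rule rev_image_eqI)
  qed
qed

text \<open>An element of the permutation module as a function on the group that is invariant under \<open>I\<close> from
  the right. Being a function on matrices rather than on cosets, it can be evaluated without choosing
  representatives.\<close>

definition coset_value :: "(('K ^ 3 ^ 3) set \<Rightarrow>\<^sub>0 'k::field) \<Rightarrow> 'K ^ 3 ^ 3 \<Rightarrow> 'k" where
  "coset_value z h = Poly_Mapping.lookup z (l_coset SL3 h I)"

definition fixed_by :: "'K ^ 3 ^ 3 \<Rightarrow> (('K ^ 3 ^ 3) set \<Rightarrow>\<^sub>0 'k::field) \<Rightarrow> bool" where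
  "fixed_by g z \<longleftrightarrow> (\<forall>h. det h = 1 \<longrightarrow> coset_value z (g ** h) = coset_value z h)"

lemma coset_value_right: "i \<in> I \<Longrightarrow> coset_value z (h ** i) = coset_value z h"
  by (simp add: coset_value_def coset_absorb flip: l_coset_mult)

lemma coset_value_simps:
  "coset_value 0 h = 0" "coset_value (- z) h = - coset_value z h"
  "coset_value (z - z') h = coset_value z h - coset_value z' h"
  "coset_value (\<Sum>a\<in>A. F a) h = (\<Sum>a\<in>A. coset_value (F a) h)"
  by (simp_all add: coset_value_def lookup_minus lookup_sum)

lemma lookup_translate:
  assumes g: "det g = 1"
  shows "Poly_Mapping.lookup (translate g z) S = Poly_Mapping.lookup z (l_coset SL3 (matrix_inv g) S)"
proof -
  have "inj (l_coset SL3 (matrix_inv g))"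
  proof (rule injI)
    fix S T assume "l_coset SL3 (matrix_inv g) S = l_coset SL3 (matrix_inv g) T"
    then have "l_coset SL3 g (l_coset SL3 (matrix_inv g) S) = l_coset SL3 g (l_coset SL3 (matrix_inv g) T)" by simp
    then show "S = T" using g by (simp add: l_coset_mult matrix_inv_right' l_coset_one)
  qed
  then show ?thesis unfolding translate_def inv_SL3[OF g] by (simp add: Poly_Mapping.map_key.rep_eq)
qed

lemma lcosets_SL3: "S \<in> lcosets\<^bsub>SL3\<^esub> I \<longleftrightarrow> (\<exists>h. det h = 1 \<and> S = l_coset SL3 h I)"
  by (auto simp: LCOSETS_def)

lemma translate_fixed_iff:
  assumes g: "det g = 1" and z: "z \<in> perm_module"
  shows "translate g z = z \<longleftrightarrow> fixed_by g z"
proof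
  assume t: "translate g z = z"
  show "fixed_by g z"
    unfolding fixed_by_def
  proof (intro allI impI)
    fix h :: "'K ^ 3 ^ 3" assume "det h = 1"
    have "coset_value z (g ** h) = Poly_Mapping.lookup (translate g z) (l_coset SL3 (g ** h) I)"
      by (simp add: coset_value_def t)
    also have "\<dots> = coset_value z (matrix_inv g ** (g ** h))"
      by (simp add: lookup_translate[OF g] l_coset_mult coset_value_def)
    also have "matrix_inv g ** (g ** h) = h" by (rule matrix_cancel[OF matrix_inv_left']) (simp add: g)
    finally show "coset_value z (g ** h) = coset_value z h" .
  qed
next
  assume f: "fixed_by g z"
  have keys: "Poly_Mapping.lookup z S = 0" if "S \<notin> lcosets\<^bsub>SL3\<^esub> I" for S
  proof -
    have "Poly_Mapping.keys z \<subseteq> lcosets\<^bsub>SL3\<^esub> I" using z by (simp add: perm_module_def)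
    then have "S \<notin> Poly_Mapping.keys z" using that by (rule contra_subsetD)
    then show ?thesis by (simp add: in_keys_iff)
  qed
  show "translate g z = z"
  proof (rule poly_mapping_eqI)
    fix S
    show "Poly_Mapping.lookup (translate g z) S = Poly_Mapping.lookup z S"
    proof (cases "S \<in> lcosets\<^bsub>SL3\<^esub> I")
      case True
      then obtain h where h: "det h = 1" "S = l_coset SL3 h I" by (auto simp: lcosets_SL3)
      have d: "det (matrix_inv g ** h) = 1" using g h by (simp add: det_mul det_matrix_inv)
      have "coset_value z (g ** (matrix_inv g ** h)) = coset_value z (matrix_inv g ** h)"
        using f d unfolding fixed_by_def by blast
      moreover have "g ** (matrix_inv g ** h) = h" by (rule matrix_cancel[OF matrix_inv_right']) (simp add: g)
      ultimately show ?thesis by (simp add: lookup_translate[OF g] h(2) l_coset_mult coset_value_def)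
    next
      case False
      have "l_coset SL3 (matrix_inv g) S \<notin> lcosets\<^bsub>SL3\<^esub> I"
      proof
        assume "l_coset SL3 (matrix_inv g) S \<in> lcosets\<^bsub>SL3\<^esub> I"
        then obtain h where h: "det h = 1" "l_coset SL3 (matrix_inv g) S = l_coset SL3 h I" by (auto simp: lcosets_SL3)
        have "S = l_coset SL3 g (l_coset SL3 (matrix_inv g) S)"
          using g by (simp add: l_coset_mult matrix_inv_right' l_coset_one)
        also have "\<dots> = l_coset SL3 (g ** h) I" by (simp only: h(2) l_coset_mult)
        finally have "S \<in> lcosets\<^bsub>SL3\<^esub> I" using g h(1) unfolding lcosets_SL3 by (intro exI[of _ "g ** h"]) (simp add: det_mul)
        then show False using False by simp
      qed
      then show ?thesis using keys False by (simp add: lookup_translate[OF g])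
    qed
  qed
qed

lemma fixed_by_mult: "det g\<^sub>2 = 1 \<Longrightarrow> fixed_by g\<^sub>1 z \<Longrightarrow> fixed_by g\<^sub>2 z \<Longrightarrow> fixed_by (g\<^sub>1 ** g\<^sub>2) z"
  unfolding fixed_by_def by (simp add: det_mul flip: matrix_mul_assoc)

lemma fixed_by_simps:
  "fixed_by g 0" "fixed_by g z \<Longrightarrow> fixed_by g (- z)"
  "fixed_by g z \<Longrightarrow> fixed_by g z' \<Longrightarrow> fixed_by g (z - z')"
  "(\<And>a. a \<in> A \<Longrightarrow> fixed_by g (F a)) \<Longrightarrow> fixed_by g (\<Sum>a\<in>A. F a)"
  by (simp_all add: fixed_by_def coset_value_simps)

lemma perm_module_simps:
  "(0 :: ('K ^ 3 ^ 3) set \<Rightarrow>\<^sub>0 'k::field) \<in> perm_module"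
  "z \<in> perm_module \<Longrightarrow> - z \<in> perm_module"
  "z \<in> perm_module \<Longrightarrow> z' \<in> perm_module \<Longrightarrow> z - z' \<in> perm_module"
  "(\<And>a. a \<in> A \<Longrightarrow> F a \<in> perm_module) \<Longrightarrow> (\<Sum>a\<in>A. F a) \<in> perm_module"
  for z z' :: "('K ^ 3 ^ 3) set \<Rightarrow>\<^sub>0 'k::field"
  unfolding perm_module_def using keys_diff[of z z'] keys_sum[of F A] by auto blast+

section \<open>Flags on which values can move\<close>

text \<open>The congruences say that the change of basis from \<open>\<kappa>\<close> to \<open>k\<close> preserves the sublattice scaled by
  \<open>dg S\<close>.\<close>

lemma vert_dg_eqI: "(\<forall>i\<in>S. \<forall>j\<in>- S. (matrix_inv \<kappa> ** k) $ i $ j \<in> \<mm>) \<Longrightarrow> k \<in> GLO \<Longrightarrow> \<kappa> \<in> GLO \<Longrightarrow> vert (k ** dg S) = vert (\<kappa> ** dg S)"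
proof -
  assume m: "\<forall>i\<in>S. \<forall>j\<in>- S. (matrix_inv \<kappa> ** k) $ i $ j \<in> \<mm>" and k: "k \<in> GLO" and \<kappa>: "\<kappa> \<in> GLO"
  define u where "u = matrix_inv \<kappa> ** k"
  have u: "u \<in> GLO" unfolding u_def using GLO_mult[OF GLO_inv[OF \<kappa>] k] .
  have uO: "u $ i $ j \<in> \<O>" for i j using u by (simp add: GLO_integral integral_nth)
  define w where "w = matrix_inv (dg S) ** u ** dg S"
  have um: "u $ i $ j / \<pi> \<in> \<O>" if "i \<in> S" "j \<notin> S" for i j
    using m that unfolding u_def[symmetric] by (simp flip: m_iff_pi)
  have "integral_matrix w"
    unfolding w_def integral_matrix_def conj_dg_nth using um uO by simp
  moreover have "det w = det u" by (simp add: w_def det_mul det_matrix_inv)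
  ultimately have w: "w \<in> GLO" using u by (simp add: GLO_def)
  have "\<kappa> ** dg S ** w = \<kappa> ** (dg S ** (matrix_inv (dg S) ** (u ** dg S)))" by (simp only: w_def matrix_mul_assoc)
  also have "\<dots> = \<kappa> ** (matrix_inv \<kappa> ** (k ** dg S))"
    by (simp only: matrix_cancel[OF matrix_inv_right'[OF det_dg]]) (simp only: u_def matrix_mul_assoc)
  also have "\<dots> = k ** dg S" by (simp only: matrix_cancel[OF GLO_inverse_mult(1)[OF \<kappa>]])
  finally show ?thesis using vert_GLO[OF v_det_line_point(4)[OF \<kappa>] w, of S] by simp
qed

lemma vert_dg_eqD:
  assumes eq: "vert (k ** dg S) = vert (\<kappa> ** dg S)" and k: "k \<in> GLO" and \<kappa>: "\<kappa> \<in> GLO"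
    and i: "i \<in> S" and j: "j \<notin> S"
  shows "(matrix_inv \<kappa> ** k) $ i $ j \<in> \<mm>"
proof -
  obtain c l where c: "c \<noteq> 0" and l: "l \<in> GLO" and e: "k ** dg S = mat c ** (\<kappa> ** dg S) ** l"
    using vert_eq_iff[OF v_det_line_point(4)[OF \<kappa>] v_det_line_point(4)[OF k]] eq by metis
  have "det k * det (dg S) = c ^ 3 * (det \<kappa> * det (dg S)) * det l"
    using arg_cong[OF e, of det] by (simp add: det_mul det_mat3)
  then have "det k = c ^ 3 * det \<kappa> * det l" by simp
  then have "v (det k) = v (c ^ 3 * det \<kappa> * det l)" by simp
  also have "\<dots> = 3 * v c"
    using c GLO_det_nz[OF \<kappa>] GLO_det_nz[OF l] by (simp add: v_mult v_det_GLO \<kappa> l power3_eq_cube)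
  finally have "v c = 0" using v_det_GLO[OF k] by simp
  then have cO: "c \<in> \<O>" by (simp add: in_O_iff)
  have "matrix_inv (dg S) ** (matrix_inv \<kappa> ** k) ** dg S = matrix_inv (dg S) ** (matrix_inv \<kappa> ** (k ** dg S))"
    by (simp only: matrix_mul_assoc)
  also have "\<dots> = (matrix_inv (dg S) ** matrix_inv \<kappa> ** mat c) ** (\<kappa> ** (dg S ** l))" by (simp only: e matrix_mul_assoc)
  also have "matrix_inv (dg S) ** matrix_inv \<kappa> ** mat c = mat c ** (matrix_inv (dg S) ** matrix_inv \<kappa>)" by (rule mat_commute)
  also have "mat c ** (matrix_inv (dg S) ** matrix_inv \<kappa>) ** (\<kappa> ** (dg S ** l))
      = mat c ** (matrix_inv (dg S) ** (matrix_inv \<kappa> ** (\<kappa> ** (dg S ** l))))" by (simp only: matrix_mul_assoc)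
  also have "\<dots> = mat c ** l"
    by (simp only: matrix_cancel[OF GLO_inverse_mult(2)[OF \<kappa>]] matrix_cancel[OF matrix_inv_left'[OF det_dg]])
  finally have "integral_matrix (matrix_inv (dg S) ** (matrix_inv \<kappa> ** k) ** dg S)"
    using integral_mat_mult[OF cO GLO_integral[OF l]] by simp
  from integral_nth[OF this, of i j] show ?thesis using i j by (simp add: conj_dg_nth m_iff_pi)
qed

lemma unipotent_conj_\<Gamma>:
  assumes "\<kappa> \<in> GLO" "i \<noteq> j" "s \<in> \<O>"
  shows "\<kappa> ** (mat 1 + elem i j (\<pi> * s)) ** matrix_inv \<kappa> \<in> \<Gamma>"
proof -
  have "det (mat 1 + elem i j (\<pi> * s)) = 1" by (rule square_zero_det) (rule elem_square[OF assms(2)])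
  then have "mat 1 + elem i j (\<pi> * s) \<in> \<Gamma>" using assms(3) by (simp add: \<Gamma>_def small_matrix_def elem_def)
  from \<Gamma>_conj[OF GLO_inv[OF assms(1)] this] show ?thesis by (simp add: GLO_matrix_inv_inv assms)
qed

text \<open>Suppose that the product is a unit. The group of the edge contains all elements of \<open>\<Gamma>\<close> for which the
  lower left entry in the basis \<open>k\<close> vanishes modulo \<open>\<pi>\<^sup>2\<close>. For suitable \<open>s\<close>, dividing \<open>g\<close> from the right by
  the conjugate \<open>e\<close> of \<open>1 + elem i j (\<pi> s)\<close> by \<open>\<kappa>\<close> achieves this, because modulo \<open>\<pi>\<^sup>2\<close> the
  entry of \<open>e\<close> in question is \<open>\<pi> s\<close> times the product. So \<open>g = a e\<close>, where \<open>a\<close> fixes \<open>z\<close> and \<open>e\<close> preserves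
  the coset \<open>h I\<close>, and \<open>z\<close> takes the same value at \<open>g h\<close> and at \<open>h\<close>.\<close>

lemma moving_forces_small:
  assumes k: "k \<in> GLO" and \<kappa>: "\<kappa> \<in> GLO" and h: "det h = 1"
    and stab: "\<And>i j s. rk i < rk j \<Longrightarrow> s \<in> \<O> \<Longrightarrow>
       matrix_inv h ** (\<kappa> ** (mat 1 + elem i j (\<pi> * s)) ** matrix_inv \<kappa>) ** h \<in> I"
    and fixed: "\<And>g. g \<in> I\<^sub>F {line_of k, point_of k} \<Longrightarrow> fixed_by g z"
    and g: "g \<in> \<Gamma>" and moved: "coset_value z (g ** h) \<noteq> coset_value z h" and ij: "rk i < rk j"
  shows "(matrix_inv k ** \<kappa>) $ 3 $ i * (matrix_inv \<kappa> ** k) $ j $ 1 \<in> \<mm>"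
proof (rule ccontr)
  let ?w = "matrix_inv k ** \<kappa>" and ?u = "matrix_inv \<kappa> ** k"
  assume unit: "?w $ 3 $ i * ?u $ j $ 1 \<notin> \<mm>"
  have wG: "?w \<in> GLO" "?u \<in> GLO" using GLO_mult GLO_inv k \<kappa> by blast+
  have wO: "?w $ a $ b \<in> \<O>" "?u $ a $ b \<in> \<O>" for a b using wG by (simp_all add: GLO_integral integral_nth)
  define q where "q = ?w $ 3 $ i * ?u $ j $ 1"
  have q: "q \<noteq> 0" "inverse q \<in> \<O>" using unit_inverse[of q] unit wO by (simp_all add: q_def)
  have ne: "i \<noteq> j" using ij by auto
  define G where "G = matrix_inv k ** g ** k"
  have G: "G \<in> \<Gamma>" unfolding G_def by (rule \<Gamma>_conj[OF k g])
  have small: "(G - mat 1) $ a $ b \<in> \<mm>" for a b using G unfolding \<Gamma>_def small_matrix_def by blast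
  define t where "t = G $ 3 $ 1"
  have t: "t / \<pi> \<in> \<O>" using small[of 3 1] by (simp add: t_def mat_def m_iff_pi)
  \<comment> \<open>Chosen such that \<open>\<pi> s q\<close> is the entry \<open>t\<close> to be cancelled.\<close>
  define s where "s = (t / \<pi>) * inverse q"
  have "s \<in> \<O>" unfolding s_def by (rule O_mult[OF t q(2)])
  then have s: "s \<in> \<O>" "- s \<in> \<O>" by simp_all
  have sq: "\<pi> * s * q = t" using q(1) by (simp add: s_def)
  define e where "e = \<kappa> ** (mat 1 + elem i j (\<pi> * s)) ** matrix_inv \<kappa>"
  define e' where "e' = \<kappa> ** (mat 1 + elem i j (\<pi> * (- s))) ** matrix_inv \<kappa>"
  have e': "e' \<in> \<Gamma>" unfolding e'_def by (rule unipotent_conj_\<Gamma>[OF \<kappa> ne s(2)])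
  have "elem i j (\<pi> * (- s)) = - elem i j (\<pi> * s)" by (simp add: elem_def vec_eq_iff)
  then have ee0: "(mat 1 + elem i j (\<pi> * (- s))) ** (mat 1 + elem i j (\<pi> * s)) = mat 1"
    using elem_square[OF ne, of "\<pi> * s" "\<pi> * s"] by (simp add: matrix_add_ldistrib matrix_diff_rdistrib)
  have e'e: "e' ** e = mat 1"
  proof -
    have "e' ** e = \<kappa> ** ((mat 1 + elem i j (\<pi> * (- s))) ** (matrix_inv \<kappa> ** (\<kappa> ** ((mat 1 + elem i j (\<pi> * s)) ** matrix_inv \<kappa>))))"
      by (simp only: e_def e'_def matrix_mul_assoc)
    then show ?thesis
      by (simp only: matrix_cancel[OF GLO_inverse_mult(2)[OF \<kappa>]] matrix_cancel[OF ee0] GLO_inverse_mult(1)[OF \<kappa>])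
  qed
  define a where "a = g ** e'"
  have gd: "det g = 1" "det e' = 1" using g e' by (simp_all add: \<Gamma>_def)
  have ed: "det e = 1" using arg_cong[OF e'e, of det] gd by (simp add: det_mul)
  have ga: "g = a ** e"
    using e'e by (simp add: a_def flip: matrix_mul_assoc)
  have conj_a: "matrix_inv k ** a ** k = G ** (matrix_inv k ** e' ** k)"
  proof -
    have "G ** (matrix_inv k ** e' ** k) = matrix_inv k ** (g ** (k ** (matrix_inv k ** (e' ** k))))"
      by (simp only: G_def matrix_mul_assoc)
    then show ?thesis
      by (simp only: matrix_cancel[OF GLO_inverse_mult(1)[OF k]]) (simp only: a_def matrix_mul_assoc)
  qed
  have ka: "matrix_inv k ** a ** k = G ** (mat 1 + ?w ** elem i j (\<pi> * (- s)) ** ?u)"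
  proof -
    have "matrix_inv k ** e' ** k = ?w ** (mat 1 + elem i j (\<pi> * (- s))) ** ?u"
      by (simp only: e'_def matrix_mul_assoc)
    also have "\<dots> = ?w ** ?u + ?w ** elem i j (\<pi> * (- s)) ** ?u"
      by (simp add: matrix_add_ldistrib matrix_add_rdistrib')
    also have "?w ** ?u = matrix_inv k ** (\<kappa> ** (matrix_inv \<kappa> ** k))" by (simp only: matrix_mul_assoc)
    also have "\<dots> = mat 1"
      by (simp only: matrix_cancel[OF GLO_inverse_mult(1)[OF \<kappa>]] GLO_inverse_mult(2)[OF k])
    finally show ?thesis unfolding conj_a by simp
  qed
  have wu: "(?w ** elem i j c ** ?u) $ b $ d = ?w $ b $ i * c * ?u $ j $ d" for b c d
    using exhaust_3[of j] by (auto simp: mult_elem matrix_matrix_mult_def[of "\<chi> a b. _ a b" ?u] sum_3)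
  have "G ** (mat 1 + ?w ** elem i j (\<pi> * (- s)) ** ?u) = G + ?w ** elem i j (\<pi> * (- s)) ** ?u
      + (G - mat 1) ** (?w ** elem i j (\<pi> * (- s)) ** ?u)"
    by (simp add: matrix_add_ldistrib matrix_diff_rdistrib)
  then have "(matrix_inv k ** a ** k) $ 3 $ 1 = t + ?w $ 3 $ i * (\<pi> * (- s)) * ?u $ j $ 1
      + ((G - mat 1) ** (?w ** elem i j (\<pi> * (- s)) ** ?u)) $ 3 $ 1"
    unfolding ka by (simp only: vector_add_component wu t_def)
  also have "t + ?w $ 3 $ i * (\<pi> * (- s)) * ?u $ j $ 1 = 0"
    using sq by (simp add: q_def mult.assoc mult.left_commute)
  also have "((G - mat 1) ** (?w ** elem i j (\<pi> * (- s)) ** ?u)) $ 3 $ 1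
      = \<pi> * ((- s) * ((G - mat 1) $ 3 $ 1 * (?w $ 1 $ i * ?u $ j $ 1) + (G - mat 1) $ 3 $ 2 * (?w $ 2 $ i * ?u $ j $ 1)
        + (G - mat 1) $ 3 $ 3 * (?w $ 3 $ i * ?u $ j $ 1)))" (is "_ = \<pi> * ?r")
    unfolding matrix_matrix_mult_def[of "G - mat 1"] by (simp only: vec_lambda_beta sum_3 wu) (simp add: algebra_simps)
  finally have "(matrix_inv k ** a ** k) $ 3 $ 1 / \<pi> = ?r" by simp
  moreover have "?r \<in> \<mm>" by (intro m_mult_left m_add m_mult_right small O_mult wO s)
  ultimately have r: "(matrix_inv k ** a ** k) $ 3 $ 1 / \<pi> \<in> \<mm>" by simp
  have "matrix_inv k ** a ** k \<in> I"
    unfolding conj_a by (intro I_mult \<Gamma>_subset_I \<Gamma>_conj k g e' G)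
  then have "fixed_by a z" using edge_line_point[OF k _ r] fixed by blast
  moreover have "det (e ** h) = 1" using ed h by (simp add: det_mul)
  ultimately have "coset_value z (a ** (e ** h)) = coset_value z (e ** h)" unfolding fixed_by_def by blast
  moreover have "a ** (e ** h) = g ** h" by (simp add: ga matrix_mul_assoc)
  moreover have "e ** h = h ** (matrix_inv h ** e ** h)"
    using matrix_cancel[OF matrix_inv_right'[of h]] h by (simp flip: matrix_mul_assoc)
  moreover have "matrix_inv h ** e ** h \<in> I" unfolding e_def by (rule stab[OF ij s(1)])
  ultimately show False using moved coset_value_right by metis
qed

text \<open>The first column of \<open>\<kappa>\<^sup>-\<^sup>1 k\<close> gives the coordinates of the point of \<open>k\<close> in the basis \<open>\<kappa>\<close>, and the
  last row of \<open>k\<^sup>-\<^sup>1 \<kappa>\<close> gives those of a linear form that defines the line of \<open>k\<close>. By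
  \<open>moving_forces_small\<close> the products of an earlier coordinate of the line with a later one of the point
  vanish modulo \<open>\<pi>\<close>. Together with the incidence relation of point and line this leaves only the case that the
  last two coordinates of the point vanish, and the case that the first two of the line vanish.\<close>

lemma moved_edge_position:
  assumes k: "k \<in> GLO" and \<kappa>: "\<kappa> \<in> GLO" and h: "det h = 1"
    and stab: "\<And>i j s. rk i < rk j \<Longrightarrow> s \<in> \<O> \<Longrightarrow>
       matrix_inv h ** (\<kappa> ** (mat 1 + elem i j (\<pi> * s)) ** matrix_inv \<kappa>) ** h \<in> I"
    and fixed: "\<And>g. g \<in> I\<^sub>F {line_of k, point_of k} \<Longrightarrow> fixed_by g z"
    and g: "g \<in> \<Gamma>" and moved: "coset_value z (g ** h) \<noteq> coset_value z h"
  shows "point_of k = point_of \<kappa> \<or> line_of k = line_of \<kappa>"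
proof -
  let ?w = "matrix_inv k ** \<kappa>" and ?u = "matrix_inv \<kappa> ** k"
  have wG: "?w \<in> GLO" "?u \<in> GLO" using GLO_mult GLO_inv k \<kappa> by blast+
  have wO: "?w $ a $ b \<in> \<O>" "?u $ a $ b \<in> \<O>" for a b using wG by (simp_all add: GLO_integral integral_nth)
  have sm: "?w $ 3 $ i * ?u $ j $ 1 \<in> \<mm>" if "rk i < rk j" for i j
    by (rule moving_forces_small[OF k \<kappa> h stab fixed g moved that])
  have prods: "?w $ 3 $ 1 \<in> \<mm> \<or> ?u $ 2 $ 1 \<in> \<mm>" "?w $ 3 $ 1 \<in> \<mm> \<or> ?u $ 3 $ 1 \<in> \<mm>" "?w $ 3 $ 2 \<in> \<mm> \<or> ?u $ 3 $ 1 \<in> \<mm>"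
    using sm[of 1 2] sm[of 1 3] sm[of 2 3] m_prime[OF wO(1) wO(2)] by simp_all
  have "?w ** ?u = matrix_inv k ** (\<kappa> ** (matrix_inv \<kappa> ** k))" by (simp only: matrix_mul_assoc)
  also have "\<dots> = mat 1"
    by (simp only: matrix_cancel[OF GLO_inverse_mult(1)[OF \<kappa>]] GLO_inverse_mult(2)[OF k])
  finally have "(?w ** ?u) $ 3 $ 1 = 0" by (simp add: mat_def)
  then have orth: "?w $ 3 $ 1 * ?u $ 1 $ 1 + ?w $ 3 $ 2 * ?u $ 2 $ 1 + ?w $ 3 $ 3 * ?u $ 3 $ 1 = 0"
    unfolding matrix_matrix_mult_def[of ?w] by (simp only: vec_lambda_beta sum_3)
  have row: "\<not> (?w $ 3 $ 1 \<in> \<mm> \<and> ?w $ 3 $ 2 \<in> \<mm> \<and> ?w $ 3 $ 3 \<in> \<mm>)"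
  proof
    assume "?w $ 3 $ 1 \<in> \<mm> \<and> ?w $ 3 $ 2 \<in> \<mm> \<and> ?w $ 3 $ 3 \<in> \<mm>"
    then have "det ?w \<in> \<mm>" unfolding det_3 by (intro m_diff m_add m_mult_left O_mult wO) simp_all
    then show False using wG(1) by (simp add: GLO_def)
  qed
  have u31: "?u $ 3 $ 1 \<in> \<mm>"
  proof (rule ccontr)
    assume n: "?u $ 3 $ 1 \<notin> \<mm>"
    then have w: "?w $ 3 $ 1 \<in> \<mm>" "?w $ 3 $ 2 \<in> \<mm>" using prods by blast+
    have "?w $ 3 $ 3 * ?u $ 3 $ 1 = - (?w $ 3 $ 1 * ?u $ 1 $ 1 + ?w $ 3 $ 2 * ?u $ 2 $ 1)"
      using orth by (simp only: eq_neg_iff_add_eq_0 ac_simps)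
    moreover have "- (?w $ 3 $ 1 * ?u $ 1 $ 1 + ?w $ 3 $ 2 * ?u $ 2 $ 1) \<in> \<mm>"
      unfolding m_minus by (intro m_add m_mult_right w wO)
    ultimately have "?w $ 3 $ 3 * ?u $ 3 $ 1 \<in> \<mm>" by simp
    then show False using m_prime[OF wO(1) wO(2)] n w row by blast
  qed
  show ?thesis
  proof (cases "?u $ 2 $ 1 \<in> \<mm>")
    case True
    have "\<forall>i\<in>{2, 3}. \<forall>j\<in>- {2, 3}. ?u $ i $ j \<in> \<mm>"
      unfolding ball_point using True u31 by simp
    then show ?thesis using vert_dg_eqI[of "{2, 3}" \<kappa> k] k \<kappa> by blast
  next
    case False
    then have w31: "?w $ 3 $ 1 \<in> \<mm>" using prods by blast
    have "?w $ 3 $ 2 * ?u $ 2 $ 1 = - (?w $ 3 $ 1 * ?u $ 1 $ 1 + ?w $ 3 $ 3 * ?u $ 3 $ 1)"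
      using orth by (simp only: eq_neg_iff_add_eq_0 ac_simps)
    moreover have "- (?w $ 3 $ 1 * ?u $ 1 $ 1 + ?w $ 3 $ 3 * ?u $ 3 $ 1) \<in> \<mm>"
      unfolding m_minus by (intro m_add m_mult_right[OF w31] m_mult_left[OF _ u31] wO)
    ultimately have "?w $ 3 $ 2 * ?u $ 2 $ 1 \<in> \<mm>" by simp
    then have w32: "?w $ 3 $ 2 \<in> \<mm>" using m_prime[OF wO(1) wO(2)] False by blast
    have "\<forall>i\<in>{3}. \<forall>j\<in>- {3}. ?w $ i $ j \<in> \<mm>"
      unfolding ball_line using w31 w32 by simp
    then show ?thesis using vert_dg_eqI[of "{3}" k \<kappa>] k \<kappa> by simp
  qed
qed

text \<open>The assumptions say that \<open>v\<^sub>2\<close> lies on \<open>line_of \<kappa>\<close> and that \<open>point_of \<kappa>\<close> lies on \<open>v\<^sub>1\<close>: the lower left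
  entries of \<open>\<kappa>\<^sup>-\<^sup>1\<close> and of \<open>\<kappa>\<close> vanish modulo \<open>\<pi>\<close>. Up to a unit the first of these is the minor
  \<open>\<kappa>\<^sub>2\<^sub>1 \<kappa>\<^sub>3\<^sub>2 - \<kappa>\<^sub>2\<^sub>2 \<kappa>\<^sub>3\<^sub>1\<close>. So \<open>\<kappa>\<^sub>2\<^sub>1\<close> or \<open>\<kappa>\<^sub>3\<^sub>2\<close> vanishes modulo \<open>\<pi>\<close> too.\<close>

lemma no_path_of_length_three:
  assumes k: "k\<^sub>1 \<in> GLO" "k\<^sub>2 \<in> GLO" "\<kappa> \<in> GLO"
    and "point_of k\<^sub>1 = v\<^sub>2" "line_of k\<^sub>1 = line_of \<kappa>"
    and "point_of k\<^sub>2 = point_of \<kappa>" "line_of k\<^sub>2 = v\<^sub>1"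
  shows "point_of \<kappa> = v\<^sub>2 \<or> line_of \<kappa> = v\<^sub>1"
proof -
  have m1: "matrix_inv (mat 1) = (mat 1 :: 'K ^ 3 ^ 3)" by (rule matrix_inv_unique) simp
  have kO: "k\<^sub>1 $ a $ b \<in> \<O>" "k\<^sub>2 $ a $ b \<in> \<O>" "\<kappa> $ a $ b \<in> \<O>" for a b using k by (simp_all add: GLO_integral integral_nth)
  have mem: "(1::3) \<notin> {2, 3}" "(1::3) \<notin> {3}" "(2::3) \<notin> {3}" by simp_all
  define x where "x = matrix_inv \<kappa> ** k\<^sub>1"
  define y where "y = matrix_inv k\<^sub>1"
  have xO: "x $ a $ b \<in> \<O>" for a b unfolding x_def by (intro integral_nth GLO_integral GLO_mult GLO_inv k)
  have yO: "y $ a $ b \<in> \<O>" for a b unfolding y_def by (intro integral_nth GLO_integral GLO_inv k)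
  have xm: "x $ 3 $ 1 \<in> \<mm>" "x $ 3 $ 2 \<in> \<mm>"
    unfolding x_def by (rule vert_dg_eqD[OF assms(5) k(1,3)]; simp)+
  have ym: "y $ 3 $ 1 \<in> \<mm>"
    using vert_dg_eqD[of "mat 1" "{2, 3}" k\<^sub>1 3 1] assms(4) k(1) mem by (simp add: v\<^sub>2_eq y_def)
  have "matrix_inv \<kappa> = x ** y"
  proof -
    have "x ** y = matrix_inv \<kappa> ** (k\<^sub>1 ** matrix_inv k\<^sub>1)" by (simp only: x_def y_def matrix_mul_assoc)
    then show ?thesis by (simp add: GLO_inverse_mult k)
  qed
  then have "matrix_inv \<kappa> $ 3 $ 1 = x $ 3 $ 1 * y $ 1 $ 1 + x $ 3 $ 2 * y $ 2 $ 1 + x $ 3 $ 3 * y $ 3 $ 1"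
    by (simp add: matrix_matrix_mult_def sum_3)
  also have "\<dots> \<in> \<mm>" by (intro m_add m_mult_right[OF xm(1)] m_mult_right[OF xm(2)] m_mult_left[OF _ ym] xO yO)
  finally have inv31: "matrix_inv \<kappa> $ 3 $ 1 \<in> \<mm>" .
  define t where "t = matrix_inv k\<^sub>2 ** \<kappa>"
  have tO: "t $ a $ b \<in> \<O>" for a b unfolding t_def by (intro integral_nth GLO_integral GLO_mult GLO_inv k)
  have tm: "t $ 3 $ 1 \<in> \<mm>"
    unfolding t_def by (rule vert_dg_eqD[OF assms(6)[symmetric] k(3,2)]; simp)
  have k2m: "k\<^sub>2 $ 3 $ 1 \<in> \<mm>" "k\<^sub>2 $ 3 $ 2 \<in> \<mm>"
    using vert_dg_eqD[of k\<^sub>2 "{3}" "mat 1" 3] assms(7) k(2) mem by (simp_all add: v\<^sub>1_eq m1)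
  have e: "\<kappa> = k\<^sub>2 ** t"
    unfolding t_def using matrix_cancel[OF GLO_inverse_mult(1)[OF k(2)]] by simp
  have "\<kappa> $ 3 $ 1 = (k\<^sub>2 ** t) $ 3 $ 1" by (rule arg_cong[OF e])
  also have "\<dots> = k\<^sub>2 $ 3 $ 1 * t $ 1 $ 1 + k\<^sub>2 $ 3 $ 2 * t $ 2 $ 1 + k\<^sub>2 $ 3 $ 3 * t $ 3 $ 1"
    by (simp add: matrix_matrix_mult_def sum_3)
  also have "\<dots> \<in> \<mm>" by (intro m_add m_mult_right[OF k2m(1)] m_mult_right[OF k2m(2)] m_mult_left[OF _ tm] kO tO)
  finally have k31: "\<kappa> $ 3 $ 1 \<in> \<mm>" .
  have d: "det \<kappa> \<noteq> 0" "det \<kappa> \<in> \<O>" using k(3) by (auto simp: GLO_det_nz GLO_def)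
  have "det \<kappa> * matrix_inv \<kappa> $ 3 $ 1 = \<kappa> $ 2 $ 1 * \<kappa> $ 3 $ 2 - \<kappa> $ 2 $ 2 * \<kappa> $ 3 $ 1"
    using d by (simp add: matrix_inv_adj3 adj3_def)
  then have "\<kappa> $ 2 $ 1 * \<kappa> $ 3 $ 2 = det \<kappa> * matrix_inv \<kappa> $ 3 $ 1 + \<kappa> $ 2 $ 2 * \<kappa> $ 3 $ 1" by simp
  also have "\<dots> \<in> \<mm>" by (intro m_add m_mult_left[OF _ inv31] m_mult_left[OF _ k31] d kO)
  finally have "\<kappa> $ 2 $ 1 \<in> \<mm> \<or> \<kappa> $ 3 $ 2 \<in> \<mm>" using m_prime kO by blast
  then show ?thesis
  proof
    assume "\<kappa> $ 2 $ 1 \<in> \<mm>"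
    then have "\<forall>i\<in>{2, 3}. \<forall>j\<in>- {2, 3}. (matrix_inv (mat 1) ** \<kappa>) $ i $ j \<in> \<mm>"
      unfolding m1 matrix_mul_lid ball_point using k31 by simp
    from vert_dg_eqI[OF this k(3) GLO_1] show ?thesis by (simp add: v\<^sub>2_eq)
  next
    assume "\<kappa> $ 3 $ 2 \<in> \<mm>"
    then have "\<forall>i\<in>{3}. \<forall>j\<in>- {3}. (matrix_inv (mat 1) ** \<kappa>) $ i $ j \<in> \<mm>"
      unfolding m1 matrix_mul_lid ball_line using k31 by simp
    from vert_dg_eqI[OF this k(3) GLO_1] show ?thesis by (simp add: v\<^sub>1_eq)
  qed
qed

end

section \<open>Collapsing the star\<close>

text \<open>The edges \<open>B\<close> form a subgraph of the double star with centres \<open>q\<close> and \<open>m\<close>, a tree, and have no leaves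
  other than \<open>P\<^sub>0\<close> and \<open>l\<^sub>0\<close>. If there is an edge at all, they form a path from \<open>P\<^sub>0\<close> to
  \<open>l\<^sub>0\<close>; if it had length three, its vertices would be \<open>P\<^sub>0\<close>, \<open>m\<close>, \<open>q\<close>, \<open>l\<^sub>0\<close>.\<close>

lemma double_star_forest:
  assumes star: "\<And>P l. B P l \<Longrightarrow> P = q \<or> l = m"
    and leaf_P: "\<And>P l. B P l \<Longrightarrow> P \<noteq> P\<^sub>0 \<Longrightarrow> \<exists>l'. l' \<noteq> l \<and> B P l'"
    and leaf_l: "\<And>P l. B P l \<Longrightarrow> l \<noteq> l\<^sub>0 \<Longrightarrow> \<exists>P'. P' \<noteq> P \<and> B P' l"
    and path: "B P\<^sub>0 m \<Longrightarrow> B q l\<^sub>0 \<Longrightarrow> q = P\<^sub>0 \<or> m = l\<^sub>0"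
    and B: "B P l"
  shows "P = P\<^sub>0 \<and> l = l\<^sub>0"
proof -
  have at_q: "l = l\<^sub>0" if "B q l" "l \<noteq> m" for l using leaf_l[OF that(1)] star that(2) by blast
  have at_m: "P = P\<^sub>0" if "B P m" "P \<noteq> q" for P using leaf_P[OF that(1)] star that(2) by blast
  have centre_q: "q = P\<^sub>0" if c: "B q m"
  proof (rule ccontr)
    assume q: "q \<noteq> P\<^sub>0"
    obtain l' where l': "l' \<noteq> m" "B q l'" using leaf_P[OF c q] by blast
    then have l0: "B q l\<^sub>0" "m \<noteq> l\<^sub>0" using at_q by auto
    obtain P' where "P' \<noteq> q" "B P' m" using leaf_l[OF c l0(2)] by blast
    then have "B P\<^sub>0 m" using at_m by auto
    then show False using path l0 q by blast
  qed
  have centre_m: "m = l\<^sub>0" if c: "B q m"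
  proof (rule ccontr)
    assume "m \<noteq> l\<^sub>0"
    then obtain P' where "P' \<noteq> q" "B P' m" using leaf_l[OF c] by blast
    then show False using at_m centre_q[OF c] by blast
  qed
  consider "P = q" "l = m" | "P = q" "l \<noteq> m" | "P \<noteq> q" "l = m" using star[OF B] by blast
  then show ?thesis
  proof cases
    case 1
    then show ?thesis using B centre_q centre_m by simp
  next
    case 2
    then have l: "l = l\<^sub>0" using at_q B by simp
    have "q = P\<^sub>0"
    proof (rule ccontr)
      assume q: "q \<noteq> P\<^sub>0"
      then obtain l' where l': "l' \<noteq> l" "B q l'" using leaf_P[of q l] B 2 by blast
      then have "l' = m" using at_q l by blast
      then show False using l' centre_q q by blast
    qed
    then show ?thesis using 2 l by simp
  next
    case 3
    then have P: "P = P\<^sub>0" using at_m B by simp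
    have "m = l\<^sub>0"
    proof (rule ccontr)
      assume m: "m \<noteq> l\<^sub>0"
      then obtain P' where P': "P' \<noteq> P" "B P' m" using leaf_l[of P m] B 3 by blast
      then have "P' = q" using at_m P by blast
      then show False using P' centre_m m by blast
    qed
    then show ?thesis using 3 P by simp
  qed
qed

locale star_chain = totally_ramified_extension \<iota> v \<pi>
  for \<iota> :: "'p :: prime_card padic \<Rightarrow> 'K :: field" and v :: "'K \<Rightarrow> int" and \<pi> :: 'K +
  fixes \<beta> :: "('K ^ 3) set set list set \<Rightarrow> (('K ^ 3 ^ 3) set \<Rightarrow>\<^sub>0 'k :: field)"
  assumes \<beta>: "\<beta> \<in> chains_in (Star v\<^sub>0) perm_module 1"
    and d\<beta>: "boundary 0 \<beta> \<in> chains_in C perm_module 0"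
begin

definition b :: "('K ^ 3) set set \<Rightarrow> ('K ^ 3) set set \<Rightarrow> (('K ^ 3 ^ 3) set \<Rightarrow>\<^sub>0 'k)" where
  "b x y = \<beta> {[x, y]}"

lemma edge_oriented: "{[x, y]} \<in> oriented_facets 1 \<longleftrightarrow> {x, y} \<in> facets 1"
  unfolding oriented_facets_one by auto

lemma \<beta>_chain:
  "c \<notin> oriented_facets 1 \<Longrightarrow> \<beta> c = 0"
  "c \<in> oriented_facets 1 \<Longrightarrow> \<beta> c \<in> perm_module"
  "c \<in> oriented_facets 1 \<Longrightarrow> g \<in> I\<^sub>F (underlying c) \<Longrightarrow> translate g (\<beta> c) = \<beta> c"
  "c \<in> oriented_facets 1 \<Longrightarrow> \<beta> (opposite c) = - \<beta> c"
  "c \<in> oriented_facets 1 \<Longrightarrow> \<not> underlying c \<subseteq> Star v\<^sub>0 \<Longrightarrow> \<beta> c = 0"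
  using \<beta> unfolding chains_in_def chains_def by simp_all

lemma b_support: "b x y \<noteq> 0 \<Longrightarrow> {x, y} \<in> facets 1 \<and> x \<in> Star v\<^sub>0 \<and> y \<in> Star v\<^sub>0"
proof -
  assume nz: "b x y \<noteq> 0"
  then have o: "{[x, y]} \<in> oriented_facets 1" using \<beta>_chain(1) by (auto simp: b_def)
  then have "underlying {[x, y]} \<subseteq> Star v\<^sub>0" using \<beta>_chain(5) nz by (auto simp: b_def)
  then show ?thesis using o by (simp add: edge_oriented[unfolded One_nat_def] underlying_simps)
qed

lemma b_perm: "b x y \<in> perm_module"
  using \<beta>_chain(1,2)[of "{[x, y]}"] perm_module_simps(1) unfolding b_def by metis

lemma det_I\<^sub>F: "g \<in> I\<^sub>F F \<Longrightarrow> det g = 1"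
  by (simp add: I\<^sub>F_def J_def)

lemma b_fixed: "g \<in> I\<^sub>F {x, y} \<Longrightarrow> fixed_by g (b x y)"
proof (cases "{[x, y]} \<in> oriented_facets 1")
  case True
  assume g: "g \<in> I\<^sub>F {x, y}"
  then have "translate g (b x y) = b x y"
    unfolding b_def using \<beta>_chain(3)[OF True] by (simp add: underlying_simps)
  then show ?thesis using translate_fixed_iff[OF det_I\<^sub>F[OF g] b_perm] by blast
next
  case False
  then show ?thesis by (simp add: b_def \<beta>_chain(1) fixed_by_simps)
qed

lemma b_neg: "b y x = - b x y"
proof (cases "{[x, y]} \<in> oriented_facets 1")
  case True
  then show ?thesis using \<beta>_chain(4)[OF True] by (simp add: b_def opposite_two)
next
  case False
  then have "{[y, x]} \<notin> oriented_facets 1" unfolding edge_oriented insert_commute[of y x] .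
  then show ?thesis using False by (simp add: b_def \<beta>_chain(1))
qed

lemma b_sum:
  assumes "x \<in> vertices" "x \<notin> C"
  shows "(\<Sum>y | {x, y} \<in> facets 1. b y x) = 0"
proof -
  have "{[x]} \<in> oriented_facets 0" using assms(1) by (simp add: oriented_facets_zero)
  moreover have "\<not> underlying {[x]} \<subseteq> C" using assms(2) by (simp add: underlying_simps)
  ultimately have "boundary 0 \<beta> {[x]} = 0" using d\<beta> unfolding chains_in_def by simp
  then show ?thesis using boundary_vertex[OF assms(1), of \<beta>] by (simp add: b_def)
qed

text \<open>The value of \<open>\<beta>\<close> on the edge, as a function on the group, is not constant on the coset \<open>\<Gamma> h\<close>.\<close>

definition moved :: "('K ^ 3) set set \<Rightarrow> ('K ^ 3) set set \<Rightarrow> 'K ^ 3 ^ 3 \<Rightarrow> bool" where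
  "moved x y h \<longleftrightarrow> (\<exists>g\<in>\<Gamma>. coset_value (b x y) (g ** h) \<noteq> coset_value (b x y) h)"

lemma moved_commute: "moved x y h \<Longrightarrow> moved y x h"
  unfolding moved_def using b_neg[of x y] by (simp add: coset_value_simps)

lemma Star_cases:
  assumes "x \<in> Star v\<^sub>0" "x \<noteq> v\<^sub>0"
  obtains k where "k \<in> GLO" "x = line_of k \<or> x = point_of k"
proof -
  obtain F where F: "F \<in> facets 2" "v\<^sub>0 \<in> F" "x \<in> F" using assms(1) unfolding Star_iff by blast
  obtain k where "k \<in> GLO" "F = {v\<^sub>0, line_of k, point_of k}" using chamber_at_v\<^sub>0[OF F(1,2)] .
  then show thesis using that F(3) assms(2) by blast
qed

lemma not_moved_v\<^sub>0: "det h = 1 \<Longrightarrow> \<not> moved v\<^sub>0 x h"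
proof
  assume h: "det h = 1" and "moved v\<^sub>0 x h"
  then obtain g where g: "g \<in> \<Gamma>" "coset_value (b v\<^sub>0 x) (g ** h) \<noteq> coset_value (b v\<^sub>0 x) h"
    unfolding moved_def by blast
  then have "b v\<^sub>0 x \<noteq> 0" by (auto simp: coset_value_simps)
  then have x: "x \<in> Star v\<^sub>0" "{v\<^sub>0, x} \<in> facets 1" using b_support by auto
  then have "x \<noteq> v\<^sub>0" unfolding facets_one_iff by auto
  with x(1) obtain k where k: "k \<in> GLO" "x = line_of k \<or> x = point_of k" by (rule Star_cases)
  then have "g \<in> I\<^sub>F {v\<^sub>0, x}" using \<Gamma>_edge_v\<^sub>0[OF k(1) g(1)] by auto
  then have "fixed_by g (b v\<^sub>0 x)" by (rule b_fixed)
  then show False using g(2) h unfolding fixed_by_def by blast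
qed

lemma moved_edge:
  assumes h: "det h = 1" and m: "moved x y h"
  obtains k where "k \<in> GLO" "(x = line_of k \<and> y = point_of k) \<or> (x = point_of k \<and> y = line_of k)"
proof -
  have "b x y \<noteq> 0" using m by (auto simp: moved_def coset_value_simps)
  then have xy: "{x, y} \<in> facets 1" "x \<in> Star v\<^sub>0" "y \<in> Star v\<^sub>0" using b_support by auto
  have ne: "x \<noteq> v\<^sub>0" "y \<noteq> v\<^sub>0" using m not_moved_v\<^sub>0[OF h] moved_commute by blast+
  have "{v\<^sub>0, x, y} \<in> facets 2" by (rule edge_in_Star[OF xy ne])
  then obtain k where k: "k \<in> GLO" "{x, y} = {line_of k, point_of k}" by (rule link_edge)
  then show thesis using that[OF k(1)] by (simp add: doubleton_eq_iff)
qed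

text \<open>The values of \<open>\<beta>\<close> on the edges with target \<open>x\<close> add up to zero. If all but one of them are constant on
  \<open>\<Gamma> h\<close>, so is the remaining one.\<close>

lemma moved_leaf:
  assumes h: "det h = 1" and m: "moved x y h" and x: "x \<notin> C"
  obtains y' where "y' \<noteq> y" "moved x y' h"
proof (rule ccontr)
  assume n: "\<not> thesis"
  note thesisI = that
  have others: "\<not> moved y' x h" if ne: "y' \<noteq> y" for y'
  proof
    assume "moved y' x h"
    from moved_commute[OF this] have thesis by (rule thesisI[OF ne])
    with n show False ..
  qed
  obtain g where g: "g \<in> \<Gamma>" "coset_value (b y x) (g ** h) \<noteq> coset_value (b y x) h"
    using moved_commute[OF m] unfolding moved_def by blast
  have "b x y \<noteq> 0" using m by (auto simp: moved_def coset_value_simps)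
  then have xy: "{x, y} \<in> facets 1" "x \<in> vertices" using b_support Star_vertices by auto
  let ?N = "{y. {x, y} \<in> facets 1}"
  have fin: "finite ?N" by (rule finite_edges_at[OF xy(2)])
  have y: "y \<in> ?N" using xy(1) by simp
  have zero: "coset_value (b y x) h' + (\<Sum>z\<in>?N - {y}. coset_value (b z x) h') = 0" for h'
  proof -
    have "coset_value (\<Sum>z\<in>?N. b z x) h' = 0" using b_sum[OF xy(2) x] by (simp add: coset_value_simps)
    then have "(\<Sum>z\<in>?N. coset_value (b z x) h') = 0" unfolding coset_value_simps .
    then show ?thesis by (simp only: sum.remove[OF fin y])
  qed
  have "(\<Sum>z\<in>?N - {y}. coset_value (b z x) (g ** h)) = (\<Sum>z\<in>?N - {y}. coset_value (b z x) h)"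
  proof (rule sum.cong[OF refl])
    fix z assume "z \<in> ?N - {y}"
    then have "\<not> moved z x h" using others by blast
    then show "coset_value (b z x) (g ** h) = coset_value (b z x) h" using g(1) unfolding moved_def by blast
  qed
  then show False using zero[of "g ** h"] zero[of h] g(2) by (simp add: add_eq_0_iff2)
qed

text \<open>The moved flags satisfy the hypotheses of \<open>double_star_forest\<close>, where the centres are the point and the
  line of the basis \<open>\<kappa>\<close> attached to \<open>h\<close>.\<close>

lemma moved_only_in_C:
  assumes h: "det h = 1" and m: "moved x y h"
  shows "{x, y} = {v\<^sub>1, v\<^sub>2}"
proof -
  obtain \<kappa> where \<kappa>: "\<kappa> \<in> GLO" and stab: "\<And>i j s. rk i < rk j \<Longrightarrow> s \<in> \<O> \<Longrightarrow>
       matrix_inv h ** (\<kappa> ** (mat 1 + elem i j (\<pi> * s)) ** matrix_inv \<kappa>) ** h \<in> I"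
    using stabiliser_contains_unipotents[OF h] by blast
  \<comment> \<open>The moved flags, as a relation between points and lines.\<close>
  define B where "B P l \<longleftrightarrow> moved P l h \<and> (\<exists>k\<in>GLO. P = point_of k \<and> l = line_of k)" for P l
  have BI: "B P l" if mv: "moved P l h" and kG: "k \<in> GLO" and Pk: "P = point_of k" for P l k
  proof -
    obtain k' where k': "k' \<in> GLO" "(P = line_of k' \<and> l = point_of k') \<or> (P = point_of k' \<and> l = line_of k')"
      using moved_edge[OF h mv] .
    then have "P = point_of k' \<and> l = line_of k'" using vertex_types(1)[OF k'(1) kG] Pk by auto
    then show ?thesis using mv k'(1) unfolding B_def by blast
  qed
  have BI': "B P l" if mv: "moved P l h" and kG: "k \<in> GLO" and Pk: "l = line_of k" for P l k
  proof -
    obtain k' where k': "k' \<in> GLO" "(P = line_of k' \<and> l = point_of k') \<or> (P = point_of k' \<and> l = line_of k')"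
      using moved_edge[OF h mv] .
    then have "P = point_of k' \<and> l = line_of k'" using vertex_types(1)[OF kG k'(1)] Pk by auto
    then show ?thesis using mv k'(1) unfolding B_def by blast
  qed
  have notC: "point_of k \<notin> C" if "k \<in> GLO" "point_of k \<noteq> v\<^sub>2" for k
    using vertex_types[OF GLO_1 that(1)] vertex_types(3)[OF that(1) that(1)] that(2)
    unfolding C_def v\<^sub>1_eq by auto
  have notC': "line_of k \<notin> C" if "k \<in> GLO" "line_of k \<noteq> v\<^sub>1" for k
    using vertex_types(1)[OF that(1) GLO_1] vertex_types(2)[OF that(1) that(1)] that(2)
    unfolding C_def v\<^sub>2_eq by auto
  have concl: "P = v\<^sub>2 \<and> l = v\<^sub>1" if B: "B P l" for P l
  proof (rule double_star_forest[of B "point_of \<kappa>" "line_of \<kappa>"])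
    show "P = point_of \<kappa> \<or> l = line_of \<kappa>" if Bpl: "B P l" for P l
    proof -
      obtain k where k: "k \<in> GLO" "P = point_of k" "l = line_of k" and mv: "moved P l h"
        using Bpl unfolding B_def by blast
      obtain g where g: "g \<in> \<Gamma>" "coset_value (b P l) (g ** h) \<noteq> coset_value (b P l) h"
        using mv unfolding moved_def by blast
      have fixed: "fixed_by g (b P l)" if "g \<in> I\<^sub>F {line_of k, point_of k}" for g
        using b_fixed[of g P l] that unfolding k by (simp add: insert_commute)
      show ?thesis
        using moved_edge_position[OF k(1) \<kappa> h stab fixed g] unfolding k by blast
    qed
    show "\<exists>l'. l' \<noteq> l \<and> B P l'" if Bpl: "B P l" and ne: "P \<noteq> v\<^sub>2" for P l
    proof -
      obtain k where k: "k \<in> GLO" "P = point_of k" and mv: "moved P l h" using Bpl unfolding B_def by blast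
      have "P \<notin> C" using notC[OF k(1)] ne k(2) by simp
      then obtain l' where l': "l' \<noteq> l" "moved P l' h" by (rule moved_leaf[OF h mv])
      from l'(1) BI[OF l'(2) k] show ?thesis by (intro exI conjI)
    qed
    show "\<exists>P'. P' \<noteq> P \<and> B P' l" if Bpl: "B P l" and ne: "l \<noteq> v\<^sub>1" for P l
    proof -
      obtain k where k: "k \<in> GLO" "l = line_of k" and mv: "moved P l h" using Bpl unfolding B_def by blast
      have "l \<notin> C" using notC'[OF k(1)] ne k(2) by simp
      then obtain P' where P': "P' \<noteq> P" "moved l P' h" by (rule moved_leaf[OF h moved_commute[OF mv]])
      from P'(1) BI'[OF moved_commute[OF P'(2)] k] show ?thesis by (intro exI conjI)
    qed
    show "point_of \<kappa> = v\<^sub>2 \<or> line_of \<kappa> = v\<^sub>1" if B2: "B v\<^sub>2 (line_of \<kappa>)" and B1: "B (point_of \<kappa>) v\<^sub>1"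
    proof -
      obtain k\<^sub>1 where k1: "k\<^sub>1 \<in> GLO" "v\<^sub>2 = point_of k\<^sub>1" "line_of \<kappa> = line_of k\<^sub>1"
        using B2 unfolding B_def by blast
      obtain k\<^sub>2 where k2: "k\<^sub>2 \<in> GLO" "point_of \<kappa> = point_of k\<^sub>2" "v\<^sub>1 = line_of k\<^sub>2"
        using B1 unfolding B_def by blast
      show ?thesis
        by (rule no_path_of_length_three[OF k1(1) k2(1) \<kappa> k1(2)[symmetric] k1(3)[symmetric] k2(2)[symmetric] k2(3)[symmetric]])
    qed
    show "B P l" by (rule B)
  qed
  obtain k where k: "k \<in> GLO" "(x = line_of k \<and> y = point_of k) \<or> (x = point_of k \<and> y = line_of k)"
    using moved_edge[OF h m] .
  then show ?thesis
  proof (elim disjE conjE)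
    assume "x = line_of k" "y = point_of k"
    from BI[OF moved_commute[OF m] k(1) this(2)] have "B y x" .
    from concl[OF this] show ?thesis by simp
  next
    assume "x = point_of k" "y = line_of k"
    from BI[OF m k(1) this(1)] have "B x y" .
    from concl[OF this] show ?thesis by (simp add: insert_commute)
  qed
qed

lemma b_\<Gamma>_fixed: "{x, y} \<noteq> {v\<^sub>1, v\<^sub>2} \<Longrightarrow> g \<in> \<Gamma> \<Longrightarrow> fixed_by g (b x y)"
proof -
  assume ne: "{x, y} \<noteq> {v\<^sub>1, v\<^sub>2}" and g: "g \<in> \<Gamma>"
  show ?thesis
    unfolding fixed_by_def
  proof (intro allI impI)
    fix h :: "'K ^ 3 ^ 3" assume "det h = 1"
    then have "\<not> moved x y h" using moved_only_in_C[of h x y] ne by metis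
    then show "coset_value (b x y) (g ** h) = coset_value (b x y) h" using g unfolding moved_def by blast
  qed
qed

text \<open>By \<open>I_conj_factor\<close> every \<open>g\<close> in question is a product of an element of \<open>\<Gamma>\<close> and one of the group
  of the edge. So the value on the edge may be assigned to the chamber that it spans with \<open>v\<^sub>0\<close>.\<close>

lemma b_chamber_fixed:
  assumes k: "k \<in> GLO" and xy: "{x, y} = {line_of k, point_of k}" "{x, y} \<noteq> {v\<^sub>1, v\<^sub>2}"
    and g: "matrix_inv k ** g ** k \<in> I"
  shows "fixed_by g (b x y)"
proof -
  obtain g\<^sub>1 g\<^sub>2 where f: "g = g\<^sub>1 ** g\<^sub>2" "g\<^sub>1 \<in> \<Gamma>" "g\<^sub>2 \<in> I\<^sub>F {line_of k, point_of k}"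
    using I_conj_factor[OF k g] .
  have "fixed_by g\<^sub>1 (b x y)" by (rule b_\<Gamma>_fixed[OF xy(2) f(2)])
  moreover have "fixed_by g\<^sub>2 (b x y)" using f(3) unfolding xy(1)[symmetric] by (rule b_fixed)
  ultimately show ?thesis unfolding f(1) using fixed_by_mult det_I\<^sub>F[OF f(3)] by blast
qed

text \<open>The oriented chambers \<open>[v\<^sub>0, x, y]\<close> that receive the value of \<open>\<beta>\<close> on \<open>[x, y]\<close>. By \<open>fills_unique\<close> the
  orientation determines \<open>x\<close> and \<open>y\<close>.\<close>

definition fills :: "('K ^ 3) set set \<Rightarrow> ('K ^ 3) set set \<Rightarrow> ('K ^ 3) set set list set \<Rightarrow> bool" where
  "fills x y c \<longleftrightarrow> {v\<^sub>0, x, y} \<in> facets 2 \<and> {x, y} \<noteq> {v\<^sub>1, v\<^sub>2} \<and> c = cyc v\<^sub>0 x y"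

definition \<gamma> :: "('K ^ 3) set set list set \<Rightarrow> (('K ^ 3 ^ 3) set \<Rightarrow>\<^sub>0 'k)" where
  "\<gamma> c = (if \<exists>x y. fills x y c then b (fst (SOME p. fills (fst p) (snd p) c)) (snd (SOME p. fills (fst p) (snd p) c)) else 0)"

lemma fills_unique: "fills x y c \<Longrightarrow> fills x' y' c \<Longrightarrow> x' = x \<and> y' = y"
proof -
  assume a: "fills x y c" "fills x' y' c"
  have "cyc v\<^sub>0 x y = cyc v\<^sub>0 x' y'" "v\<^sub>0 \<noteq> x" "v\<^sub>0 \<noteq> y" using a unfolding fills_def facets_two_iff by auto
  from cyc_eq[OF this] show ?thesis by simp
qed

lemma \<gamma>_fills: "fills x y c \<Longrightarrow> \<gamma> c = b x y"
proof -
  assume f: "fills x y c"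
  then have "\<exists>p. fills (fst p) (snd p) c" by (intro exI[of _ "(x, y)"]) simp
  from someI_ex[OF this] have "fst (SOME p. fills (fst p) (snd p) c) = x \<and> snd (SOME p. fills (fst p) (snd p) c) = y"
    by (rule fills_unique[OF f])
  moreover have "\<exists>x y. fills x y c" using f by blast
  ultimately show ?thesis unfolding \<gamma>_def by simp
qed

lemma \<gamma>_cyc: "{v\<^sub>0, x, y} \<in> facets 2 \<Longrightarrow> \<gamma> (cyc v\<^sub>0 x y) = (if {x, y} = {v\<^sub>1, v\<^sub>2} then 0 else b x y)"
proof (cases "{x, y} = {v\<^sub>1, v\<^sub>2}")
  case True
  assume f: "{v\<^sub>0, x, y} \<in> facets 2"
  then have ne: "v\<^sub>0 \<noteq> x" "v\<^sub>0 \<noteq> y" unfolding facets_two_iff by auto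
  have "\<not> (\<exists>x' y'. fills x' y' (cyc v\<^sub>0 x y))"
  proof
    assume "\<exists>x' y'. fills x' y' (cyc v\<^sub>0 x y)"
    then obtain x' y' where f': "cyc v\<^sub>0 x y = cyc v\<^sub>0 x' y'" "{x', y'} \<noteq> {v\<^sub>1, v\<^sub>2}" unfolding fills_def by blast
    then show False using cyc_eq[OF f'(1) ne] True by simp
  qed
  then show ?thesis using True unfolding \<gamma>_def by simp
next
  case False
  assume "{v\<^sub>0, x, y} \<in> facets 2"
  then have "fills x y (cyc v\<^sub>0 x y)" using False unfolding fills_def by simp
  then show ?thesis using \<gamma>_fills False by simp
qed

lemma \<gamma>_zero: "v\<^sub>0 \<notin> underlying c \<Longrightarrow> \<gamma> c = 0"
proof -
  assume n: "v\<^sub>0 \<notin> underlying c"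
  have "\<not> (\<exists>x y. fills x y c)"
  proof
    assume "\<exists>x y. fills x y c"
    then obtain x y where "c = cyc v\<^sub>0 x y" unfolding fills_def by blast
    then show False using n by (simp add: underlying_simps)
  qed
  then show ?thesis unfolding \<gamma>_def by simp
qed

lemma \<gamma>_nonzero:
  assumes "\<gamma> c \<noteq> 0"
  obtains x y where "fills x y c" "\<gamma> c = b x y"
  using assms \<gamma>_fills unfolding \<gamma>_def by (metis (no_types, lifting))

lemma cyc_with_v\<^sub>0:
  assumes "v\<^sub>0 \<in> {x, y, z}"
  obtains x' y' where "cyc x y z = cyc v\<^sub>0 x' y'" "{x, y, z} = {v\<^sub>0, x', y'}"
proof -
  consider "x = v\<^sub>0" | "y = v\<^sub>0" | "z = v\<^sub>0" using assms by auto
  then show thesis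
  proof cases
    case 1
    show thesis by (rule that[of y z]) (simp_all add: 1)
  next
    case 2
    show thesis by (rule that[of z x]) (simp add: 2 cyc_rotate[of x], auto simp: 2)
  next
    case 3
    show thesis by (rule that[of x y]) (simp add: 3 cyc_rotate[of v\<^sub>0], auto simp: 3)
  qed
qed

lemma \<gamma>_opposite: "c \<in> oriented_facets 2 \<Longrightarrow> \<gamma> (opposite c) = - \<gamma> c"
proof -
  assume "c \<in> oriented_facets 2"
  then obtain x y z where c: "c = cyc x y z" "{x, y, z} \<in> facets 2" unfolding oriented_facets_two by blast
  show ?thesis
  proof (cases "v\<^sub>0 \<in> {x, y, z}")
    case True
    then obtain x' y' where c': "cyc x y z = cyc v\<^sub>0 x' y'" "{x, y, z} = {v\<^sub>0, x', y'}" by (rule cyc_with_v\<^sub>0)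
    have f: "{v\<^sub>0, x', y'} \<in> facets 2" using c(2) unfolding c'(2) .
    then have f': "{v\<^sub>0, y', x'} \<in> facets 2" by (simp only: insert_commute)
    have op: "opposite c = cyc v\<^sub>0 y' x'" unfolding c(1) c'(1) opposite_cyc by (rule cyc_rotate)
    show ?thesis
      unfolding op \<gamma>_cyc[OF f'] unfolding c(1) c'(1) \<gamma>_cyc[OF f] using b_neg[of x' y'] by (simp add: insert_commute)
  next
    case False
    then have "v\<^sub>0 \<notin> underlying c" "v\<^sub>0 \<notin> underlying (opposite c)"
      unfolding c(1) opposite_cyc underlying_simps by auto
    then show ?thesis using \<gamma>_zero by simp
  qed
qed

lemma \<gamma>_chain: "\<gamma> \<in> chains perm_module 2"
proof -
  have supp: "c \<in> oriented_facets 2 \<and> c \<in> (\<lambda>(x, y). cyc v\<^sub>0 x y) ` (Star v\<^sub>0 \<times> Star v\<^sub>0)" if nz: "\<gamma> c \<noteq> 0" for c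
  proof -
    obtain x y where f: "fills x y c" using nz by (rule \<gamma>_nonzero)
    then have F: "{v\<^sub>0, x, y} \<in> facets 2" "c = cyc v\<^sub>0 x y" unfolding fills_def by auto
    then have "x \<in> Star v\<^sub>0" "y \<in> Star v\<^sub>0" unfolding Star_iff by (auto intro!: bexI[OF _ F(1)])
    then have "c \<in> (\<lambda>(x, y). cyc v\<^sub>0 x y) ` (Star v\<^sub>0 \<times> Star v\<^sub>0)" by (intro image_eqI[of _ _ "(x, y)"]) (simp_all add: F(2))
    moreover have "c \<in> oriented_facets 2" unfolding oriented_facets_two using F by blast
    ultimately show ?thesis by simp
  qed
  have "{c. \<gamma> c \<noteq> 0} \<subseteq> (\<lambda>(x, y). cyc v\<^sub>0 x y) ` (Star v\<^sub>0 \<times> Star v\<^sub>0)" using supp by blast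
  then have 1: "finite {c. \<gamma> c \<noteq> 0}" by (rule finite_subset) (simp add: finite_Star)
  have 2: "\<gamma> c = 0" if "c \<notin> oriented_facets 2" for c using supp that by blast
  have 3: "\<gamma> c \<in> perm_module" for c
    using \<gamma>_nonzero[of c] b_perm perm_module_simps(1) by metis
  have 4: "translate g (\<gamma> c) = \<gamma> c" if g: "g \<in> I\<^sub>F (underlying c)" for c g
  proof -
    have "fixed_by g (\<gamma> c)"
    proof (cases "\<gamma> c = 0")
      case False
      then obtain x y where f: "fills x y c" "\<gamma> c = b x y" by (rule \<gamma>_nonzero)
      then have F: "{v\<^sub>0, x, y} \<in> facets 2" "c = cyc v\<^sub>0 x y" "{x, y} \<noteq> {v\<^sub>1, v\<^sub>2}" unfolding fills_def by auto
      from F(1) obtain k where k: "k \<in> GLO" and xy: "{x, y} = {line_of k, point_of k}" by (rule link_edge)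
      have "g \<in> I\<^sub>F {v\<^sub>0, line_of k, point_of k}" using g unfolding F(2) underlying_simps xy .
      from chamber_imp_I[OF k this] show ?thesis unfolding f(2) by (rule b_chamber_fixed[OF k xy F(3)])
    qed (simp add: fixed_by_simps)
    then show ?thesis using translate_fixed_iff[OF det_I\<^sub>F[OF g] 3] by blast
  qed
  show ?thesis unfolding chains_def using 1 2 3 4 \<gamma>_opposite by simp
qed

definition \<alpha> :: "('K ^ 3) set set list set \<Rightarrow> (('K ^ 3 ^ 3) set \<Rightarrow>\<^sub>0 'k)" where
  "\<alpha> c = \<beta> c - boundary 1 \<gamma> c"

lemma \<alpha>_edge: "{x, y} \<in> facets 1 \<Longrightarrow> \<alpha> {[x, y]} = b x y - (\<Sum>z | {x, y, z} \<in> facets 2. \<gamma> (cyc z x y))"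
  unfolding \<alpha>_def boundary_edge b_def by simp

lemma \<alpha>_commute:
  assumes "{x, y} \<in> facets 1"
  shows "\<alpha> {[y, x]} = - \<alpha> {[x, y]}"
proof -
  have yx: "{y, x} \<in> facets 1" using assms by (simp only: insert_commute)
  have "{z. {y, x, z} \<in> facets 2} = {z. {x, y, z} \<in> facets 2}" by (simp only: insert_commute)
  then have "(\<Sum>z | {y, x, z} \<in> facets 2. \<gamma> (cyc z y x)) = (\<Sum>z | {x, y, z} \<in> facets 2. \<gamma> (cyc z y x))" by simp
  also have "\<dots> = (\<Sum>z | {x, y, z} \<in> facets 2. - \<gamma> (cyc z x y))"
  proof (rule sum.cong[OF refl])
    fix z assume "z \<in> {z. {x, y, z} \<in> facets 2}"
    then have "{z, x, y} \<in> facets 2" by (simp add: insert_commute)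
    then have "cyc z x y \<in> oriented_facets 2" unfolding oriented_facets_two by blast
    from \<gamma>_opposite[OF this] have "\<gamma> (cyc x z y) = - \<gamma> (cyc z x y)" by (simp only: opposite_cyc)
    then show "\<gamma> (cyc z y x) = - \<gamma> (cyc z x y)" by (simp only: cyc_rotate[of x z y])
  qed
  finally show ?thesis
    unfolding \<alpha>_edge[OF assms] \<alpha>_edge[OF yx] using b_neg[of x y] by (simp add: sum_negf)
qed

text \<open>Only the chamber spanned with \<open>v\<^sub>0\<close> contributes to the boundary of \<open>\<gamma>\<close>, and unless it is \<open>C\<close>, its contribution cancels
  \<open>\<beta>\<close>.\<close>

lemma \<alpha>_link:
  assumes e: "{x, y} \<in> facets 1" and ne: "x \<noteq> v\<^sub>0" "y \<noteq> v\<^sub>0"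
  shows "\<alpha> {[x, y]} = (if {x, y} = {v\<^sub>1, v\<^sub>2} then b x y else 0)"
proof -
  let ?N = "{z. {x, y, z} \<in> facets 2}"
  have x: "x \<in> vertices" using e unfolding facets_one_iff by blast
  have fin: "finite ?N" by (rule finite_chambers_at[OF x])
  have v0: "v\<^sub>0 \<in> ?N \<longleftrightarrow> {v\<^sub>0, x, y} \<in> facets 2" by (simp add: insert_commute)
  have "(\<Sum>z\<in>?N. \<gamma> (cyc z x y)) = (\<Sum>z\<in>?N. if z = v\<^sub>0 then \<gamma> (cyc v\<^sub>0 x y) else 0)"
  proof (rule sum.cong[OF refl])
    fix z
    show "\<gamma> (cyc z x y) = (if z = v\<^sub>0 then \<gamma> (cyc v\<^sub>0 x y) else 0)"
      using \<gamma>_zero[of "cyc z x y"] ne by (auto simp: underlying_simps)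
  qed
  also have "\<dots> = (if v\<^sub>0 \<in> ?N then \<gamma> (cyc v\<^sub>0 x y) else 0)" by (rule sum.delta[OF fin])
  finally have s: "(\<Sum>z\<in>?N. \<gamma> (cyc z x y)) = (if {v\<^sub>0, x, y} \<in> facets 2 then \<gamma> (cyc v\<^sub>0 x y) else 0)" by (simp only: v0)
  show ?thesis
  proof (cases "{v\<^sub>0, x, y} \<in> facets 2")
    case True
    then show ?thesis unfolding \<alpha>_edge[OF e] s by (simp add: \<gamma>_cyc[OF True])
  next
    case False
    then have "b x y = 0" using b_support edge_in_Star ne by blast
    then show ?thesis using False unfolding \<alpha>_edge[OF e] s by simp
  qed
qed

lemma \<alpha>_v\<^sub>0:
  assumes e: "{v\<^sub>0, y} \<in> facets 1"
  shows "\<alpha> {[v\<^sub>0, y]} = b v\<^sub>0 y - (\<Sum>z | {v\<^sub>0, y, z} \<in> facets 2. if {y, z} = {v\<^sub>1, v\<^sub>2} then 0 else b y z)"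
proof -
  have "(\<Sum>z | {v\<^sub>0, y, z} \<in> facets 2. \<gamma> (cyc z v\<^sub>0 y)) = (\<Sum>z | {v\<^sub>0, y, z} \<in> facets 2. if {y, z} = {v\<^sub>1, v\<^sub>2} then 0 else b y z)"
  proof (rule sum.cong[OF refl])
    fix z assume "z \<in> {z. {v\<^sub>0, y, z} \<in> facets 2}"
    then have "{v\<^sub>0, y, z} \<in> facets 2" by simp
    from \<gamma>_cyc[OF this] show "\<gamma> (cyc z v\<^sub>0 y) = (if {y, z} = {v\<^sub>1, v\<^sub>2} then 0 else b y z)"
      by (simp only: cyc_rotate[of z v\<^sub>0 y])
  qed
  then show ?thesis unfolding \<alpha>_edge[OF e] by simp
qed

text \<open>What the boundary of \<open>\<gamma>\<close> subtracts is, up to sign, the sum of \<open>\<beta>\<close> over the edges of the link with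
  target \<open>y\<close>. As \<open>\<beta>\<close> has no boundary at \<open>y\<close>, this is the value of \<open>\<beta>\<close> on \<open>[v\<^sub>0, y]\<close>.\<close>

lemma \<alpha>_v\<^sub>0_outside:
  assumes e: "{v\<^sub>0, y} \<in> facets 1" and y: "y \<notin> C"
  shows "\<alpha> {[v\<^sub>0, y]} = 0"
proof -
  have yv: "y \<in> vertices" "v\<^sub>0 \<in> vertices" "y \<noteq> v\<^sub>0" using e unfolding facets_one_iff by auto
  have nC: "{y, z} \<noteq> {v\<^sub>1, v\<^sub>2}" for z using y unfolding C_def by auto
  let ?N = "{z. {y, z} \<in> facets 1}" and ?T = "{z. {v\<^sub>0, y, z} \<in> facets 2}"
  have fin: "finite ?N" by (rule finite_edges_at[OF yv(1)])
  have v0: "v\<^sub>0 \<in> ?N" using e by (simp only: mem_Collect_eq insert_commute)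
  have T: "?T \<subseteq> ?N - {v\<^sub>0}" unfolding facets_two_iff facets_one_iff by auto
  have z0: "b z y = 0" if "z \<in> ?N - {v\<^sub>0} - ?T" for z
  proof (rule ccontr)
    assume "b z y \<noteq> 0"
    then have "z \<in> Star v\<^sub>0" "y \<in> Star v\<^sub>0" using b_support by auto
    then have "{v\<^sub>0, y, z} \<in> facets 2" using edge_in_Star[of y z] that yv(3) by simp
    then show False using that by simp
  qed
  have "(\<Sum>z\<in>?N. b z y) = b v\<^sub>0 y + (\<Sum>z\<in>?N - {v\<^sub>0}. b z y)" by (rule sum.remove[OF fin v0])
  also have "(\<Sum>z\<in>?N - {v\<^sub>0}. b z y) = (\<Sum>z\<in>?T. b z y)"
    by (rule sum.mono_neutral_right[OF _ T]) (use fin z0 in simp_all)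
  also have "\<dots> = - (\<Sum>z\<in>?T. b y z)" unfolding sum_negf[symmetric] by (intro sum.cong refl b_neg)
  finally have "b v\<^sub>0 y - (\<Sum>z\<in>?T. b y z) = 0" using b_sum[OF yv(1) y] by simp
  then show ?thesis unfolding \<alpha>_v\<^sub>0[OF e] using nC by simp
qed

text \<open>In a basis adapted to any chamber that contains the edge, the group of the edge lies in \<open>I\<close>. So it
  fixes all values that \<open>\<gamma>\<close> takes on such chambers.\<close>

lemma \<alpha>_v\<^sub>0_fixed:
  assumes e: "{v\<^sub>0, y} \<in> facets 1" and g: "g \<in> I\<^sub>F {v\<^sub>0, y}"
  shows "fixed_by g (\<alpha> {[v\<^sub>0, y]})"
  unfolding \<alpha>_v\<^sub>0[OF e]
proof (intro fixed_by_simps(3) fixed_by_simps(4) b_fixed[OF g])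
  fix z assume "z \<in> {z. {v\<^sub>0, y, z} \<in> facets 2}"
  then have F: "{v\<^sub>0, y, z} \<in> facets 2" by simp
  show "fixed_by g (if {y, z} = {v\<^sub>1, v\<^sub>2} then 0 else b y z)"
  proof (cases "{y, z} = {v\<^sub>1, v\<^sub>2}")
    case False
    from F obtain k where k: "k \<in> GLO" and yz: "{y, z} = {line_of k, point_of k}" by (rule link_edge)
    from yz have "y = line_of k \<or> y = point_of k" by (metis doubleton_eq_iff)
    then have "matrix_inv k ** g ** k \<in> I" using edge_v\<^sub>0_imp_I[OF k] g by auto
    from b_chamber_fixed[OF k yz False this] show ?thesis using False by simp
  qed (simp add: fixed_by_simps)
qed

lemma \<alpha>_perm: "\<alpha> {[x, y]} \<in> perm_module" if "{x, y} \<in> facets 1"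
proof -
  have "\<gamma> c \<in> perm_module" for c
    using \<gamma>_chain perm_module_simps(1) unfolding chains_def by (metis (mono_tags, lifting) mem_Collect_eq)
  then show ?thesis unfolding \<alpha>_edge[OF that] by (intro perm_module_simps b_perm)
qed

lemma \<alpha>_chain: "\<alpha> \<in> chains_in C perm_module 1"
proof -
  have van: "\<alpha> {[x, y]} = 0" if e: "{x, y} \<in> facets 1" and n: "\<not> {x, y} \<subseteq> C" for x y
  proof -
    have ne: "{x, y} \<noteq> {v\<^sub>1, v\<^sub>2}" using n unfolding C_def by auto
    have v0: "v\<^sub>0 \<in> C" by (simp add: C_def)
    consider "x = v\<^sub>0" | "y = v\<^sub>0" | "x \<noteq> v\<^sub>0" "y \<noteq> v\<^sub>0" by blast
    then show ?thesis
    proof cases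
      case 1
      then show ?thesis using \<alpha>_v\<^sub>0_outside[of y] e n v0 by simp
    next
      case 2
      have e': "{v\<^sub>0, x} \<in> facets 1" using e unfolding 2 by (simp only: insert_commute)
      have "x \<notin> C" using n v0 2 by simp
      from \<alpha>_v\<^sub>0_outside[OF e' this] show ?thesis using \<alpha>_commute[OF e'] 2 by simp
    next
      case 3
      then show ?thesis using \<alpha>_link[OF e 3] ne by simp
    qed
  qed
  have fixed: "fixed_by g (\<alpha> {[x, y]})" if e: "{x, y} \<in> facets 1" and g: "g \<in> I\<^sub>F {x, y}" for x y g
  proof -
    consider "x = v\<^sub>0" | "y = v\<^sub>0" | "x \<noteq> v\<^sub>0" "y \<noteq> v\<^sub>0" by blast
    then show ?thesis
    proof cases
      case 1
      then show ?thesis using \<alpha>_v\<^sub>0_fixed[of y g] e g by simp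
    next
      case 2
      have e': "{v\<^sub>0, x} \<in> facets 1" using e unfolding 2 by (simp only: insert_commute)
      have "g \<in> I\<^sub>F {v\<^sub>0, x}" using g unfolding 2 by (simp only: insert_commute)
      from fixed_by_simps(2)[OF \<alpha>_v\<^sub>0_fixed[OF e' this]] show ?thesis
        using \<alpha>_commute[OF e'] 2 by simp
    next
      case 3
      then show ?thesis unfolding \<alpha>_link[OF e 3] using b_fixed[OF g] by (simp add: fixed_by_simps)
    qed
  qed
  have off: "\<alpha> c = 0" if "c \<notin> oriented_facets 1" for c
    unfolding \<alpha>_def boundary_def using that \<beta>_chain(1)[OF that] by simp
  have edge: "\<exists>x y. c = {[x, y]} \<and> {x, y} \<in> facets 1" if "c \<in> oriented_facets 1" for c
    using that unfolding oriented_facets_one .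
  have supp: "c \<in> (\<lambda>(x, y). {[x, y]}) ` (C \<times> C)" if nz: "\<alpha> c \<noteq> 0" for c
  proof -
    obtain x y where c: "c = {[x, y]}" "{x, y} \<in> facets 1" using edge off nz by blast
    then have "{x, y} \<subseteq> C" using van that by blast
    then show ?thesis by (intro image_eqI[of _ _ "(x, y)"]) (simp_all add: c(1))
  qed
  have "finite (C \<times> C)" by (simp add: C_def)
  then have "finite ((\<lambda>(x, y). {[x, y]}) ` (C \<times> C))" by (rule finite_imageI)
  moreover have "{c. \<alpha> c \<noteq> 0} \<subseteq> (\<lambda>(x, y). {[x, y]}) ` (C \<times> C)" using supp by blast
  ultimately have 1: "finite {c. \<alpha> c \<noteq> 0}" by (rule rev_finite_subset)
  have 2: "\<alpha> c \<in> perm_module \<and> (\<forall>g\<in>I\<^sub>F (underlying c). translate g (\<alpha> c) = \<alpha> c) \<and> \<alpha> (opposite c) = - \<alpha> c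
      \<and> (\<not> underlying c \<subseteq> C \<longrightarrow> \<alpha> c = 0)"
    if co: "c \<in> oriented_facets 1" for c
  proof -
    obtain x y where c: "c = {[x, y]}" "{x, y} \<in> facets 1" using edge[OF co] by blast
    have "\<forall>g\<in>I\<^sub>F (underlying c). translate g (\<alpha> c) = \<alpha> c"
      unfolding c(1) underlying_simps using translate_fixed_iff[OF det_I\<^sub>F \<alpha>_perm[OF c(2)]] fixed[OF c(2)] by blast
    moreover have "\<alpha> (opposite c) = - \<alpha> c" unfolding c(1) opposite_two by (rule \<alpha>_commute[OF c(2)])
    moreover have "\<not> underlying c \<subseteq> C \<longrightarrow> \<alpha> c = 0" unfolding c(1) underlying_simps using van[OF c(2)] by blast
    moreover have "\<alpha> c \<in> perm_module" unfolding c(1) by (rule \<alpha>_perm[OF c(2)])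
    ultimately show ?thesis by blast
  qed
  show ?thesis unfolding chains_in_def chains_def using 1 2 off by simp
qed

lemma \<beta>_in_M: "\<beta> \<in> M C perm_module"
proof -
  have "\<beta> = (\<lambda>c. \<alpha> c + boundary 1 \<gamma> c)" by (simp add: \<alpha>_def)
  then show ?thesis unfolding M_def using \<alpha>_chain \<gamma>_chain by blast
qed

end

theorem theorem5p12:
  fixes \<iota> :: "'p :: prime_card padic \<Rightarrow> 'K :: field"
    and v :: "'K \<Rightarrow> int" and \<pi> :: 'K
  assumes "totally_ramified_extension \<iota> v \<pi>"
    and "range \<iota> \<noteq> UNIV"
    and "CHAR('k :: field) = CARD('p)"
  shows "totally_ramified_extension.collapsible \<iota> v \<pi>
    (totally_ramified_extension.Star v \<pi> (totally_ramified_extension.v\<^sub>0 v))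
    (totally_ramified_extension.C v \<pi>)
    (totally_ramified_extension.perm_module v :: (('K ^ 3 ^ 3) set \<Rightarrow>\<^sub>0 'k) set)"
proof -
  interpret totally_ramified_extension \<iota> v \<pi> by (rule assms(1))
  have "\<beta> \<in> M C (perm_module :: (('K ^ 3 ^ 3) set \<Rightarrow>\<^sub>0 'k) set)"
    if "\<beta> \<in> chains_in (Star v\<^sub>0) perm_module 1" "boundary 0 \<beta> \<in> chains_in C perm_module 0" for \<beta>
  proof -
    interpret star_chain \<iota> v \<pi> \<beta> using that by unfold_locales
    show ?thesis by (rule \<beta>_in_M)
  qed
  then show ?thesis
    unfolding collapsible_def using invariant_C invariant_Star C_subset_Star by blast
qed

end
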